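(* Let $X$ be a Riemannian manifold of dimension $n$, let $\Phi_I$ and $\Phi_{II}$ be $N$-functions, and let $1\le k\le n$. (A) If $T^k_{\Phi_I,\Phi_{II}}(X)=0$, then there exists a constant $C'$ such that for any differential form $\theta\in\Omega^{k-1}_{\Phi_I,\Phi_{II}}(X)$ there exists a closed form $\zeta\in Z^{k-1}_{\Phi_I}(X)$ such that $$\|\theta-\zeta\|_{(\Phi_I)}\le C'\,\|d\theta\|_{(\Phi_{II})}.$$ (B) Conversely, if $\Phi_{II}\in\Delta_2\cap\nabla_2$ and there exists a constant $C'$ such that for any form $\theta\in\Omega^{k-1}_{\Phi_I,\Phi_{II}}(X)$ there exists $\zeta\in Z^{k-1}_{\Phi_I}(X)$ with $\|\theta-\zeta\|_{(\Phi_I)}\le C'\,\|d\theta\|_{(\Phi_{II})}$, then $T^k_{\Phi_I,\Phi_{II}}(X)=0$.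
   Context: An $N$-function is a function $\Phi:\mathbb{R}\to[0,\infty)$ that is even and convex, with $\Phi(x)=0\iff x=0$, $\lim_{x\to0}\Phi(x)/x=0$ and $\lim_{x\to\infty}\Phi(x)/x=\infty$. $\Phi\in\Delta_2$ means there is a constant $K>2$ with $\Phi(2x)\le K\Phi(x)$ for all $x\ge0$; $\Phi\in\nabla_2$ means there is a constant $c>1$ with $\Phi(x)\le\frac1{2c}\Phi(cx)$ for all $x\ge0$. For a Riemannian manifold $X$ of dimension $n$ with volume element $d\mu_X$, and a measurable $k$-form $\omega$ on $X$ with pointwise norm $|\omega(x)|$ (induced by the Riemannian scalar product on exterior forms on $T_xX$), put $\rho_\Phi(\omega)=\int_X\Phi(|\omega(x)|)\,d\mu_X$. Forms differing on a set of measure zero are identified. $L^\Phi(X,\Lambda^k)$ is the space of measurable $k$-forms $\omega$ with $\rho_\Phi(\alpha\omega)<\infty$ for some $\alpha>0$, endowed with the gauge norm $\|\omega\|_{(\Phi)}=\inf\{K>0:\rho_\Phi(\omega/K)\le1\}$; it is a Banach space. Weak differential: a locally integrable $(j+1)$-form $\theta$ is the (weak) differential $d\omega$ of a locally integrable $j$-form $\omega$ if $\int_U\omega\wedge du=(-1)^{j+1}\int_U\theta\wedge u$ for every orientable domain $U\subset\mathrm{Int}\,X$ and every smooth compactly supported $(n-j-1)$-form $u$ with support in $U$. For $N$-functions $\Phi_I,\Phi_{II}$ put $\Omega^k_{\Phi_I,\Phi_{II}}(X)=\{\omega\in L^{\Phi_I}(X,\Lambda^k): d\omega\in L^{\Phi_{II}}(X,\Lambda^{k+1})\}$;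 $Z^k_{\Phi}(X)=\{\omega\in L^{\Phi}(X,\Lambda^k): d\omega=0\}$ for any $N$-function $\Phi$; $B^k_{\Phi_I,\Phi_{II}}(X)=\{\omega\in L^{\Phi_{II}}(X,\Lambda^k):\omega=d\beta\text{ for some }\beta\in L^{\Phi_I}(X,\Lambda^{k-1})\}$; $\overline B^k_{\Phi_I,\Phi_{II}}(X)$ is the closure of $B^k_{\Phi_I,\Phi_{II}}(X)$ in $L^{\Phi_{II}}(X,\Lambda^k)$. The $L_{\Phi_I,\Phi_{II}}$-torsion is $T^k_{\Phi_I,\Phi_{II}}(X)=\overline B^k_{\Phi_I,\Phi_{II}}(X)/B^k_{\Phi_I,\Phi_{II}}(X)$. *)

theory Defs
  imports "HOL-Analysis.Analysis" "HOL-Combinatorics.Permutations"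
begin

section \<open>N-functions\<close>

definition N_function :: "(real \<Rightarrow> real) \<Rightarrow> bool" where
  "N_function \<Phi> \<longleftrightarrow>
     (\<forall>x. 0 \<le> \<Phi> x) \<and> (\<forall>x. \<Phi> (- x) = \<Phi> x) \<and> convex_on UNIV \<Phi> \<and>
     (\<forall>x. \<Phi> x = 0 \<longleftrightarrow> x = 0) \<and>
     ((\<lambda>x. \<Phi> x / x) \<longlongrightarrow> 0) (at 0) \<and>
     filterlim (\<lambda>x. \<Phi> x / x) at_top at_top"

definition Delta2 :: "(real \<Rightarrow> real) \<Rightarrow> bool" where
  "Delta2 \<Phi> \<longleftrightarrow> (\<exists>K>2. \<forall>x\<ge>0. \<Phi> (2 * x) \<le> K * \<Phi> x)"

definition nabla2 :: "(real \<Rightarrow> real) \<Rightarrow> bool" where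
  "nabla2 \<Phi> \<longleftrightarrow> (\<exists>c>1. \<forall>x\<ge>0. \<Phi> x \<le> 1 / (2 * c) * \<Phi> (c * x))"


section \<open>Smooth maps\<close>

text \<open>\<open>Ck_on m S f\<close> is meant for open \<open>S\<close>.\<close>

primrec Ck_on :: "nat \<Rightarrow> 'e::euclidean_space set \<Rightarrow> ('e \<Rightarrow> 'f::euclidean_space) \<Rightarrow> bool" where
  "Ck_on 0 S f \<longleftrightarrow> continuous_on S f"
| "Ck_on (Suc m) S f \<longleftrightarrow>
     (\<forall>x\<in>S. f differentiable (at x)) \<and>
     (\<forall>v. Ck_on m S (\<lambda>x. frechet_derivative f (at x) v))"

text \<open>On a set that need not be open (an open piece of a closed half-space), a map is smooth if
  it extends smoothly to an open neighbourhood of every point.\<close>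

definition smooth_on :: "'e::euclidean_space set \<Rightarrow> ('e \<Rightarrow> 'f::euclidean_space) \<Rightarrow> bool" where
  "smooth_on S f \<longleftrightarrow>
     (\<forall>x\<in>S. \<exists>W F. open W \<and> x \<in> W \<and> (\<forall>m. Ck_on m W F) \<and> (\<forall>y\<in>S \<inter> W. F y = f y))"


section \<open>Riemannian manifolds\<close>

text \<open>The manifold is the whole type \<open>'a\<close> and its dimension is \<open>CARD('n)\<close>. A chart is a
  pair of its domain and its coordinate map. The manifold may have a boundary.\<close>

type_synonym ('a, 'n) chart = "'a set \<times> ('a \<Rightarrow> real ^ 'n)"

definition chart_inv :: "('a, 'n::finite) chart \<Rightarrow> real ^ 'n \<Rightarrow> 'a" where
  "chart_inv c = inv_into (fst c) (snd c)"

definition basis_enum :: "nat \<Rightarrow> 'n::finite" where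
  "basis_enum = (SOME e. bij_betw e {..<CARD('n)} UNIV)"

definition coord_frame :: "nat \<Rightarrow> real ^ 'n::finite" where
  "coord_frame i = axis (basis_enum i) 1"

definition half_space :: "(real ^ 'n::finite) set" where
  "half_space = {y. 0 \<le> y $ basis_enum 0}"

definition is_chart :: "('a::topological_space, 'n::finite) chart \<Rightarrow> bool" where
  "is_chart c \<longleftrightarrow>
     open (fst c) \<and>
     (open (snd c ` fst c) \<or> openin (top_of_set half_space) (snd c ` fst c)) \<and>
     homeomorphism (fst c) (snd c ` fst c) (snd c) (chart_inv c)"

definition transition :: "('a, 'n::finite) chart \<Rightarrow> ('a, 'n) chart \<Rightarrow> real ^ 'n \<Rightarrow> real ^ 'n" where
  "transition c c' = snd c' \<circ> chart_inv c"

definition transition_deriv ::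
    "('a, 'n::finite) chart \<Rightarrow> ('a, 'n) chart \<Rightarrow> 'a \<Rightarrow> real ^ 'n \<Rightarrow> real ^ 'n" where
  "transition_deriv c c' x =
     frechet_derivative (transition c c') (at (snd c x) within snd c ` (fst c \<inter> fst c'))"

text \<open>\<open>metric X c x\<close> is the Gram matrix of the Riemannian metric at \<open>x\<close> with respect to the
  coordinate vectors of the chart \<open>c\<close>.\<close>

record ('a, 'n) riemannian =
  atlas :: "('a, 'n) chart set"
  metric :: "('a, 'n) chart \<Rightarrow> 'a \<Rightarrow> real ^ 'n ^ 'n"

definition smooth_atlas :: "('a::topological_space, 'n::finite) chart set \<Rightarrow> bool" where
  "smooth_atlas A \<longleftrightarrow>
     (\<forall>c\<in>A. is_chart c) \<and> (\<Union>c\<in>A. fst c) = UNIV \<and>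
     (\<forall>c\<in>A. \<forall>c'\<in>A. smooth_on (snd c ` (fst c \<inter> fst c')) (transition c c'))"

definition riemannian_metric ::
    "('a::topological_space, 'n::finite) riemannian \<Rightarrow> bool" where
  "riemannian_metric X \<longleftrightarrow>
     (\<forall>c\<in>atlas X. \<forall>x\<in>fst c.
        transpose (metric X c x) = metric X c x \<and>
        (\<forall>v. v \<noteq> 0 \<longrightarrow> 0 < v \<bullet> (metric X c x *v v))) \<and>
     (\<forall>c\<in>atlas X. \<forall>c'\<in>atlas X. \<forall>x\<in>fst c \<inter> fst c'. \<forall>v w.
        v \<bullet> (metric X c x *v w) =
        transition_deriv c c' x v \<bullet> (metric X c' x *v transition_deriv c c' x w)) \<and>
     (\<forall>c\<in>atlas X. smooth_on (snd c ` fst c) (\<lambda>y. metric X c (chart_inv c y)))"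

definition riemannian_manifold ::
    "('a::{t2_space, second_countable_topology}, 'n::finite) riemannian \<Rightarrow> bool" where
  "riemannian_manifold X \<longleftrightarrow> smooth_atlas (atlas X) \<and> riemannian_metric X"

definition manifold_interior :: "('a, 'n::finite) riemannian \<Rightarrow> 'a set" where
  "manifold_interior X =
     {x. \<exists>c\<in>atlas X. x \<in> fst c \<and> snd c x \<in> interior (snd c ` fst c)}"

text \<open>The Riemannian volume is the Borel measure given by \<open>sqrt (det g) dx\<close> in every chart;
  this determines it uniquely.\<close>

definition riemannian_volume ::
    "('a::topological_space, 'n::finite) riemannian \<Rightarrow> 'a measure \<Rightarrow> bool" where
  "riemannian_volume X \<mu> \<longleftrightarrow>
     sets \<mu> = sets borel \<and>
     (\<forall>c\<in>atlas X. \<forall>A\<in>sets borel. A \<subseteq> fst c \<longrightarrow>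
        emeasure \<mu> A =
          (\<integral>\<^sup>+y\<in>snd c ` A. ennreal (sqrt (det (metric X c (chart_inv c y)))) \<partial>lborel))"


section \<open>Exterior algebra\<close>

text \<open>A \<open>k\<close>-covector is an alternating \<open>k\<close>-linear function of the entries \<open>0, \<dots>, k - 1\<close> of a
  sequence of vectors; it ignores all other entries.\<close>

type_synonym 'n covector = "(nat \<Rightarrow> real ^ 'n) \<Rightarrow> real"

definition alternating :: "nat \<Rightarrow> 'n::finite covector \<Rightarrow> bool" where
  "alternating k \<alpha> \<longleftrightarrow>
     (\<forall>v. \<forall>i<k. linear (\<lambda>w. \<alpha> (v(i := w)))) \<and>
     (\<forall>v. \<forall>i<k. \<forall>j<k. i \<noteq> j \<and> v i = v j \<longrightarrow> \<alpha> v = 0) \<and>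
     (\<forall>v w. (\<forall>i<k. v i = w i) \<longrightarrow> \<alpha> v = \<alpha> w)"

definition wedge :: "nat \<Rightarrow> nat \<Rightarrow> 'n::finite covector \<Rightarrow> 'n covector \<Rightarrow> 'n covector" where
  "wedge p q \<alpha> \<beta> = (\<lambda>v.
     (\<Sum>\<sigma> | \<sigma> permutes {..<p + q}.
        of_int (sign \<sigma>) * \<alpha> (\<lambda>i. v (\<sigma> i)) * \<beta> (\<lambda>i. v (\<sigma> (p + i)))) / (fact p * fact q))"

text \<open>The norm for the scalar product on \<open>k\<close>-covectors induced by the Gram matrix \<open>g\<close>: the sum
  contracts the components of \<open>\<alpha>\<close> with themselves through \<open>k\<close> copies of the inverse of \<open>g\<close>. The
  factor \<open>1 / k!\<close> makes wedge products of distinct members of an orthonormal coframe unit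
  covectors.\<close>

definition covector_norm :: "real ^ 'n ^ 'n \<Rightarrow> nat \<Rightarrow> 'n::finite covector \<Rightarrow> real" where
  "covector_norm g k \<alpha> = sqrt (
     (\<Sum>I\<in>{..<k} \<rightarrow>\<^sub>E UNIV. \<Sum>J\<in>{..<k} \<rightarrow>\<^sub>E UNIV.
        (\<Prod>a<k. matrix_inv g $ I a $ J a) *
        \<alpha> (\<lambda>a. axis (I a) 1) * \<alpha> (\<lambda>a. axis (J a) 1)) / fact k)"


section \<open>Differential forms\<close>

text \<open>A differential form is a family of local representatives, one for each chart, that are
  related by pullback along the transition maps. The values \<open>\<omega> c x\<close> for \<open>c\<close> outside the atlas
  or \<open>x\<close> outside the domain of \<open>c\<close> play no role.\<close>

type_synonym ('a, 'n) form = "('a, 'n) chart \<Rightarrow> 'a \<Rightarrow> 'n covector"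

definition is_form :: "('a, 'n::finite) riemannian \<Rightarrow> nat \<Rightarrow> ('a, 'n) form \<Rightarrow> bool" where
  "is_form X k \<omega> \<longleftrightarrow>
     (\<forall>c\<in>atlas X. \<forall>x\<in>fst c. alternating k (\<omega> c x)) \<and>
     (\<forall>c\<in>atlas X. \<forall>c'\<in>atlas X. \<forall>x\<in>fst c \<inter> fst c'. \<forall>v.
        \<omega> c x v = \<omega> c' x (\<lambda>i. transition_deriv c c' x (v i)))"

definition zero_form :: "('a, 'n::finite) form" where
  "zero_form = (\<lambda>c x v. 0)"

definition scale_form :: "real \<Rightarrow> ('a, 'n::finite) form \<Rightarrow> ('a, 'n) form" where
  "scale_form a \<omega> = (\<lambda>c x v. a * \<omega> c x v)"

definition wedge_form ::
    "nat \<Rightarrow> nat \<Rightarrow> ('a, 'n::finite) form \<Rightarrow> ('a, 'n) form \<Rightarrow> ('a, 'n) form" where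
  "wedge_form p q \<omega> \<eta> = (\<lambda>c x. wedge p q (\<omega> c x) (\<eta> c x))"

text \<open>The exterior derivative of a smooth \<open>m\<close>-form. In a chart, \<open>du(v 0, \<dots>, v m)\<close> is the sum
  over \<open>i\<close> of \<open>(-1) ^ i\<close> times the derivative in direction \<open>v i\<close> of \<open>u\<close> applied to the remaining
  (constant) vectors.\<close>

definition ext_deriv :: "nat \<Rightarrow> ('a, 'n::finite) form \<Rightarrow> ('a, 'n) form" where
  "ext_deriv m u = (\<lambda>c x v. \<Sum>i\<le>m. (-1) ^ i *
     frechet_derivative
       (\<lambda>y. u c (chart_inv c y) (\<lambda>j. if j < i then v j else v (Suc j)))
       (at (snd c x) within snd c ` fst c) (v i))"

definition smooth_form :: "('a, 'n::finite) riemannian \<Rightarrow> nat \<Rightarrow> ('a, 'n) form \<Rightarrow> bool" where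
  "smooth_form X k u \<longleftrightarrow> is_form X k u \<and>
     (\<forall>c\<in>atlas X. \<forall>v. smooth_on (snd c ` fst c) (\<lambda>y. u c (chart_inv c y) v))"

definition form_support ::
    "('a::topological_space, 'n::finite) riemannian \<Rightarrow> ('a, 'n) form \<Rightarrow> 'a set" where
  "form_support X u = closure {x. \<exists>c\<in>atlas X. x \<in> fst c \<and> (\<exists>v. u c x v \<noteq> 0)}"

text \<open>An arbitrary chart around \<open>x\<close>. Neither the pointwise norm nor the integrand of an
  \<open>n\<close>-form below depends on its choice.\<close>

definition chart_at :: "('a, 'n::finite) riemannian \<Rightarrow> 'a \<Rightarrow> ('a, 'n) chart" where
  "chart_at X x = (SOME c. c \<in> atlas X \<and> x \<in> fst c)"

definition form_norm ::
    "('a, 'n::finite) riemannian \<Rightarrow> nat \<Rightarrow> ('a, 'n) form \<Rightarrow> 'a \<Rightarrow> real" where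
  "form_norm X k \<omega> x =
     (let c = chart_at X x in covector_norm (metric X c x) k (\<omega> c x))"

text \<open>An orientation of \<open>U\<close> tells for each chart \<open>c\<close> and point \<open>x\<close> whether the coordinate frame
  of \<open>c\<close> at \<open>x\<close> is positive (\<open>1\<close>) or negative (\<open>-1\<close>). An \<open>n\<close>-form on \<open>U\<close> is a function times
  the volume form of the oriented Riemannian manifold \<open>U\<close>, and its integral is the integral of
  that function against the Riemannian volume.\<close>

definition orientation ::
    "('a::topological_space, 'n::finite) riemannian \<Rightarrow> 'a set \<Rightarrow>
     (('a, 'n) chart \<Rightarrow> 'a \<Rightarrow> real) \<Rightarrow> bool" where
  "orientation X U s \<longleftrightarrow>
     (\<forall>c\<in>atlas X. continuous_on (U \<inter> fst c) (s c) \<and> (\<forall>x\<in>U \<inter> fst c. s c x \<in> {1, -1})) \<and>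
     (\<forall>c\<in>atlas X. \<forall>c'\<in>atlas X. \<forall>x\<in>U \<inter> fst c \<inter> fst c'.
        s c x = sgn (det (matrix (transition_deriv c c' x))) * s c' x)"

definition form_integral ::
    "('a, 'n::finite) riemannian \<Rightarrow> 'a measure \<Rightarrow> (('a, 'n) chart \<Rightarrow> 'a \<Rightarrow> real) \<Rightarrow>
     'a set \<Rightarrow> ('a, 'n) form \<Rightarrow> real" where
  "form_integral X \<mu> s U \<tau> =
     (LINT x:U|completion \<mu>.
        (let c = chart_at X x in s c x * \<tau> c x coord_frame / sqrt (det (metric X c x))))"


section \<open>Measurable forms and the weak differential\<close>

definition measurable_form ::
    "('a, 'n::finite) riemannian \<Rightarrow> 'a measure \<Rightarrow> nat \<Rightarrow> ('a, 'n) form \<Rightarrow> bool" where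
  "measurable_form X \<mu> k \<omega> \<longleftrightarrow> is_form X k \<omega> \<and>
     (\<forall>c\<in>atlas X. \<forall>v.
        (\<lambda>x. \<omega> c x v) \<in> borel_measurable (restrict_space (completion \<mu>) (fst c)))"

definition locally_integrable_form ::
    "('a::topological_space, 'n::finite) riemannian \<Rightarrow> 'a measure \<Rightarrow> nat \<Rightarrow>
     ('a, 'n) form \<Rightarrow> bool" where
  "locally_integrable_form X \<mu> k \<omega> \<longleftrightarrow> measurable_form X \<mu> k \<omega> \<and>
     (\<forall>K. compact K \<longrightarrow>
        (\<integral>\<^sup>+x\<in>K. ennreal (form_norm X k \<omega> x) \<partial>completion \<mu>) < \<infinity>)"

text \<open>\<open>weak_differential X \<mu> j \<omega> \<theta>\<close> says that the \<open>(j + 1)\<close>-form \<open>\<theta>\<close> is the weak differential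
  of the \<open>j\<close>-form \<open>\<omega>\<close>, for \<open>j < CARD('n)\<close>. It is a relation because \<open>\<theta>\<close> is determined only up
  to null sets.\<close>

definition weak_differential ::
    "('a::topological_space, 'n::finite) riemannian \<Rightarrow> 'a measure \<Rightarrow> nat \<Rightarrow>
     ('a, 'n) form \<Rightarrow> ('a, 'n) form \<Rightarrow> bool" where
  "weak_differential X \<mu> j \<omega> \<theta> \<longleftrightarrow>
     locally_integrable_form X \<mu> j \<omega> \<and> locally_integrable_form X \<mu> (j + 1) \<theta> \<and>
     (\<forall>U s u.
        open U \<and> connected U \<and> U \<subseteq> manifold_interior X \<and> orientation X U s \<and>
        smooth_form X (CARD('n) - j - 1) u \<and>
        compact (form_support X u) \<and> form_support X u \<subseteq> U \<longrightarrow>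
        form_integral X \<mu> s U
          (wedge_form j (CARD('n) - j) \<omega> (ext_deriv (CARD('n) - j - 1) u)) =
        (-1) ^ (j + 1) *
        form_integral X \<mu> s U (wedge_form (j + 1) (CARD('n) - j - 1) \<theta> u))"


section \<open>Orlicz spaces of forms and the torsion\<close>

text \<open>The spaces below consist of forms rather than of classes of forms modulo equality almost
  everywhere. All of them, and the gauge norm, are invariant under changes on null sets.\<close>

definition modular ::
    "('a, 'n::finite) riemannian \<Rightarrow> 'a measure \<Rightarrow> (real \<Rightarrow> real) \<Rightarrow> nat \<Rightarrow>
     ('a, 'n) form \<Rightarrow> ennreal" where
  "modular X \<mu> \<Phi> k \<omega> = (\<integral>\<^sup>+x. ennreal (\<Phi> (form_norm X k \<omega> x)) \<partial>completion \<mu>)"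

definition Orlicz_forms ::
    "('a, 'n::finite) riemannian \<Rightarrow> 'a measure \<Rightarrow> (real \<Rightarrow> real) \<Rightarrow> nat \<Rightarrow>
     ('a, 'n) form set" where
  "Orlicz_forms X \<mu> \<Phi> k =
     {\<omega>. measurable_form X \<mu> k \<omega> \<and> (\<exists>a>0. modular X \<mu> \<Phi> k (scale_form a \<omega>) < \<infinity>)}"

definition gauge_norm ::
    "('a, 'n::finite) riemannian \<Rightarrow> 'a measure \<Rightarrow> (real \<Rightarrow> real) \<Rightarrow> nat \<Rightarrow>
     ('a, 'n) form \<Rightarrow> real" where
  "gauge_norm X \<mu> \<Phi> k \<omega> = Inf {K. 0 < K \<and> modular X \<mu> \<Phi> k (scale_form (1 / K) \<omega>) \<le> 1}"

definition Omega_forms ::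
    "('a::topological_space, 'n::finite) riemannian \<Rightarrow> 'a measure \<Rightarrow> (real \<Rightarrow> real) \<Rightarrow>
     (real \<Rightarrow> real) \<Rightarrow> nat \<Rightarrow> ('a, 'n) form set" where
  "Omega_forms X \<mu> \<Phi>1 \<Phi>2 k =
     {\<omega> \<in> Orlicz_forms X \<mu> \<Phi>1 k.
        \<exists>\<theta>\<in>Orlicz_forms X \<mu> \<Phi>2 (k + 1). weak_differential X \<mu> k \<omega> \<theta>}"

definition closed_forms ::
    "('a::topological_space, 'n::finite) riemannian \<Rightarrow> 'a measure \<Rightarrow> (real \<Rightarrow> real) \<Rightarrow>
     nat \<Rightarrow> ('a, 'n) form set" where
  "closed_forms X \<mu> \<Phi> k =
     {\<omega> \<in> Orlicz_forms X \<mu> \<Phi> k. weak_differential X \<mu> k \<omega> zero_form}"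

text \<open>For \<open>k \<ge> 1\<close>.\<close>

definition exact_forms ::
    "('a::topological_space, 'n::finite) riemannian \<Rightarrow> 'a measure \<Rightarrow> (real \<Rightarrow> real) \<Rightarrow>
     (real \<Rightarrow> real) \<Rightarrow> nat \<Rightarrow> ('a, 'n) form set" where
  "exact_forms X \<mu> \<Phi>1 \<Phi>2 k =
     {\<omega> \<in> Orlicz_forms X \<mu> \<Phi>2 k.
        \<exists>\<beta>\<in>Orlicz_forms X \<mu> \<Phi>1 (k - 1). weak_differential X \<mu> (k - 1) \<beta> \<omega>}"

definition exact_forms_closure ::
    "('a::topological_space, 'n::finite) riemannian \<Rightarrow> 'a measure \<Rightarrow> (real \<Rightarrow> real) \<Rightarrow>
     (real \<Rightarrow> real) \<Rightarrow> nat \<Rightarrow> ('a, 'n) form set" where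
  "exact_forms_closure X \<mu> \<Phi>1 \<Phi>2 k =
     {\<omega> \<in> Orlicz_forms X \<mu> \<Phi>2 k.
        \<forall>\<epsilon>>0. \<exists>\<eta>\<in>exact_forms X \<mu> \<Phi>1 \<Phi>2 k. gauge_norm X \<mu> \<Phi>2 k (\<omega> - \<eta>) < \<epsilon>}"

text \<open>The torsion is the set of cosets of \<open>exact_forms\<close> in its closure. Its zero element is the
  coset \<open>exact_forms\<close> itself.\<close>

definition torsion ::
    "('a::topological_space, 'n::finite) riemannian \<Rightarrow> 'a measure \<Rightarrow> (real \<Rightarrow> real) \<Rightarrow>
     (real \<Rightarrow> real) \<Rightarrow> nat \<Rightarrow> ('a, 'n) form set set" where
  "torsion X \<mu> \<Phi>1 \<Phi>2 k =
     exact_forms_closure X \<mu> \<Phi>1 \<Phi>2 k //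
       {(\<omega>, \<eta>). \<omega> \<in> exact_forms_closure X \<mu> \<Phi>1 \<Phi>2 k \<and> \<eta> \<in> exact_forms_closure X \<mu> \<Phi>1 \<Phi>2 k \<and>
                \<omega> - \<eta> \<in> exact_forms X \<mu> \<Phi>1 \<Phi>2 k}"

end

theory Submission
  imports Defs "HOL-Library.Function_Algebras"
begin

text \<open>
  The weak differential is a closed linear relation between the complete seminormed spaces
  \<open>L(\<Phi>1)\<close> of \<open>(k - 1)\<close>-forms and \<open>L(\<Phi>2)\<close> of \<open>k\<close>-forms. Its range is the space of exact forms and its
  kernel the space of closed forms. The torsion vanishes precisely when the range is closed
  (lemma \<open>cosets_eq_singleton_iff\<close>), and for a closed relation this is equivalent to an
  estimate for preimages modulo the kernel.

  If the range is closed, it is complete, and the open mapping theorem gives the estimate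
  (\<open>closed_range_imp_bounded_below\<close>). Conversely, given the estimate, a limit of exact forms is the
  sum of a rapidly convergent series of exact forms; primitives of the terms can be chosen with
  summable norms, and their sum is a primitive of the limit (\<open>bounded_below_imp_closed_range\<close>).

  The remaining work is to show that the weak differential fits this pattern. Completeness of
  the Orlicz spaces (\<open>Orlicz_complete\<close>) is the theorem of Riesz and Fischer, based on Jensen's
  inequality and monotone convergence. For closedness
  (\<open>closed_linear_relation_differential\<close>) one fixes a test form \<open>u\<close> and passes to the limit in the
  integrals of \<open>\<omega> \<and> du\<close> and of \<open>\<theta> \<and> u\<close>. Both integrands are bounded by a multiple of the norm of
  the form on the compact support of \<open>u\<close>, and there the gauge norm dominates the \<open>L\<^sup>1\<close> norm
  (\<open>Orlicz_integrable_compact\<close>).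

  The integrands are defined in an arbitrary chart at each point, so their measurability rests
  on independence of the chart. This requires that an \<open>n\<close>-form transforms with the determinant of
  the Jacobian (\<open>top_degree_det\<close>) and that the exterior derivative of \<open>u\<close> is compatible with
  transition maps (\<open>ext_deriv_transition\<close>), which in turn rests on the symmetry of second derivatives. The
  pointwise norm is independent of the chart because it is the norm of the values on an
  orthonormal basis (\<open>covector_norm_orthonormal\<close>).
\<close>

section \<open>Closed linear relations between complete seminormed spaces\<close>

text \<open>Forms are functions, so this makes them a real vector space with pointwise operations.\<close>

instantiation "fun" :: (type, real_vector) real_vector
begin

definition scaleR_fun_def: "a *\<^sub>R f = (\<lambda>x. a *\<^sub>R f x)"

instance
  by standard (auto simp: scaleR_fun_def fun_eq_iff algebra_simps)

end

lemma scaleR_fun_apply [simp]: "(a *\<^sub>R f) x = a *\<^sub>R f x"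
  by (simp add: scaleR_fun_def)

text \<open>Completeness is stated for absolutely convergent series, which is how the Riesz-Fischer argument
  yields it. Limits need not be unique, because forms that agree almost everywhere are not
  identified.\<close>

locale complete_seminormed =
  fixes V :: "'v::real_vector set" and p :: "'v \<Rightarrow> real"
  assumes subspace: "subspace V"
    and nonneg: "x \<in> V \<Longrightarrow> 0 \<le> p x"
    and triangle: "x \<in> V \<Longrightarrow> y \<in> V \<Longrightarrow> p (x + y) \<le> p x + p y"
    and scale: "x \<in> V \<Longrightarrow> p (a *\<^sub>R x) = \<bar>a\<bar> * p x"
    and complete: "(\<And>i. s i \<in> V) \<Longrightarrow> summable (\<lambda>i. p (s i)) \<Longrightarrow>
      \<exists>x\<in>V. (\<lambda>m. p (x - (\<Sum>i<m. s i))) \<longlonglongrightarrow> 0"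
begin

lemma zero_mem: "0 \<in> V"
  and add_mem: "x \<in> V \<Longrightarrow> y \<in> V \<Longrightarrow> x + y \<in> V"
  and diff_mem: "x \<in> V \<Longrightarrow> y \<in> V \<Longrightarrow> x - y \<in> V"
  and scale_mem: "x \<in> V \<Longrightarrow> a *\<^sub>R x \<in> V"
  and sum_mem: "(\<And>i. i \<in> I \<Longrightarrow> s i \<in> V) \<Longrightarrow> sum s I \<in> V"
  using subspace by (auto intro: subspace_0 subspace_add subspace_diff subspace_scale subspace_sum)

lemma zero: "p 0 = 0"
  using scale[OF zero_mem, of 0] by simp

lemma minus_commute: "x \<in> V \<Longrightarrow> y \<in> V \<Longrightarrow> p (x - y) = p (y - x)"
  using scale[OF diff_mem, of x y "- 1"] by simp

lemma diff_triangle: "x \<in> V \<Longrightarrow> y \<in> V \<Longrightarrow> z \<in> V \<Longrightarrow> p (x - z) \<le> p (x - y) + p (y - z)"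
  using triangle[OF diff_mem diff_mem, of x y y z] by simp

lemma triangle_diff: "x \<in> V \<Longrightarrow> y \<in> V \<Longrightarrow> p x \<le> p y + p (x - y)"
  using triangle[OF _ diff_mem, of y x y] by simp

lemma diff_le: "x \<in> V \<Longrightarrow> y \<in> V \<Longrightarrow> p (x - y) \<le> p x + p y"
  using triangle[of x "- y"] scale[of y "-1"] scale_mem[of y "-1"] by simp

lemma sum_le: "(\<And>i. i \<in> I \<Longrightarrow> s i \<in> V) \<Longrightarrow> p (sum s I) \<le> (\<Sum>i\<in>I. p (s i))"
proof (induction I rule: infinite_finite_induct)
  case (insert i I)
  then have "p (sum s (insert i I)) \<le> p (s i) + p (sum s I)"
    using triangle[of "s i" "sum s I"] sum_mem[of I s] by simp
  with insert show ?case by fastforce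
qed (simp_all add: zero)

end

text \<open>A closed operator, possibly unbounded and not everywhere defined. It is a relation because the
  weak differential is determined only up to null sets.\<close>

locale closed_linear_relation =
  dom: complete_seminormed V p + cod: complete_seminormed W q
  for V :: "'v::real_vector set" and p and W :: "'w::real_vector set" and q +
  fixes G :: "('v \<times> 'w) set"
  assumes graph_subspace: "subspace G"
    and graph_subset: "G \<subseteq> V \<times> W"
    and graph_closed: "(\<And>m. (x m, y m) \<in> G) \<Longrightarrow> x' \<in> V \<Longrightarrow> y' \<in> W \<Longrightarrow>
      (\<lambda>m. p (x' - x m)) \<longlonglongrightarrow> 0 \<Longrightarrow> (\<lambda>m. q (y' - y m)) \<longlonglongrightarrow> 0 \<Longrightarrow> (x', y') \<in> G"
begin

definition closed_range :: bool where
  "closed_range \<longleftrightarrow> (\<forall>y\<in>W. (\<forall>\<epsilon>>0. \<exists>z\<in>Range G. q (y - z) < \<epsilon>) \<longrightarrow> y \<in> Range G)"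

text \<open>The pairs \<open>(z, 0)\<close> play the role of the kernel, so \<open>C\<close> bounds the inverse of the operator that is
  induced on the quotient by the kernel.\<close>

definition bounded_below_mod_kernel :: "real \<Rightarrow> bool" where
  "bounded_below_mod_kernel C \<longleftrightarrow>
     (\<forall>(x, y)\<in>G. \<exists>z. (z, 0) \<in> G \<and> p (x - z) \<le> C * q y)"

lemma graph_mem: "(x, y) \<in> G \<Longrightarrow> x \<in> V" "(x, y) \<in> G \<Longrightarrow> y \<in> W"
  using graph_subset by auto

lemma Range_mem: "y \<in> Range G \<Longrightarrow> y \<in> W"
  using graph_subset by auto

lemma graph_add: "(x, y) \<in> G \<Longrightarrow> (x', y') \<in> G \<Longrightarrow> (x + x', y + y') \<in> G"
  using subspace_add[OF graph_subspace] by fastforce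

lemma graph_diff: "(x, y) \<in> G \<Longrightarrow> (x', y') \<in> G \<Longrightarrow> (x - x', y - y') \<in> G"
  using subspace_diff[OF graph_subspace] by fastforce

lemma graph_scale: "(x, y) \<in> G \<Longrightarrow> (a *\<^sub>R x, a *\<^sub>R y) \<in> G"
  using subspace_scale[OF graph_subspace] by fastforce

lemma graph_zero: "(0, 0) \<in> G"
  using subspace_0[OF graph_subspace] by (simp add: zero_prod_def)

lemma graph_sum: "(\<And>i. i \<in> I \<Longrightarrow> (x i, y i) \<in> G) \<Longrightarrow> (sum x I, sum y I) \<in> G"
  by (induction I rule: infinite_finite_induct) (auto intro: graph_add graph_zero)

lemma Range_subspace: "subspace (Range G)"
  unfolding subspace_def
  using graph_zero graph_add graph_scale by (meson Range.intros RangeE)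

text \<open>Completeness of the source and closedness of the graph together let one lift a convergent
  series term by term.\<close>

lemma lift_series:
  assumes "\<And>i. (x i, y i) \<in> G" and "summable (\<lambda>i. p (x i))"
    and "y' \<in> W" and "(\<lambda>m. q (y' - (\<Sum>i<m. y i))) \<longlonglongrightarrow> 0"
  shows "\<exists>x'. (x', y') \<in> G \<and> p x' \<le> (\<Sum>i. p (x i))"
proof -
  have xV: "x i \<in> V" for i
    using assms(1) graph_mem by blast
  obtain x' where x': "x' \<in> V" "(\<lambda>m. p (x' - (\<Sum>i<m. x i))) \<longlonglongrightarrow> 0"
    using dom.complete[OF xV assms(2)] by blast
  have "(x', y') \<in> G"
    by (rule graph_closed[OF graph_sum x'(1) assms(3) x'(2) assms(4)]) (rule assms(1))
  moreover have "p x' \<le> (\<Sum>i. p (x i))"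
  proof (rule LIMSEQ_le_const)
    show "(\<lambda>m. (\<Sum>i. p (x i)) + p (x' - (\<Sum>i<m. x i))) \<longlonglongrightarrow> (\<Sum>i. p (x i))"
      using tendsto_add[OF tendsto_const x'(2)] by simp
    have "p x' \<le> (\<Sum>i. p (x i)) + p (x' - (\<Sum>i<m. x i))" for m
    proof -
      have "p x' \<le> p (\<Sum>i<m. x i) + p (x' - (\<Sum>i<m. x i))"
        by (intro dom.triangle_diff x' dom.sum_mem xV)
      moreover have "p (\<Sum>i<m. x i) \<le> (\<Sum>i<m. p (x i))"
        by (intro dom.sum_le xV)
      moreover have "(\<Sum>i<m. p (x i)) \<le> (\<Sum>i. p (x i))"
        by (intro sum_le_suminf assms(2)) (auto intro: dom.nonneg xV)
      ultimately show ?thesis by linarith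
    qed
    then show "\<exists>N. \<forall>m\<ge>N. p x' \<le> (\<Sum>i. p (x i)) + p (x' - (\<Sum>i<m. x i))"
      by blast
  qed
  ultimately show ?thesis by blast
qed

text \<open>This is Baire's argument. If the images of balls were nowhere dense in the closed range, nested
  small balls in the range would avoid the image of the ball of radius \<open>n\<close> at step \<open>n\<close>. Their common
  point would lie in the range without having a preimage of any norm.\<close>

lemma approximate_preimages_small_ball:
  assumes "closed_range"
  shows "\<exists>r>0. \<forall>y\<in>Range G. q y < r \<longrightarrow> (\<forall>\<epsilon>>0. \<exists>(x, z)\<in>G. p x \<le> 1 \<and> q (y - z) < \<epsilon>)"
proof (rule ccontr)
  assume contra: "\<not> ?thesis"
  define far where "far N a \<epsilon> \<longleftrightarrow> (\<forall>(x, z)\<in>G. p x \<le> N \<longrightarrow> \<epsilon> \<le> q (a - z))" for N a \<epsilon>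
  have small_far: "\<exists>y\<in>Range G. q y < r \<and> (\<exists>\<epsilon>>0. far N y \<epsilon>)" if "0 < r" "0 < N" for r N :: real
  proof -
    have "0 < r / N" using that by simp
    then obtain y \<epsilon> where y: "y \<in> Range G" "q y < r / N" "\<epsilon> > 0"
      and *: "\<And>x z. (x, z) \<in> G \<Longrightarrow> p x \<le> 1 \<Longrightarrow> \<epsilon> \<le> q (y - z)"
      using contra by (force simp: not_less)
    have "far N (N *\<^sub>R y) (N * \<epsilon>)"
      unfolding far_def
    proof clarify
      fix x z assume xz: "(x, z) \<in> G" "p x \<le> N"
      have "\<epsilon> \<le> q (y - (1 / N) *\<^sub>R z)"
      proof (rule *)
        show "((1 / N) *\<^sub>R x, (1 / N) *\<^sub>R z) \<in> G"
          using xz graph_scale by blast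
        show "p ((1 / N) *\<^sub>R x) \<le> 1"
          using that xz graph_mem by (subst dom.scale) (auto simp: field_simps)
      qed
      moreover have "q (N *\<^sub>R (y - (1 / N) *\<^sub>R z)) = \<bar>N\<bar> * q (y - (1 / N) *\<^sub>R z)"
        using xz y graph_mem Range_mem
        by (intro cod.scale cod.diff_mem cod.scale_mem) auto
      moreover have "N *\<^sub>R (y - (1 / N) *\<^sub>R z) = N *\<^sub>R y - z"
        using that by (simp add: algebra_simps)
      ultimately show "N * \<epsilon> \<le> q (N *\<^sub>R y - z)"
        using that by simp
    qed
    moreover have "q (N *\<^sub>R y) < r"
      using y that Range_mem by (subst cod.scale) (auto simp: field_simps)
    moreover have "N *\<^sub>R y \<in> Range G"
      using y Range_subspace subspace_scale by blast
    ultimately show ?thesis using y(3) that by (meson mult_pos_pos)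
  qed
  \<comment> \<open>If both \<open>a + y\<close> and \<open>a - y\<close> were close to images of the ball of radius \<open>N\<close>, so would
    be half their difference \<open>y\<close>.\<close>
  have step: "\<exists>a'\<in>Range G. \<exists>r'>0. r' \<le> r / 2 \<and> q (a' - a) < r / 2 \<and> far N a' (2 * r')"
    if "a \<in> Range G" "0 < r" "0 < N" for a r and N :: real
  proof -
    obtain y \<epsilon> where y: "y \<in> Range G" "q y < r / 2" "\<epsilon> > 0" "far N y \<epsilon>"
      using small_far[OF half_gt_zero[OF \<open>0 < r\<close>] \<open>0 < N\<close>] by blast
    have W: "a \<in> W" "y \<in> W" using y that Range_mem by auto
    have "far N (a + y) \<epsilon> \<or> far N (a - y) \<epsilon>"
    proof (rule ccontr)
      assume "\<not> ?thesis"
      then have nf: "\<not> far N (a + y) \<epsilon>" "\<not> far N (a - y) \<epsilon>"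
        by auto
      obtain x1 z1 where 1: "(x1, z1) \<in> G" "p x1 \<le> N" "q (a + y - z1) < \<epsilon>"
        using nf(1) unfolding far_def Ball_def split_beta by (metis not_le prod.collapse)
      obtain x2 z2 where 2: "(x2, z2) \<in> G" "p x2 \<le> N" "q (a - y - z2) < \<epsilon>"
        using nf(2) unfolding far_def Ball_def split_beta by (metis not_le prod.collapse)
      have mem: "x1 \<in> V" "x2 \<in> V" "z1 \<in> W" "z2 \<in> W"
        using 1 2 graph_mem by auto
      have "((1/2) *\<^sub>R (x1 - x2), (1/2) *\<^sub>R (z1 - z2)) \<in> G"
        using 1 2 by (intro graph_scale graph_diff)
      moreover have "p ((1/2) *\<^sub>R (x1 - x2)) \<le> N"
        using dom.scale[OF dom.diff_mem[OF mem(1,2)], of "1/2"] dom.diff_le[OF mem(1,2)] 1 2 by simp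
      ultimately have "\<epsilon> \<le> q (y - (1/2) *\<^sub>R (z1 - z2))"
        using y(4) unfolding far_def by auto
      also have "y - (1/2) *\<^sub>R (z1 - z2) = (1/2) *\<^sub>R ((a + y - z1) - (a - y - z2))"
        by (simp add: algebra_simps flip: scaleR_2)
      also have "q \<dots> = (1/2) * q ((a + y - z1) - (a - y - z2))"
        by (subst cod.scale) (intro cod.diff_mem cod.add_mem W mem, simp)
      also have "\<dots> \<le> (1/2) * (q (a + y - z1) + q (a - y - z2))"
        by (intro mult_left_mono cod.diff_le cod.diff_mem cod.add_mem W mem) simp
      also have "\<dots> < \<epsilon>" using 1 2 by simp
      finally show False by simp
    qed
    then obtain a' where a': "a' = a + y \<or> a' = a - y" "far N a' \<epsilon>"
      by blast
    have "a' \<in> Range G"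
      using a'(1) that(1) y(1) Range_subspace subspace_add subspace_diff by blast
    moreover have "q (a' - a) = q y"
      using a'(1) cod.scale[of y "-1"] W by auto
    moreover have "far N a' (2 * min (\<epsilon> / 2) (r / 2))"
      using a'(2) unfolding far_def by force
    ultimately show ?thesis
      using y that by (intro bexI[of _ a'] exI[of _ "min (\<epsilon> / 2) (r / 2)"]) auto
  qed
  have "\<exists>s. \<forall>n. (fst (s n) \<in> Range G \<and> 0 < snd (s n)) \<and>
      (snd (s (Suc n)) \<le> snd (s n) / 2 \<and> q (fst (s (Suc n)) - fst (s n)) < snd (s n) / 2 \<and>
       far (real (Suc n)) (fst (s (Suc n))) (2 * snd (s (Suc n))))"
  proof (rule dependent_nat_choice)
    show "\<exists>s. fst s \<in> Range G \<and> (0::real) < snd s"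
      using graph_zero by (intro exI[of _ "(0, 1)"]) auto
    show "\<exists>t. (fst t \<in> Range G \<and> 0 < snd t) \<and> snd t \<le> snd s / 2 \<and>
        q (fst t - fst s) < snd s / 2 \<and> far (real (Suc n)) (fst t) (2 * snd t)"
      if "fst s \<in> Range G \<and> 0 < snd s" for s n
      using step[of "fst s" "snd s" "real (Suc n)"] that by force
  qed
  then obtain s where s: "\<And>n. fst (s n) \<in> Range G" "\<And>n. 0 < snd (s n)"
    "\<And>n. snd (s (Suc n)) \<le> snd (s n) / 2" "\<And>n. q (fst (s (Suc n)) - fst (s n)) < snd (s n) / 2"
    "\<And>n. far (real (Suc n)) (fst (s (Suc n))) (2 * snd (s (Suc n)))"
    by blast
  define a where "a = (\<lambda>n. fst (s n))"
  define r where "r = (\<lambda>n. snd (s n))"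
  have aR: "a n \<in> Range G" and aW: "a n \<in> W" and r: "0 < r n"
    and ar: "q (a (Suc n) - a n) \<le> r n - r (Suc n)"
    and a_far: "far (real (Suc n)) (a (Suc n)) (2 * r (Suc n))" for n
    using s(1,2,5)[of n] s(3,4)[of n] Range_mem unfolding a_def r_def by auto
  have dist: "q (a (n + m) - a n) \<le> r n" for n m
  proof -
    have "q (a (n + m) - a n) \<le> r n - r (n + m)"
    proof (induction m)
      case 0
      show ?case using cod.zero by simp
    next
      case (Suc m)
      show ?case
        using cod.diff_triangle[of "a (Suc (n + m))" "a (n + m)" "a n"] aW ar[of "n + m"] Suc by simp
    qed
    then show ?thesis using r[of "n + m"] by simp
  qed
  have "summable (\<lambda>i. q (a (Suc i) - a i))"
  proof (rule summableI_nonneg_bounded)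
    fix m
    have "(\<Sum>i<m. q (a (Suc i) - a i)) \<le> (\<Sum>i<m. r i - r (Suc i))"
      by (intro sum_mono ar)
    also have "\<dots> = r 0 - r m"
      by (rule sum_lessThan_telescope')
    finally show "(\<Sum>i<m. q (a (Suc i) - a i)) \<le> r 0"
      using r[of m] by simp
  qed (auto intro!: cod.nonneg cod.diff_mem aW)
  then obtain b where b: "b \<in> W" "(\<lambda>m. q (b - (\<Sum>i<m. a (Suc i) - a i))) \<longlonglongrightarrow> 0"
    using cod.complete[of "\<lambda>i. a (Suc i) - a i"] cod.diff_mem aW by blast
  define l where "l = b + a 0"
  have l: "l \<in> W" "(\<lambda>m. q (l - a m)) \<longlonglongrightarrow> 0"
    using b by (auto simp: l_def sum_lessThan_telescope algebra_simps intro: cod.add_mem aW)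
  have "l \<in> Range G"
  proof -
    have "\<exists>z\<in>Range G. q (l - z) < \<epsilon>" if "0 < \<epsilon>" for \<epsilon>
      using order_tendstoD(2)[OF l(2) that] aR by (auto simp: eventually_sequentially)
    then show ?thesis using assms l(1) unfolding closed_range_def by blast
  qed
  then obtain x where x: "(x, l) \<in> G" by blast
  obtain n where n: "p x \<le> real (Suc n)"
    using real_arch_simple[of "p x"] by (metis le_Suc_eq of_nat_le_iff order_trans order_refl)
  have "2 * r (Suc n) \<le> q (a (Suc n) - l)"
    using a_far[of n] x n unfolding far_def by auto
  also have "q (a (Suc n) - l) = q (l - a (Suc n))"
    by (intro cod.minus_commute aW l)
  also have "\<dots> \<le> r (Suc n)"
  proof (rule LIMSEQ_le_const)
    have "(\<lambda>m. q (l - a (Suc n + m))) \<longlonglongrightarrow> 0"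
      using LIMSEQ_ignore_initial_segment[OF l(2), of "Suc n"] by (simp add: add.commute)
    then show "(\<lambda>m. q (l - a (Suc n + m)) + r (Suc n)) \<longlonglongrightarrow> r (Suc n)"
      using tendsto_add[OF _ tendsto_const[of "r (Suc n)"]] by fastforce
    have "q (l - a (Suc n)) \<le> q (l - a (Suc n + m)) + r (Suc n)" for m
      using cod.diff_triangle[OF l(1) aW[of "Suc n + m"] aW[of "Suc n"]] dist[of "Suc n" m] by linarith
    then show "\<exists>N. \<forall>m\<ge>N. q (l - a (Suc n)) \<le> q (l - a (Suc n + m)) + r (Suc n)"
      by blast
  qed
  finally show False using r[of "Suc n"] by simp
qed

text \<open>Approximate preimages improve to exact ones: halve the error at each step, with corrections of
  norm at most \<open>(1/2) ^ n\<close>, and lift the resulting series.\<close>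

lemma preimages_small_ball:
  assumes "closed_range"
  shows "\<exists>r>0. \<forall>y\<in>Range G. q y < r \<longrightarrow> (\<exists>x. (x, y) \<in> G \<and> p x \<le> 2)"
proof -
  obtain r where r: "r > 0"
    and approx: "\<And>y \<epsilon>. y \<in> Range G \<Longrightarrow> q y < r \<Longrightarrow> \<epsilon> > 0 \<Longrightarrow>
      \<exists>(x, z)\<in>G. p x \<le> 1 \<and> q (y - z) < \<epsilon>"
    using approximate_preimages_small_ball[OF assms] by blast
  have step: "\<exists>R'. (R' \<in> Range G \<and> q R' < r * (1/2) ^ Suc n) \<and>
      (\<exists>x. (x, R - R') \<in> G \<and> p x \<le> (1/2) ^ n)"
    if "R \<in> Range G \<and> q R < r * (1/2) ^ n" for R n
  proof -
    have R: "2 ^ n *\<^sub>R R \<in> Range G" "R \<in> W"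
      using that Range_subspace Range_mem by (auto intro: subspace_scale)
    have "q (2 ^ n *\<^sub>R R) < r"
      using R that by (subst cod.scale) (auto simp: field_simps)
    then obtain x z where xz: "(x, z) \<in> G" "p x \<le> 1" "q (2 ^ n *\<^sub>R R - z) < r / 2"
      using approx[OF R(1), of "r / 2"] r by auto
    define x' z' where "x' = (1/2) ^ n *\<^sub>R x" and "z' = (1/2) ^ n *\<^sub>R z"
    have mem: "x \<in> V" "z \<in> W" using xz graph_mem by auto
    have G: "(x', z') \<in> G"
      unfolding x'_def z'_def using xz by (intro graph_scale)
    have "R - z' = (1/2) ^ n *\<^sub>R (2 ^ n *\<^sub>R R - z)"
      by (simp add: z'_def algebra_simps flip: power_mult_distrib)
    then have "q (R - z') = (1/2) ^ n * q (2 ^ n *\<^sub>R R - z)"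
      using R mem by (simp add: cod.scale cod.diff_mem cod.scale_mem)
    also have "\<dots> < (1/2) ^ n * (r / 2)"
      using xz by (intro mult_strict_left_mono) auto
    finally have "q (R - z') < r * (1/2) ^ Suc n" by (simp add: mult_ac)
    moreover have "R - z' \<in> Range G"
      using that G Range_subspace subspace_diff by blast
    moreover have "p x' \<le> (1/2) ^ n"
      unfolding x'_def using mem xz by (subst dom.scale) (auto simp: mult_left_le)
    ultimately show ?thesis
      using G by (intro exI[of _ "R - z'"]) auto
  qed
  have "\<exists>x. (x, y) \<in> G \<and> p x \<le> 2" if y: "y \<in> Range G" "q y < r" for y
  proof -
    have "\<exists>R. \<forall>n. (R n \<in> Range G \<and> q (R n) < r * (1/2) ^ n \<and> (n = 0 \<longrightarrow> R n = y)) \<and>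
        (\<exists>x. (x, R n - R (Suc n)) \<in> G \<and> p x \<le> (1/2) ^ n)"
    proof (rule dependent_nat_choice)
      show "\<exists>R. R \<in> Range G \<and> q R < r * (1/2) ^ 0 \<and> (0 = (0::nat) \<longrightarrow> R = y)"
        using y by auto
    qed (use step in blast)
    then obtain R where R: "\<And>n. R n \<in> Range G" "\<And>n. q (R n) < r * (1/2) ^ n" "R 0 = y"
      and ex: "\<forall>n. \<exists>x. (x, R n - R (Suc n)) \<in> G \<and> p x \<le> (1/2) ^ n"
      by metis
    obtain x where x: "\<And>n. (x n, R n - R (Suc n)) \<in> G" "\<And>n. p (x n) \<le> (1/2) ^ n"
      using choice[OF ex] by auto
    have geo: "summable (\<lambda>n. (1/2::real) ^ n)" "(\<Sum>n. (1/2::real) ^ n) = 2"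
      using suminf_geometric[of "1/2::real"] by (auto intro!: summable_geometric)
    have p0: "0 \<le> p (x n)" for n using x(1) dom.nonneg graph_mem by blast
    have sm: "summable (\<lambda>n. p (x n))"
      by (rule summable_comparison_test'[OF geo(1), of 0]) (use p0 x(2) in auto)
    have "(\<lambda>m. q (y - (\<Sum>i<m. R i - R (Suc i)))) \<longlonglongrightarrow> 0"
    proof (rule real_tendsto_sandwich[of "\<lambda>_. 0" _ _ "\<lambda>m. r * (1/2) ^ m"])
      have eq: "y - (\<Sum>i<m. R i - R (Suc i)) = R m" for m
        by (simp add: sum_lessThan_telescope' R)
      show "\<forall>\<^sub>F m in sequentially. 0 \<le> q (y - (\<Sum>i<m. R i - R (Suc i)))"
        using cod.nonneg Range_mem R(1) by (simp add: eq)
      show "\<forall>\<^sub>F m in sequentially. q (y - (\<Sum>i<m. R i - R (Suc i))) \<le> r * (1/2) ^ m"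
        using R(2) by (simp add: eq less_imp_le)
      show "(\<lambda>m. r * (1/2) ^ m) \<longlonglongrightarrow> 0"
        by (intro tendsto_mult_right_zero LIMSEQ_power_zero) simp
    qed simp
    then obtain x' where "(x', y) \<in> G" "p x' \<le> (\<Sum>i. p (x i))"
      using lift_series[OF x(1) sm] y Range_mem by blast
    moreover have "(\<Sum>i. p (x i)) \<le> 2"
      using suminf_le[OF x(2) sm geo(1)] geo(2) by simp
    ultimately show ?thesis by force
  qed
  then show ?thesis using r by blast
qed

text \<open>The open mapping theorem for the induced operator, by scaling to the ball of the preceding
  lemma.\<close>

theorem closed_range_imp_bounded_below:
  assumes "closed_range"
  shows "\<exists>C. bounded_below_mod_kernel C"
proof -
  obtain r where r: "r > 0" and pre: "\<And>y. y \<in> Range G \<Longrightarrow> q y < r \<Longrightarrow> \<exists>x. (x, y) \<in> G \<and> p x \<le> 2"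
    using preimages_small_ball[OF assms] by blast
  have "\<exists>z. (z, 0) \<in> G \<and> p (x - z) \<le> (4 / r) * q y" if xy: "(x, y) \<in> G" for x y
  proof (cases "q y = 0")
    case True
    have "(x, 0) \<in> G"
      using graph_closed[of "\<lambda>_. x" "\<lambda>_. y" x 0] xy True graph_mem[OF xy] dom.zero
        cod.zero_mem cod.scale[of y "-1"] by simp
    then show ?thesis using dom.zero True by (intro exI[of _ x]) simp
  next
    case False
    have mem: "x \<in> V" "y \<in> W" using xy graph_mem by auto
    with False have qy: "q y > 0" using cod.nonneg[of y] by simp
    \<comment> \<open>Scales \<open>y\<close> to norm \<open>r / 2\<close>, inside the ball of radius \<open>r\<close>\<close>
    define t where "t = r / (2 * q y)"
    have t: "t > 0" using r qy by (simp add: t_def)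
    have "q (t *\<^sub>R y) < r"
      using mem t r qy by (simp add: cod.scale t_def)
    moreover have "t *\<^sub>R y \<in> Range G"
      using graph_scale[OF xy] by blast
    ultimately obtain x' where x': "(x', t *\<^sub>R y) \<in> G" "p x' \<le> 2"
      using pre by blast
    have "((1 / t) *\<^sub>R x', (1 / t) *\<^sub>R (t *\<^sub>R y)) \<in> G"
      using x'(1) by (rule graph_scale)
    then have "((1 / t) *\<^sub>R x', y) \<in> G" using t by simp
    then have "(x - (1 / t) *\<^sub>R x', y - y) \<in> G"
      using xy graph_diff by blast
    moreover have "p (x - (x - (1 / t) *\<^sub>R x')) \<le> (4 / r) * q y"
    proof -
      have "p (x - (x - (1 / t) *\<^sub>R x')) = (1 / t) * p x'"
        using x'(1) graph_mem t by (simp add: dom.scale)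
      also have "\<dots> \<le> (1 / t) * 2"
        using x'(2) t by (intro mult_left_mono) auto
      finally show ?thesis using r qy by (simp add: t_def field_simps)
    qed
    ultimately show ?thesis by auto
  qed
  then show ?thesis unfolding bounded_below_mod_kernel_def by blast
qed

text \<open>A point of the closure is the sum of a series in the range with geometrically decreasing terms.
  By hypothesis the terms have preimages of comparable norm, so the series can be lifted.\<close>

theorem bounded_below_imp_closed_range:
  assumes "bounded_below_mod_kernel C"
  shows "closed_range"
  unfolding closed_range_def
proof (intro ballI impI)
  fix y assume y: "y \<in> W" and approx: "\<forall>\<epsilon>>0. \<exists>z\<in>Range G. q (y - z) < \<epsilon>"
  have "\<forall>n. \<exists>z\<in>Range G. q (y - z) < (1/2) ^ n"
    using approx by simp
  then obtain z where z: "\<And>n. z n \<in> Range G" "\<And>n. q (y - z n) < (1/2) ^ n"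
    by metis
  \<comment> \<open>The series with partial sums \<open>z 0, z 1, \<dots>\<close>\<close>
  define w where "w n = (if n = 0 then z 0 else z n - z (n - 1))" for n
  have sum_w: "(\<Sum>i<Suc m. w i) = z m" for m
    by (induction m) (auto simp: w_def)
  have wR: "w n \<in> Range G" for n
    using z(1) Range_subspace by (auto simp: w_def intro: subspace_diff)
  have "\<exists>x. (x, w n) \<in> G \<and> p x \<le> \<bar>C\<bar> * q (w n)" for n
  proof -
    obtain x where "(x, w n) \<in> G" using wR by blast
    then obtain k where k: "(x, w n) \<in> G" "(k, 0) \<in> G" "p (x - k) \<le> C * q (w n)"
      using assms unfolding bounded_below_mod_kernel_def by blast
    have "C * q (w n) \<le> \<bar>C\<bar> * q (w n)"
      using cod.nonneg[OF Range_mem[OF wR]] by (intro mult_right_mono) auto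
    with k graph_diff[OF k(1,2)] show ?thesis by force
  qed
  then obtain x where x: "\<And>n. (x n, w n) \<in> G" "\<And>n. p (x n) \<le> \<bar>C\<bar> * q (w n)"
    by metis
  have qw: "q (w (Suc n)) \<le> 2 * (1/2) ^ n" for n
  proof -
    have W: "z n \<in> W" for n using z(1) Range_mem by blast
    have "q (w (Suc n)) = q ((y - z n) - (y - z (Suc n)))"
      by (simp add: w_def)
    also have "\<dots> \<le> q (y - z n) + q (y - z (Suc n))"
      by (intro cod.diff_le cod.diff_mem y W)
    also have "\<dots> \<le> (1/2) ^ n + (1/2) ^ Suc n"
      using z(2)[of n] z(2)[of "Suc n"] by linarith
    also have "\<dots> \<le> 2 * (1/2) ^ n" by simp
    finally show ?thesis .
  qed
  have "summable (\<lambda>n. p (x (Suc n)))"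
  proof (rule summable_comparison_test')
    show "summable (\<lambda>n. \<bar>C\<bar> * (2 * (1/2::real) ^ n))"
      by (intro summable_mult summable_geometric) simp
    show "norm (p (x (Suc n))) \<le> \<bar>C\<bar> * (2 * (1/2) ^ n)" if "n \<ge> 0" for n
    proof -
      have "\<bar>C\<bar> * q (w (Suc n)) \<le> \<bar>C\<bar> * (2 * (1/2) ^ n)"
        by (intro mult_left_mono qw) simp
      then show ?thesis
        using x(2)[of "Suc n"] dom.nonneg[of "x (Suc n)"] graph_mem[OF x(1)] by simp
    qed
  qed
  then have sm: "summable (\<lambda>n. p (x n))"
    by (rule summable_Suc_iff[THEN iffD1])
  have "(\<lambda>m. q (y - (\<Sum>i<Suc m. w i))) \<longlonglongrightarrow> 0"
  proof (rule real_tendsto_sandwich[of "\<lambda>_. 0" _ _ "\<lambda>m. (1/2) ^ m"])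
    show "\<forall>\<^sub>F m in sequentially. 0 \<le> q (y - (\<Sum>i<Suc m. w i))"
      unfolding sum_w using cod.nonneg cod.diff_mem y z(1) Range_mem by simp
    show "\<forall>\<^sub>F m in sequentially. q (y - (\<Sum>i<Suc m. w i)) \<le> (1/2) ^ m"
      unfolding sum_w using z(2) by (simp add: less_imp_le)
  qed (auto intro: LIMSEQ_power_zero)
  then have "(\<lambda>m. q (y - (\<Sum>i<m. w i))) \<longlonglongrightarrow> 0"
    by (rule LIMSEQ_imp_Suc)
  then show "y \<in> Range G"
    using lift_series[OF x(1) sm y] by blast
qed

end

section \<open>Multilinear functions and the norm of a covector\<close>

text \<open>Multilinearity alone justifies the expansion into components, and it is what is proved below of
  the differential of a test form.\<close>

definition multilinear :: "nat \<Rightarrow> 'n::finite covector \<Rightarrow> bool" where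
  "multilinear k \<alpha> \<longleftrightarrow>
     (\<forall>v. \<forall>i<k. linear (\<lambda>w. \<alpha> (v(i := w)))) \<and>
     (\<forall>v w. (\<forall>i<k. v i = w i) \<longrightarrow> \<alpha> v = \<alpha> w)"

lemma multilinear_linear: "multilinear k \<alpha> \<Longrightarrow> i < k \<Longrightarrow> linear (\<lambda>w. \<alpha> (v(i := w)))"
  by (simp add: multilinear_def)

lemma multilinear_cong: "multilinear k \<alpha> \<Longrightarrow> (\<And>i. i < k \<Longrightarrow> v i = w i) \<Longrightarrow> \<alpha> v = \<alpha> w"
  by (simp add: multilinear_def)

lemma alternating_imp_multilinear: "alternating k \<alpha> \<Longrightarrow> multilinear k \<alpha>"
  by (simp add: alternating_def multilinear_def)

lemma multilinear_comp:
  fixes \<alpha> :: "'n::finite covector" and D :: "real ^ 'n \<Rightarrow> real ^ 'n"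
  assumes "multilinear k \<alpha>" and "linear D"
  shows "multilinear k (\<lambda>v. \<alpha> (\<lambda>i. D (v i)))"
  unfolding multilinear_def
proof (intro conjI allI impI)
  fix v :: "nat \<Rightarrow> real ^ 'n" and i
  assume "i < k"
  have "(\<lambda>w. \<alpha> (\<lambda>j. D ((v(i := w)) j))) = (\<lambda>w. \<alpha> ((\<lambda>j. D (v j))(i := w))) \<circ> D"
    by (auto simp: fun_eq_iff intro!: arg_cong[of _ _ \<alpha>])
  then show "linear (\<lambda>w. \<alpha> (\<lambda>j. D ((v(i := w)) j)))"
    using linear_compose[OF assms(2) multilinear_linear[OF assms(1) \<open>i < k\<close>]] by simp
next
  fix v w :: "nat \<Rightarrow> real ^ 'n"
  assume "\<forall>i<k. v i = w i"
  then show "\<alpha> (\<lambda>i. D (v i)) = \<alpha> (\<lambda>i. D (w i))"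
    by (intro multilinear_cong[OF assms(1)]) simp
qed

lemma sum_PiE_lessThan_Suc:
  "(\<Sum>I\<in>{..<Suc m} \<rightarrow>\<^sub>E S. f I) = (\<Sum>I\<in>{..<m} \<rightarrow>\<^sub>E S. \<Sum>i\<in>S. f (I(m := i)))"
proof -
  have "(\<Sum>I\<in>{..<Suc m} \<rightarrow>\<^sub>E S. f I) = (\<Sum>I\<in>(\<lambda>(y, g). g(m := y)) ` (S \<times> ({..<m} \<rightarrow>\<^sub>E S)). f I)"
    by (simp add: lessThan_Suc PiE_insert_eq)
  also have "\<dots> = (\<Sum>(i, I)\<in>S \<times> ({..<m} \<rightarrow>\<^sub>E S). f (I(m := i)))"
    using inj_combinator[of m "{..<m}" "\<lambda>_. S"]
    by (subst sum.reindex) (auto simp: case_prod_unfold)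
  also have "\<dots> = (\<Sum>i\<in>S. \<Sum>I\<in>{..<m} \<rightarrow>\<^sub>E S. f (I(m := i)))"
    by (rule sum.cartesian_product[symmetric])
  also have "\<dots> = (\<Sum>I\<in>{..<m} \<rightarrow>\<^sub>E S. \<Sum>i\<in>S. f (I(m := i)))"
    by (rule sum.swap)
  finally show ?thesis .
qed

lemma multilinear_expand:
  fixes e :: "'n::finite \<Rightarrow> real ^ 'n"
  assumes "multilinear k \<alpha>"
  shows "\<alpha> (\<lambda>a. \<Sum>i\<in>UNIV. c a i *\<^sub>R e i) =
    (\<Sum>I\<in>{..<k} \<rightarrow>\<^sub>E UNIV. (\<Prod>a<k. c a (I a)) * \<alpha> (\<lambda>a. e (I a)))"
proof -
  define s where "s a = (\<Sum>i\<in>UNIV. c a i *\<^sub>R e i)" for a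
  have "\<alpha> s = (\<Sum>I\<in>{..<m} \<rightarrow>\<^sub>E UNIV. (\<Prod>a<m. c a (I a)) * \<alpha> (\<lambda>a. if a < m then e (I a) else s a))"
    if "m \<le> k" for m
    using that
  proof (induction m)
    case 0
    then show ?case by simp
  next
    case (Suc m)
    have slot: "\<alpha> (\<lambda>a. if a < m then e (I a) else s a) =
        (\<Sum>i\<in>UNIV. c m i * \<alpha> (\<lambda>a. if a < Suc m then e ((I(m := i)) a) else s a))" for I
    proof -
      let ?v = "\<lambda>a. if a < m then e (I a) else s a"
      have lin: "linear (\<lambda>w. \<alpha> (?v(m := w)))"
        using Suc.prems by (intro multilinear_linear[OF assms]) simp
      have "\<alpha> ?v = \<alpha> (?v(m := \<Sum>i\<in>UNIV. c m i *\<^sub>R e i))"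
        by (rule arg_cong[of _ _ \<alpha>]) (auto simp: s_def)
      also have "\<dots> = (\<Sum>i\<in>UNIV. c m i * \<alpha> (?v(m := e i)))"
        using linear_sum[OF lin, of "\<lambda>i. c m i *\<^sub>R e i" UNIV] linear_scale[OF lin] by simp
      also have "\<dots> = (\<Sum>i\<in>UNIV. c m i * \<alpha> (\<lambda>a. if a < Suc m then e ((I(m := i)) a) else s a))"
        by (intro sum.cong refl arg_cong2[of _ _ _ _ "(*)"] arg_cong[of _ _ \<alpha>]) (auto simp: less_Suc_eq)
      finally show ?thesis .
    qed
    have "\<alpha> s = (\<Sum>I\<in>{..<m} \<rightarrow>\<^sub>E UNIV. (\<Prod>a<m. c a (I a)) *
        (\<Sum>i\<in>UNIV. c m i * \<alpha> (\<lambda>a. if a < Suc m then e ((I(m := i)) a) else s a)))"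
      using Suc by (simp flip: slot)
    also have "\<dots> = (\<Sum>I\<in>{..<Suc m} \<rightarrow>\<^sub>E UNIV.
        (\<Prod>a<Suc m. c a (I a)) * \<alpha> (\<lambda>a. if a < Suc m then e (I a) else s a))"
      unfolding sum_PiE_lessThan_Suc
      by (intro sum.cong refl) (simp add: sum_distrib_left mult.assoc)
    finally show ?case .
  qed
  from this[of k] have "\<alpha> s = (\<Sum>I\<in>{..<k} \<rightarrow>\<^sub>E UNIV.
      (\<Prod>a<k. c a (I a)) * \<alpha> (\<lambda>a. if a < k then e (I a) else s a))"
    by simp
  also have "\<dots> = (\<Sum>I\<in>{..<k} \<rightarrow>\<^sub>E UNIV. (\<Prod>a<k. c a (I a)) * \<alpha> (\<lambda>a. e (I a)))"
    by (intro sum.cong refl arg_cong2[of _ _ _ _ "(*)"] multilinear_cong[OF assms]) simp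
  finally show ?thesis unfolding s_def .
qed

lemma multilinear_components:
  assumes "multilinear k \<alpha>"
  shows "\<alpha> v = (\<Sum>I\<in>{..<k} \<rightarrow>\<^sub>E UNIV. (\<Prod>a<k. v a $ I a) * \<alpha> (\<lambda>a. axis (I a) 1))"
proof -
  have "(\<Sum>i\<in>UNIV. v a $ i *\<^sub>R axis i 1) = v a" for a
    using basis_expansion[of "v a"] by (simp add: scalar_mult_eq_scaleR)
  then show ?thesis
    using multilinear_expand[OF assms, of "\<lambda>a i. v a $ i" "\<lambda>i. axis i 1"] by simp
qed

lemma matrix_vector_axis: "(D::real^'n^'m) *v axis j 1 = (\<Sum>i\<in>UNIV. D $ i $ j *\<^sub>R axis i 1)"
  using basis_expansion[of "column j D"]
  by (simp add: matrix_vector_mult_basis column_def scalar_mult_eq_scaleR)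

subsection \<open>Factoring a Gram matrix\<close>

definition pos_def :: "real ^ 'n ^ 'n \<Rightarrow> bool" where
  "pos_def g \<longleftrightarrow> transpose g = g \<and> (\<forall>v. v \<noteq> 0 \<longrightarrow> 0 < v \<bullet> (g *v v))"

text \<open>The columns of \<open>B\<close> form an orthonormal basis for the scalar product with Gram matrix
  \<open>g\<close>.\<close>

definition gram_factor :: "real ^ 'n ^ 'n \<Rightarrow> real ^ 'n ^ 'n \<Rightarrow> real ^ 'n ^ 'n \<Rightarrow> bool" where
  "gram_factor g A B \<longleftrightarrow> g = transpose A ** A \<and> A ** B = mat 1 \<and> B ** A = mat 1"

text \<open>Cholesky factorisation, by eliminating one index after the other.\<close>

lemma cholesky:
  fixes h :: "'i \<Rightarrow> 'i \<Rightarrow> real"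
  assumes "finite S" and "\<And>i j. i \<in> S \<Longrightarrow> j \<in> S \<Longrightarrow> h i j = h j i"
    and "\<And>x. (\<exists>i\<in>S. x i \<noteq> 0) \<Longrightarrow> 0 < (\<Sum>i\<in>S. \<Sum>j\<in>S. h i j * x i * x j)"
  shows "\<exists>w. \<forall>i\<in>S. \<forall>j\<in>S. h i j = (\<Sum>l\<in>S. w l i * w l j)"
  using assms
proof (induction S arbitrary: h rule: finite_induct)
  case empty
  then show ?case by simp
next
  case (insert a S)
  have haa: "0 < h a a"
    using insert.prems(2)[of "\<lambda>i. if i = a then 1 else 0"] insert.hyps
    by (simp add: sum.delta sum.insert_if if_distrib[of "\<lambda>y. _ * y"] cong: if_cong)
  define h' where "h' i j = h i j - h a i * h a j / h a a" for i j
  have sym: "h i a = h a i" if "i \<in> S" for i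
    using insert.prems(1)[of i a] that by simp
  have "0 < (\<Sum>i\<in>S. \<Sum>j\<in>S. h' i j * x i * x j)" if x: "\<exists>i\<in>S. x i \<noteq> 0" for x
  proof -
    define b where "b = (\<Sum>i\<in>S. h a i * x i)"
    define y where "y = x(a := - b / h a a)"
    have y: "y a = - b / h a a" "\<And>i. i \<in> S \<Longrightarrow> y i = x i"
      using insert.hyps by (auto simp: y_def)
    have "0 < (\<Sum>i\<in>insert a S. \<Sum>j\<in>insert a S. h i j * y i * y j)"
      using x y(2) insert.hyps by (intro insert.prems(2)) fastforce
    also have "\<dots> = (h a a * y a * y a + (\<Sum>j\<in>S. h a j * y a * x j)) +
        ((\<Sum>i\<in>S. h a i * x i * y a) + (\<Sum>i\<in>S. \<Sum>j\<in>S. h i j * x i * x j))"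
      using insert.hyps y(2) sym by (simp add: sum.distrib cong: sum.cong)
    also have "(\<Sum>j\<in>S. h a j * y a * x j) = y a * b"
      by (simp add: b_def sum_distrib_left mult_ac)
    also have "(\<Sum>i\<in>S. h a i * x i * y a) = y a * b"
      by (simp add: b_def sum_distrib_left mult_ac)
    also have "(\<Sum>i\<in>S. \<Sum>j\<in>S. h i j * x i * x j) =
        (\<Sum>i\<in>S. \<Sum>j\<in>S. h' i j * x i * x j + (h a i * x i) * (h a j * x j) / h a a)"
      by (intro sum.cong refl) (simp add: h'_def field_simps)
    also have "\<dots> = (\<Sum>i\<in>S. \<Sum>j\<in>S. h' i j * x i * x j) + b * b / h a a"
      by (simp add: sum.distrib b_def sum_product flip: sum_divide_distrib)
    finally show ?thesis
      using haa by (simp add: y(1) field_simps)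
  qed
  moreover have "h' i j = h' j i" if "i \<in> S" "j \<in> S" for i j
    using insert.prems(1)[of i j] that by (simp add: h'_def)
  ultimately obtain w where w: "\<And>i j. i \<in> S \<Longrightarrow> j \<in> S \<Longrightarrow> h' i j = (\<Sum>l\<in>S. w l i * w l j)"
    using insert.IH[of h'] by blast
  define w' where "w' l i = (if l = a then h a i / sqrt (h a a) else if i = a then 0 else w l i)" for l i
  have "h i j = (\<Sum>l\<in>insert a S. w' l i * w' l j)" if "i \<in> insert a S" "j \<in> insert a S" for i j
  proof -
    have "(\<Sum>l\<in>insert a S. w' l i * w' l j) =
        h a i * h a j / h a a + (\<Sum>l\<in>S. if i = a \<or> j = a then 0 else w l i * w l j)"
      using insert.hyps haa
      by (auto simp: w'_def intro!: sum.cong arg_cong2[of _ _ _ _ "(+)"])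
    also have "\<dots> = h i j"
    proof (cases "i = a \<or> j = a")
      case True
      then have "h i j = h a i * h a j / h a a"
        using that haa sym[of i] by auto
      with True show ?thesis by simp
    next
      case False
      then show ?thesis
        using that w[of i j] by (simp add: h'_def)
    qed
    finally show ?thesis by simp
  qed
  then show ?case by blast
qed

lemma ex_gram_factor:
  fixes g :: "real ^ 'n::finite ^ 'n"
  assumes "pos_def g"
  shows "\<exists>A B. gram_factor g A B"
proof -
  have sym: "g $ i $ j = g $ j $ i" for i j
    using assms unfolding pos_def_def by (metis transpose_def vec_lambda_beta)
  have quad: "(\<Sum>i\<in>UNIV. \<Sum>j\<in>UNIV. g $ i $ j * x i * x j) = (\<chi> i. x i) \<bullet> (g *v (\<chi> i. x i))" for x
    by (simp add: inner_vec_def matrix_vector_mult_def sum_distrib_left mult_ac)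
  have "0 < (\<Sum>i\<in>UNIV. \<Sum>j\<in>UNIV. g $ i $ j * x i * x j)" if "\<exists>i\<in>UNIV. x i \<noteq> 0" for x
    using assms that unfolding quad pos_def_def by (auto simp: vec_eq_iff)
  then obtain w :: "'n \<Rightarrow> 'n \<Rightarrow> real" where w: "\<And>i j. g $ i $ j = (\<Sum>l\<in>UNIV. w l i * w l j)"
    using cholesky[of UNIV "\<lambda>i j. g $ i $ j"] sym by auto
  define A :: "real ^ 'n ^ 'n" where "A = (\<chi> l i. w l i)"
  have g: "g = transpose A ** A"
    by (simp add: A_def vec_eq_iff matrix_matrix_mult_def transpose_def w)
  have "x = 0" if "A *v x = 0" for x
  proof (rule ccontr)
    assume "x \<noteq> 0"
    then have "0 < x \<bullet> (g *v x)" using assms by (simp add: pos_def_def)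
    also have "g *v x = transpose A *v (A *v x)"
      by (simp only: g matrix_vector_mul_assoc)
    finally show False using that by simp
  qed
  then have "\<exists>B. B ** A = mat 1"
    by (subst matrix_left_invertible_ker) auto
  then show ?thesis
    using g unfolding gram_factor_def by (metis matrix_left_right_inverse)
qed

lemma matrix_inv_unique:
  fixes A :: "real ^ 'n ^ 'n"
  assumes "A ** B = mat 1" "B ** A = mat 1"
  shows "matrix_inv A = B"
proof -
  have "A ** matrix_inv A = mat 1 \<and> matrix_inv A ** A = mat 1"
    unfolding matrix_inv_def by (rule someI[of _ B]) (use assms in simp)
  then have "matrix_inv A = (B ** A) ** matrix_inv A" "B ** (A ** matrix_inv A) = B"
    using assms by simp_all
  then show ?thesis by (metis matrix_mul_assoc)
qed

lemma gram_factor_matrix_inv: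
  assumes "gram_factor g A B"
  shows "matrix_inv g = B ** transpose B"
proof (rule matrix_inv_unique)
  have AB: "A ** B = mat 1" "B ** A = mat 1" and g: "g = transpose A ** A"
    using assms by (auto simp: gram_factor_def)
  have AB': "transpose A ** transpose B = mat 1" "transpose B ** transpose A = mat 1"
    by (simp_all add: AB flip: matrix_transpose_mul)
  have "g ** (B ** transpose B) = transpose A ** ((A ** B) ** transpose B)"
    by (simp add: g matrix_mul_assoc)
  then show "g ** (B ** transpose B) = mat 1" by (simp add: AB AB')
  have "(B ** transpose B) ** g = B ** ((transpose B ** transpose A) ** A)"
    by (simp add: g matrix_mul_assoc)
  then show "(B ** transpose B) ** g = mat 1" by (simp add: AB AB')
qed

lemma pos_def_det_pos:
  fixes g :: "real ^ 'n::finite ^ 'n"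
  assumes "pos_def g"
  shows "0 < det g"
proof -
  obtain A B where "gram_factor g A B" using ex_gram_factor[OF assms] by blast
  then have "det g = det A * det A" "det A * det B = det (mat 1 :: real ^ 'n ^ 'n)"
    unfolding gram_factor_def by (metis det_mul det_transpose)+
  then have "det g = det A * det A" "det A * det B = 1"
    by simp_all
  then show ?thesis by (metis mult_zero_left not_real_square_gt_zero zero_neq_one)
qed

text \<open>Contracting with the inverse of \<open>g\<close> amounts to summing the squares of the values on
  an orthonormal basis.\<close>

lemma covector_norm_orthonormal:
  fixes \<alpha> :: "'n::finite covector"
  assumes "multilinear k \<alpha>" and "gram_factor g A B"
  shows "covector_norm g k \<alpha> =
    sqrt ((\<Sum>L\<in>{..<k} \<rightarrow>\<^sub>E UNIV. (\<alpha> (\<lambda>a. B *v axis (L a) 1))\<^sup>2) / fact k)"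
proof -
  let ?P = "{..<k} \<rightarrow>\<^sub>E (UNIV :: 'n set)"
  let ?e = "\<lambda>I. \<alpha> (\<lambda>a. axis (I a) 1)"
  have B: "matrix_inv g $ i $ j = (\<Sum>l\<in>UNIV. B $ i $ l * B $ j $ l)" for i j
    by (simp add: gram_factor_matrix_inv[OF assms(2)] matrix_matrix_mult_def transpose_def)
  have "(\<Sum>L\<in>?P. (\<alpha> (\<lambda>a. B *v axis (L a) 1))\<^sup>2) =
      (\<Sum>L\<in>?P. (\<Sum>I\<in>?P. (\<Prod>a<k. B $ I a $ L a) * ?e I) * (\<Sum>J\<in>?P. (\<Prod>a<k. B $ J a $ L a) * ?e J))"
    unfolding power2_eq_square matrix_vector_axis
    by (simp add: multilinear_expand[OF assms(1)])
  also have "\<dots> = (\<Sum>L\<in>?P. \<Sum>I\<in>?P. \<Sum>J\<in>?P. (\<Prod>a<k. B $ I a $ L a * B $ J a $ L a) * ?e I * ?e J)"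
    by (simp add: sum_product prod.distrib mult_ac)
  also have "\<dots> = (\<Sum>I\<in>?P. \<Sum>L\<in>?P. \<Sum>J\<in>?P. (\<Prod>a<k. B $ I a $ L a * B $ J a $ L a) * ?e I * ?e J)"
    by (rule sum.swap)
  also have "\<dots> = (\<Sum>I\<in>?P. \<Sum>J\<in>?P. \<Sum>L\<in>?P. (\<Prod>a<k. B $ I a $ L a * B $ J a $ L a) * ?e I * ?e J)"
    by (intro sum.cong refl sum.swap)
  also have "\<dots> = (\<Sum>I\<in>?P. \<Sum>J\<in>?P. (\<Prod>a<k. matrix_inv g $ I a $ J a) * ?e I * ?e J)"
    unfolding B by (intro sum.cong refl) (simp add: prod_sum_PiE sum_distrib_right)
  finally show ?thesis unfolding covector_norm_def by simp
qed

lemma covector_norm_L2: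
  assumes "multilinear k \<alpha>" and "gram_factor g A B"
  shows "covector_norm g k \<alpha> =
    L2_set (\<lambda>L. \<alpha> (\<lambda>a. B *v axis (L a) 1)) ({..<k} \<rightarrow>\<^sub>E UNIV) / sqrt (fact k)"
  by (simp add: covector_norm_orthonormal[OF assms] L2_set_def real_sqrt_divide)

lemma covector_norm_nonneg:
  assumes "pos_def g" and "multilinear k \<alpha>"
  shows "0 \<le> covector_norm g k \<alpha>"
  using ex_gram_factor[OF assms(1)] covector_norm_L2[OF assms(2)] by fastforce

lemma covector_norm_scale: "covector_norm g k (\<lambda>v. c * \<alpha> v) = \<bar>c\<bar> * covector_norm g k \<alpha>"
proof -
  have "(\<Sum>I\<in>{..<k} \<rightarrow>\<^sub>E UNIV. \<Sum>J\<in>{..<k} \<rightarrow>\<^sub>E UNIV. (\<Prod>a<k. matrix_inv g $ I a $ J a) *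
      (c * \<alpha> (\<lambda>a. axis (I a) 1)) * (c * \<alpha> (\<lambda>a. axis (J a) 1))) / fact k =
    c\<^sup>2 * ((\<Sum>I\<in>{..<k} \<rightarrow>\<^sub>E UNIV. \<Sum>J\<in>{..<k} \<rightarrow>\<^sub>E UNIV. (\<Prod>a<k. matrix_inv g $ I a $ J a) *
      \<alpha> (\<lambda>a. axis (I a) 1) * \<alpha> (\<lambda>a. axis (J a) 1)) / fact k)"
    by (simp add: sum_distrib_left power2_eq_square mult_ac)
  then show ?thesis unfolding covector_norm_def by (simp only: real_sqrt_mult real_sqrt_abs)
qed

lemma multilinear_add:
  assumes "multilinear k \<alpha>" "multilinear k \<beta>"
  shows "multilinear k (\<lambda>v. \<alpha> v + \<beta> v)"
  using assms unfolding multilinear_def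
  by (intro conjI allI impI linear_compose_add arg_cong2[of _ _ _ _ "(+)"]) simp_all

lemma covector_norm_add_le:
  assumes "pos_def g" and "multilinear k \<alpha>" and "multilinear k \<beta>"
  shows "covector_norm g k (\<lambda>v. \<alpha> v + \<beta> v) \<le> covector_norm g k \<alpha> + covector_norm g k \<beta>"
proof -
  obtain A B where AB: "gram_factor g A B" using ex_gram_factor[OF assms(1)] by blast
  show ?thesis
    unfolding covector_norm_L2[OF assms(2) AB] covector_norm_L2[OF assms(3) AB]
      covector_norm_L2[OF multilinear_add[OF assms(2,3)] AB]
    using L2_set_triangle_ineq[of "\<lambda>L. \<alpha> (\<lambda>a. B *v axis (L a) 1)" "\<lambda>L. \<beta> (\<lambda>a. B *v axis (L a) 1)"]
    by (simp add: divide_right_mono flip: add_divide_distrib)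
qed

lemma sqrt_prod: "sqrt (\<Prod>a<k. f a) = (\<Prod>a<k. sqrt (f a))" for k :: nat
  by (induction k) (simp_all add: real_sqrt_mult)

text \<open>Expand the arguments in an orthonormal basis and apply the Cauchy-Schwarz inequality.\<close>

lemma abs_le_covector_norm:
  fixes \<alpha> :: "'n::finite covector"
  assumes "pos_def g" and "multilinear k \<alpha>"
  shows "\<bar>\<alpha> v\<bar> \<le> (sqrt (fact k) * (\<Prod>a<k. sqrt (v a \<bullet> (g *v v a)))) * covector_norm g k \<alpha>"
proof -
  let ?P = "{..<k} \<rightarrow>\<^sub>E (UNIV :: 'n set)"
  obtain A B where AB: "gram_factor g A B" using ex_gram_factor[OF assms(1)] by blast
  define b where "b i = B *v axis i 1" for i
  define c where "c a = A *v v a" for a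
  have v: "v a = (\<Sum>i\<in>UNIV. c a $ i *\<^sub>R b i)" for a
  proof -
    have "v a = B *v c a"
      using AB by (simp add: c_def matrix_vector_mul_assoc gram_factor_def)
    also have "\<dots> = (\<Sum>i\<in>UNIV. c a $ i *\<^sub>R b i)"
      unfolding b_def matrix_vector_mult_basis
      by (simp add: matrix_mult_sum scalar_mult_eq_scaleR)
    finally show ?thesis .
  qed
  have sq: "v a \<bullet> (g *v v a) = (\<Sum>i\<in>UNIV. (c a $ i)\<^sup>2)" for a
  proof -
    have "v a \<bullet> (g *v v a) = v a \<bullet> (transpose A *v c a)"
      using AB by (simp only: gram_factor_def c_def matrix_vector_mul_assoc)
    also have "\<dots> = c a \<bullet> c a"
      by (simp add: c_def dot_lmul_matrix inner_commute[of "v a"])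
    finally show ?thesis by (simp add: inner_vec_def power2_eq_square)
  qed
  have "\<alpha> v = \<alpha> (\<lambda>a. \<Sum>i\<in>UNIV. c a $ i *\<^sub>R b i)"
    by (rule arg_cong[of _ _ \<alpha>]) (auto simp flip: v)
  also have "\<dots> = (\<Sum>L\<in>?P. (\<Prod>a<k. c a $ L a) * \<alpha> (\<lambda>a. b (L a)))"
    by (rule multilinear_expand[OF assms(2)])
  finally have "\<bar>\<alpha> v\<bar> \<le> (\<Sum>L\<in>?P. \<bar>\<Prod>a<k. c a $ L a\<bar> * \<bar>\<alpha> (\<lambda>a. b (L a))\<bar>)"
    by (simp add: sum_abs flip: abs_mult)
  also have "\<dots> \<le> L2_set (\<lambda>L. \<Prod>a<k. c a $ L a) ?P * L2_set (\<lambda>L. \<alpha> (\<lambda>a. b (L a))) ?P"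
    by (rule L2_set_mult_ineq)
  also have "L2_set (\<lambda>L. \<Prod>a<k. c a $ L a) ?P = (\<Prod>a<k. sqrt (v a \<bullet> (g *v v a)))"
    unfolding L2_set_def sq
    by (simp add: prod_sum_PiE flip: sqrt_prod prod_power_distrib)
  also have "L2_set (\<lambda>L. \<alpha> (\<lambda>a. b (L a))) ?P = sqrt (fact k) * covector_norm g k \<alpha>"
    by (simp add: covector_norm_L2[OF assms(2) AB] b_def)
  finally show ?thesis by (simp add: mult_ac)
qed

text \<open>If the columns of \<open>B\<close> are orthonormal for \<open>g'\<close>, those of \<open>E ** B\<close> are orthonormal for the pulled
  back \<open>g\<close>, and the two forms take the same values on the two bases.\<close>

lemma covector_norm_pullback:
  fixes \<alpha>' :: "'n::finite covector" and g g' D :: "real ^ 'n ^ 'n"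
  assumes "pos_def g'" and "multilinear k \<alpha>'" and "g = transpose D ** g' ** D"
    and "D ** E = mat 1" "E ** D = mat 1"
  shows "covector_norm g k (\<lambda>v. \<alpha>' (\<lambda>i. D *v v i)) = covector_norm g' k \<alpha>'"
proof -
  obtain A B where AB: "gram_factor g' A B" using ex_gram_factor[OF assms(1)] by blast
  have "gram_factor g (A ** D) (E ** B)"
    unfolding gram_factor_def
  proof (intro conjI)
    show "g = transpose (A ** D) ** (A ** D)"
      using AB by (simp add: gram_factor_def assms(3) matrix_transpose_mul matrix_mul_assoc)
    have "(A ** D) ** (E ** B) = A ** (D ** E) ** B" by (simp only: matrix_mul_assoc)
    then show "(A ** D) ** (E ** B) = mat 1" using AB assms(4) by (simp add: gram_factor_def)
    have "(E ** B) ** (A ** D) = E ** (B ** A) ** D" by (simp only: matrix_mul_assoc)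
    then show "(E ** B) ** (A ** D) = mat 1" using AB assms(5) by (simp add: gram_factor_def)
  qed
  then have "covector_norm g k (\<lambda>v. \<alpha>' (\<lambda>i. D *v v i)) = sqrt ((\<Sum>L\<in>{..<k} \<rightarrow>\<^sub>E UNIV.
      (\<alpha>' (\<lambda>a. D *v ((E ** B) *v axis (L a) 1)))\<^sup>2) / fact k)"
    by (intro covector_norm_orthonormal multilinear_comp[OF assms(2)]) simp_all
  also have "\<dots> = covector_norm g' k \<alpha>'"
    by (simp add: covector_norm_orthonormal[OF assms(2) AB] matrix_vector_mul_assoc matrix_mul_assoc assms(4))
  finally show ?thesis .
qed

text \<open>Cramer's rule, by which the entries of the inverse depend continuously on the matrix.\<close>

lemma matrix_inv_component:
  fixes g :: "real ^ 'n::finite ^ 'n"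
  assumes "det g \<noteq> 0"
  shows "matrix_inv g $ i $ j =
    det (\<chi> k l. if l = i then axis j 1 $ k else g $ k $ l) / det g"
proof -
  have "invertible g" using assms by (simp add: invertible_det_nz)
  then obtain B where B: "g ** B = mat 1" "B ** g = mat 1" unfolding invertible_def by blast
  then have "g *v (B *v axis j 1) = axis j 1" by (simp add: matrix_vector_mul_assoc)
  then have "B *v axis j 1 = (\<chi> i. det (\<chi> k l. if l = i then axis j 1 $ k else g $ k $ l) / det g)"
    using cramer[OF assms] by blast
  then have "(B *v axis j 1) $ i = det (\<chi> k l. if l = i then axis j 1 $ k else g $ k $ l) / det g"
    by simp
  then show ?thesis
    by (simp add: matrix_inv_unique[OF B] matrix_vector_mult_basis column_def)
qed

subsection \<open>Wedge products and top-degree covectors\<close>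

lemma multilinear_wedge:
  fixes \<alpha> \<beta> :: "'n::finite covector"
  assumes "multilinear p \<alpha>" and "multilinear q \<beta>"
  shows "multilinear (p + q) (wedge p q \<alpha> \<beta>)"
  unfolding multilinear_def
proof (intro conjI allI impI)
  fix v :: "nat \<Rightarrow> real ^ 'n" and i
  assume i: "i < p + q"
  have "linear (\<lambda>w. of_int (sign \<sigma>) * \<alpha> (\<lambda>j. (v(i := w)) (\<sigma> j)) * \<beta> (\<lambda>j. (v(i := w)) (\<sigma> (p + j))))"
    if \<sigma>: "\<sigma> permutes {..<p + q}" for \<sigma>
  proof -
    obtain l where l: "\<sigma> l = i" "l < p + q"
      using permutes_image[OF \<sigma>] i by (metis imageE lessThan_iff)
    have inj: "\<sigma> j = i \<longleftrightarrow> j = l" for j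
      using permutes_inj[OF \<sigma>] l(1) by (auto dest: injD)
    show ?thesis
    proof (cases "l < p")
      case True
      have "(\<lambda>w. \<alpha> (\<lambda>j. (v(i := w)) (\<sigma> j))) = (\<lambda>w. \<alpha> ((\<lambda>j. v (\<sigma> j))(l := w)))"
        by (auto simp: fun_eq_iff inj intro!: arg_cong[of _ _ \<alpha>])
      then have "linear (\<lambda>w. \<alpha> (\<lambda>j. (v(i := w)) (\<sigma> j)))"
        using multilinear_linear[OF assms(1) True, of "\<lambda>j. v (\<sigma> j)"] by simp
      moreover have "(\<lambda>j. (v(i := w)) (\<sigma> (p + j))) = (\<lambda>j. v (\<sigma> (p + j)))" for w
        using True by (auto simp: inj)
      ultimately show ?thesis
        by (auto simp: linear_iff algebra_simps)
    next
      case False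
      have "(\<lambda>w. \<beta> (\<lambda>j. (v(i := w)) (\<sigma> (p + j)))) = (\<lambda>w. \<beta> ((\<lambda>j. v (\<sigma> (p + j)))(l - p := w)))"
        using False by (auto simp: fun_eq_iff inj intro!: arg_cong[of _ _ \<beta>])
      then have "linear (\<lambda>w. \<beta> (\<lambda>j. (v(i := w)) (\<sigma> (p + j))))"
        using multilinear_linear[OF assms(2), of "l - p" "\<lambda>j. v (\<sigma> (p + j))"] False l by simp
      moreover have "\<alpha> (\<lambda>j. (v(i := w)) (\<sigma> j)) = \<alpha> (\<lambda>j. v (\<sigma> j))" for w
        using False by (intro multilinear_cong[OF assms(1)]) (auto simp: inj)
      ultimately show ?thesis
        by (auto simp: linear_iff algebra_simps)
    qed
  qed
  then have "linear (\<lambda>w. \<Sum>\<sigma> | \<sigma> permutes {..<p + q}. of_int (sign \<sigma>) *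
      \<alpha> (\<lambda>j. (v(i := w)) (\<sigma> j)) * \<beta> (\<lambda>j. (v(i := w)) (\<sigma> (p + j))))"
    by (intro linear_compose_sum) auto
  then show "linear (\<lambda>w. wedge p q \<alpha> \<beta> (v(i := w)))"
    unfolding wedge_def by (simp add: linear_iff add_divide_distrib)
next
  fix v w :: "nat \<Rightarrow> real ^ 'n"
  assume eq: "\<forall>i<p + q. v i = w i"
  have "\<alpha> (\<lambda>i. v (\<sigma> i)) = \<alpha> (\<lambda>i. w (\<sigma> i))" "\<beta> (\<lambda>i. v (\<sigma> (p + i))) = \<beta> (\<lambda>i. w (\<sigma> (p + i)))"
    if \<sigma>: "\<sigma> permutes {..<p + q}" for \<sigma>
    using permutes_in_image[OF \<sigma>] eq
    by (auto intro!: multilinear_cong[OF assms(1)] multilinear_cong[OF assms(2)])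
  then show "wedge p q \<alpha> \<beta> v = wedge p q \<alpha> \<beta> w"
    unfolding wedge_def by (intro arg_cong2[of _ _ _ _ "(/)"] sum.cong) auto
qed

text \<open>The sum over all permutations makes a wedge product antisymmetric.\<close>

lemma wedge_permute:
  assumes "\<pi> permutes {..<p + q}"
  shows "wedge p q \<alpha> \<beta> (\<lambda>i. v (\<pi> i)) = of_int (sign \<pi>) * wedge p q \<alpha> \<beta> v"
proof -
  let ?t = "\<lambda>\<sigma>. \<alpha> (\<lambda>i. v (\<sigma> i)) * \<beta> (\<lambda>i. v (\<sigma> (p + i)))"
  have perm: "permutation \<sigma>" if "\<sigma> permutes {..<p + q}" for \<sigma>
    using that by (metis finite_lessThan permutation_permutes)
  have "(\<Sum>\<sigma> | \<sigma> permutes {..<p + q}. of_int (sign \<sigma>) * ?t \<sigma>) =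
      (\<Sum>\<sigma> | \<sigma> permutes {..<p + q}. of_int (sign (\<pi> \<circ> \<sigma>)) * ?t (\<pi> \<circ> \<sigma>))"
    by (rule setum_permutations_compose_left[OF assms])
  also have "\<dots> = (\<Sum>\<sigma> | \<sigma> permutes {..<p + q}. of_int (sign \<pi>) * (of_int (sign \<sigma>) * ?t (\<pi> \<circ> \<sigma>)))"
    by (intro sum.cong refl) (simp add: sign_compose perm assms)
  also have "\<dots> = of_int (sign \<pi>) * (\<Sum>\<sigma> | \<sigma> permutes {..<p + q}. of_int (sign \<sigma>) * ?t (\<pi> \<circ> \<sigma>))"
    by (simp add: sum_distrib_left)
  finally have *: "(\<Sum>\<sigma> | \<sigma> permutes {..<p + q}. of_int (sign \<sigma>) * ?t (\<pi> \<circ> \<sigma>)) =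
      of_int (sign \<pi>) * (\<Sum>\<sigma> | \<sigma> permutes {..<p + q}. of_int (sign \<sigma>) * ?t \<sigma>)"
    by (simp flip: of_int_mult mult.assoc)
  then show ?thesis
    unfolding wedge_def by (simp add: mult.assoc)
qed

lemma bij_betw_basis_enum: "bij_betw (basis_enum :: nat \<Rightarrow> 'n::finite) {..<CARD('n)} UNIV"
proof -
  have "\<exists>e. bij_betw e {..<CARD('n)} (UNIV :: 'n set)"
    using ex_bij_betw_nat_finite[of "UNIV :: 'n set"] by (simp add: atLeast0LessThan)
  then show ?thesis
    unfolding basis_enum_def by (rule someI_ex)
qed

text \<open>Expanding \<open>f\<close> over all sequences of basis vectors, only the permutations survive, and they
  give the Leibniz formula.\<close>

lemma top_degree_det:
  fixes f :: "'n::finite covector" and D :: "real ^ 'n ^ 'n"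
  assumes f: "multilinear (CARD('n)) f"
    and perm: "\<And>\<pi> v. \<pi> permutes {..<CARD('n)} \<Longrightarrow> f (\<lambda>i. v (\<pi> i)) = of_int (sign \<pi>) * f v"
  shows "f (\<lambda>i. D *v coord_frame i) = det D * f coord_frame"
proof -
  let ?n = "CARD('n)"
  let ?b = "basis_enum :: nat \<Rightarrow> 'n"
  let ?P = "{..<?n} \<rightarrow>\<^sub>E (UNIV :: 'n set)"
  have b: "bij_betw ?b {..<?n} UNIV" by (rule bij_betw_basis_enum)
  have inj_b: "inj_on ?b {..<?n}" using b by (simp add: bij_betw_def)
  define F where "F p = restrict (\<lambda>a. p (?b a)) {..<?n}" for p :: "'n \<Rightarrow> 'n"
  define S where "S = {p. p permutes (UNIV :: 'n set)}"
  have S: "finite S" by (simp add: S_def finite_permutations)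
  have not_inj: "f (\<lambda>a. axis (I a) 1) = 0" if ni: "\<not> inj_on I {..<?n}" for I :: "nat \<Rightarrow> 'n"
  proof -
    obtain i j where ij: "i < ?n" "j < ?n" "i \<noteq> j" "I i = I j"
      using ni unfolding inj_on_def by blast
    have "(\<lambda>a. axis (I (Transposition.transpose i j a)) 1) = (\<lambda>a. axis (I a) (1::real))"
      using ij by (auto simp: Transposition.transpose_def)
    then have "f (\<lambda>a. axis (I a) 1) = - f (\<lambda>a. axis (I a) 1)"
      using perm[of "Transposition.transpose i j" "\<lambda>a. axis (I a) 1"] ij
      by (simp add: permutes_swap_id sign_swap_id)
    then show ?thesis by simp
  qed
  have F_inj: "inj_on F S"
  proof (rule inj_onI)
    fix p p' assume "F p = F p'"
    then have "p (?b a) = p' (?b a)" if "a < ?n" for a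
      using that by (metis F_def lessThan_iff restrict_apply')
    moreover have "\<exists>a<?n. x = ?b a" for x
      using b unfolding bij_betw_def by (metis UNIV_I imageE lessThan_iff)
    ultimately show "p = p'" by (metis ext)
  qed
  have F_image: "F ` S = {I \<in> ?P. inj_on I {..<?n}}"
  proof (intro equalityI subsetI)
    fix I assume "I \<in> F ` S"
    then obtain p where p: "p permutes UNIV" "I = F p" unfolding S_def by blast
    have "inj_on (p \<circ> ?b) {..<?n}"
      using inj_b permutes_inj[OF p(1)] by (intro comp_inj_on) (auto intro: inj_on_subset)
    then have "inj_on I {..<?n}"
      by (rule inj_on_cong[THEN iffD1, rotated]) (simp add: p(2) F_def)
    then show "I \<in> {I \<in> ?P. inj_on I {..<?n}}"
      by (simp add: p(2) F_def)
  next
    fix I assume I: "I \<in> {I \<in> ?P. inj_on I {..<?n}}"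
    define p where "p = (\<lambda>x. I (inv_into {..<?n} ?b x))"
    have "inj p"
    proof (rule injI)
      fix x y assume "p x = p y"
      moreover have mem: "inv_into {..<?n} ?b z \<in> {..<?n}" for z
        using b by (intro inv_into_into) (simp add: bij_betw_def)
      ultimately have "inv_into {..<?n} ?b x = inv_into {..<?n} ?b y"
        using I unfolding p_def by (auto dest: inj_onD)
      then show "x = y"
        using b by (metis UNIV_I bij_betw_def f_inv_into_f)
    qed
    then have "p permutes UNIV"
      by (intro bij_imp_permutes) (auto simp: bij_def finite_UNIV_inj_surj)
    moreover have "F p = I"
    proof
      fix a
      show "F p a = I a"
        using I inv_into_f_f[OF inj_b, of a] by (cases "a < ?n") (auto simp: F_def p_def PiE_def extensional_def)
    qed
    ultimately show "I \<in> F ` S" unfolding S_def by blast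
  qed
  have perm_term: "(\<Prod>a<?n. D $ F p a $ ?b a) * f (\<lambda>a. axis (F p a) 1) =
      of_int (sign p) * (\<Prod>i\<in>UNIV. D $ p i $ i) * f coord_frame" if "p \<in> S" for p
  proof -
    have p: "p permutes UNIV" using that by (simp add: S_def)
    have b': "bij_betw (inv_into {..<?n} ?b) UNIV {..<?n}" by (rule bij_betw_inv_into[OF b])
    define \<pi> where "\<pi> = map_permutation UNIV (inv_into {..<?n} ?b) p"
    have \<pi>: "\<pi> permutes {..<?n}"
      unfolding \<pi>_def by (rule map_permutation_permutes[OF b' p])
    have sgn: "sign \<pi> = sign p"
      unfolding \<pi>_def using b' p by (intro sign_map_permutation) (auto simp: bij_betw_def)
    have b\<pi>: "?b (\<pi> a) = p (?b a)" if "a < ?n" for a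
    proof -
      have "\<pi> a = \<pi> (inv_into {..<?n} ?b (?b a))"
        using that by (simp add: inv_into_f_f[OF inj_b])
      also have "\<dots> = inv_into {..<?n} ?b (p (?b a))"
        unfolding \<pi>_def using b' by (intro map_permutation_apply) (auto simp: bij_betw_def)
      finally show ?thesis
        using b by (simp add: bij_betw_def f_inv_into_f)
    qed
    have "f (\<lambda>a. axis (F p a) 1) = f (\<lambda>a. coord_frame (\<pi> a))"
      by (intro multilinear_cong[OF f]) (simp add: F_def coord_frame_def b\<pi>)
    also have "\<dots> = of_int (sign p) * f coord_frame"
      by (simp add: perm[OF \<pi>] sgn)
    finally have "f (\<lambda>a. axis (F p a) 1) = of_int (sign p) * f coord_frame" .
    moreover have "(\<Prod>a<?n. D $ F p a $ ?b a) = (\<Prod>i\<in>UNIV. D $ p i $ i)"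
      using prod.reindex_bij_betw[OF b, of "\<lambda>i. D $ p i $ i"] by (simp add: F_def)
    ultimately show ?thesis by simp
  qed
  have "f (\<lambda>i. D *v coord_frame i) =
      (\<Sum>I\<in>?P. (\<Prod>a<?n. D $ I a $ ?b a) * f (\<lambda>a. axis (I a) 1))"
    unfolding coord_frame_def matrix_vector_axis by (rule multilinear_expand[OF f])
  also have "\<dots> = (\<Sum>I\<in>F ` S. (\<Prod>a<?n. D $ I a $ ?b a) * f (\<lambda>a. axis (I a) 1))"
    unfolding F_image by (intro sum.mono_neutral_right) (auto simp: finite_PiE not_inj)
  also have "\<dots> = (\<Sum>p\<in>S. (\<Prod>a<?n. D $ F p a $ ?b a) * f (\<lambda>a. axis (F p a) 1))"
    by (rule sum.reindex[OF F_inj, unfolded o_def])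
  also have "\<dots> = (\<Sum>p\<in>S. of_int (sign p) * (\<Prod>i\<in>UNIV. D $ p i $ i) * f coord_frame)"
    by (intro sum.cong refl perm_term)
  also have "\<dots> = det (Finite_Cartesian_Product.transpose D) * f coord_frame"
    by (simp add: det_def S_def sum_distrib_right Finite_Cartesian_Product.transpose_def)
  finally show ?thesis by (simp add: det_transpose)
qed

section \<open>Charts, the pointwise norm and the volume\<close>

lemma smooth_on_differentiable:
  assumes "smooth_on S f" and "x \<in> S"
  shows "f differentiable (at x within S)"
proof -
  obtain W F where W: "open W" "x \<in> W" "\<forall>m. Ck_on m W F" "\<forall>y\<in>S \<inter> W. F y = f y"
    using bspec[OF assms[unfolded smooth_on_def]] by (elim exE conjE)
  have "F differentiable (at x)" using W(3)[THEN spec, of "Suc 0"] W(2) by simp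
  then obtain F' where "(F has_derivative F') (at x within S)"
    unfolding differentiable_def by (meson has_derivative_at_withinI)
  moreover obtain d where "d > 0" "\<And>y. dist y x < d \<Longrightarrow> y \<in> W"
    using W(1,2) by (meson open_dist)
  ultimately have "(f has_derivative F') (at x within S)"
    using W(4) assms(2) by (blast intro: has_derivative_transform_within)
  then show ?thesis by (rule differentiableI)
qed

lemma smooth_on_imp_continuous_on: "smooth_on S f \<Longrightarrow> continuous_on S f"
  using smooth_on_differentiable differentiable_imp_continuous_within
  unfolding continuous_on_eq_continuous_within by blast

lemma matrix_eq_bilinear:
  fixes A B :: "real ^ 'n ^ 'n"
  assumes "\<And>v w. v \<bullet> (A *v w) = v \<bullet> (B *v w)"
  shows "A = B"
proof -
  have "A *v w = B *v w" for w
    using assms[of _ w] vector_eq_ldot[of "A *v w" "B *v w"] by blast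
  then show ?thesis by (simp add: matrix_eq)
qed

lemma measurable_restrict_completion:
  assumes "f \<in> measurable (restrict_space M A) N"
  shows "f \<in> measurable (restrict_space (completion M) A) N"
proof (rule measurableI)
  fix x assume "x \<in> space (restrict_space (completion M) A)"
  then show "f x \<in> space N"
    using measurable_space[OF assms, of x] by (simp add: space_restrict_space)
next
  fix S assume "S \<in> sets N"
  then have "f -` S \<inter> space (restrict_space M A) \<in> sets (restrict_space M A)"
    using measurable_sets[OF assms] by blast
  then show "f -` S \<inter> space (restrict_space (completion M) A) \<in> sets (restrict_space (completion M) A)"
    by (auto simp: space_restrict_space sets_restrict_space image_iff)
qed

lemma continuous_on_det:
  fixes A :: "'a::topological_space \<Rightarrow> real ^ 'n ^ 'n"
  assumes "\<And>i j. continuous_on S (\<lambda>x. A x $ i $ j)"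
  shows "continuous_on S (\<lambda>x. det (A x))"
  unfolding det_def by (intro continuous_intros assms)

locale riemannian_measure =
  fixes X :: "('a::{t2_space, second_countable_topology}, 'n::finite) riemannian"
    and \<mu> :: "'a measure"
  assumes manifold: "riemannian_manifold X"
    and volume: "riemannian_volume X \<mu>"
begin

abbreviation "J \<equiv> transition_deriv :: ('a, 'n) chart \<Rightarrow> _"

lemma sets_\<mu> [measurable_cong]: "sets \<mu> = sets borel"
  using volume by (simp add: riemannian_volume_def)

lemma space_\<mu> [simp]: "space \<mu> = UNIV"
  using sets_eq_imp_space_eq[OF sets_\<mu>] by simp

lemma
  assumes "c \<in> atlas X"
  shows chart_open: "open (fst c)"
    and chart_continuous: "continuous_on (fst c) (snd c)"
    and chart_inv_continuous: "continuous_on (snd c ` fst c) (chart_inv c)"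
    and chart_inv_chart: "x \<in> fst c \<Longrightarrow> chart_inv c (snd c x) = x"
    and chart_inj: "inj_on (snd c) (fst c)"
proof -
  have "is_chart c"
    using assms manifold by (simp add: riemannian_manifold_def smooth_atlas_def)
  then have h: "open (fst c)" "homeomorphism (fst c) (snd c ` fst c) (snd c) (chart_inv c)"
    by (simp_all add: is_chart_def)
  show "open (fst c)" "continuous_on (fst c) (snd c)" "continuous_on (snd c ` fst c) (chart_inv c)"
    using h by (auto simp: homeomorphism_def)
  show inv: "chart_inv c (snd c x) = x" if "x \<in> fst c" for x
    using h that by (simp add: homeomorphism_def)
  show "inj_on (snd c) (fst c)"
    by (rule inj_on_inverseI) (rule inv)
qed

lemma chart_at: "chart_at X x \<in> atlas X" "x \<in> fst (chart_at X x)"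
proof -
  have "\<exists>c. c \<in> atlas X \<and> x \<in> fst c"
    using manifold unfolding riemannian_manifold_def smooth_atlas_def by (metis UNIV_I UN_E)
  then have "chart_at X x \<in> atlas X \<and> x \<in> fst (chart_at X x)"
    unfolding chart_at_def by (rule someI_ex)
  then show "chart_at X x \<in> atlas X" "x \<in> fst (chart_at X x)" by auto
qed

lemma transition_smooth:
  "c \<in> atlas X \<Longrightarrow> c' \<in> atlas X \<Longrightarrow> smooth_on (snd c ` (fst c \<inter> fst c')) (transition c c')"
  using manifold by (simp add: riemannian_manifold_def smooth_atlas_def)

lemma transition_chart:
  "c \<in> atlas X \<Longrightarrow> x \<in> fst c \<Longrightarrow> transition c c' (snd c x) = snd c' x"
  by (simp add: transition_def chart_inv_chart)

lemma transition_has_derivative: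
  assumes "c \<in> atlas X" "c' \<in> atlas X" "x \<in> fst c" "x \<in> fst c'"
  shows "(transition c c' has_derivative J c c' x) (at (snd c x) within snd c ` (fst c \<inter> fst c'))"
  unfolding transition_deriv_def
  using smooth_on_differentiable[OF transition_smooth[OF assms(1,2)], of "snd c x"] assms
  by (subst frechet_derivative_works[symmetric]) auto

lemma transition_deriv_linear:
  assumes "c \<in> atlas X" "c' \<in> atlas X" "x \<in> fst c" "x \<in> fst c'"
  shows "linear (J c c' x)"
  using transition_has_derivative[OF assms] by (rule has_derivative_linear)

lemma transition_deriv_matrix:
  assumes "c \<in> atlas X" "c' \<in> atlas X" "x \<in> fst c" "x \<in> fst c'"
  shows "J c c' x = (*v) (matrix (J c c' x))"
proof -
  have "Vector_Spaces.linear (*s) (*s) (J c c' x)"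
    unfolding linear_matrix_vector_mul_eq by (rule transition_deriv_linear[OF assms])
  then show ?thesis by (intro ext) (rule matrix_works[symmetric])
qed

lemma metric_pos_def: "c \<in> atlas X \<Longrightarrow> x \<in> fst c \<Longrightarrow> pos_def (metric X c x)"
  using manifold unfolding riemannian_manifold_def riemannian_metric_def pos_def_def by blast

lemma metric_transition:
  assumes "c \<in> atlas X" "c' \<in> atlas X" "x \<in> fst c" "x \<in> fst c'"
  shows "metric X c x = transpose (matrix (J c c' x)) ** metric X c' x ** matrix (J c c' x)"
proof (rule matrix_eq_bilinear)
  fix v w :: "real ^ 'n"
  let ?D = "matrix (J c c' x)"
  have "v \<bullet> (metric X c x *v w) = J c c' x v \<bullet> (metric X c' x *v J c c' x w)"
    using manifold assms unfolding riemannian_manifold_def riemannian_metric_def by blast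
  also have "\<dots> = (?D *v v) \<bullet> (metric X c' x *v (?D *v w))"
    using transition_deriv_matrix[OF assms] by metis
  also have "\<dots> = v \<bullet> (transpose ?D *v (metric X c' x *v (?D *v w)))"
    by (metis dot_lmul_matrix inner_commute transpose_matrix_vector)
  finally show "v \<bullet> (metric X c x *v w) = v \<bullet> (transpose ?D ** metric X c' x ** ?D *v w)"
    by (simp only: matrix_vector_mul_assoc matrix_mul_assoc)
qed

text \<open>Since the metrics are positive definite, their transformation rule forces the Jacobian of a
  transition map to be invertible, also at the boundary.\<close>

lemma det_transition_nonzero:
  assumes "c \<in> atlas X" "c' \<in> atlas X" "x \<in> fst c" "x \<in> fst c'"
  shows "det (matrix (J c c' x)) \<noteq> 0"
    and "det (metric X c x) = (det (matrix (J c c' x)))\<^sup>2 * det (metric X c' x)"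
proof -
  show "det (metric X c x) = (det (matrix (J c c' x)))\<^sup>2 * det (metric X c' x)"
    by (subst metric_transition[OF assms]) (simp add: det_mul det_transpose power2_eq_square)
  then show "det (matrix (J c c' x)) \<noteq> 0"
    using pos_def_det_pos[OF metric_pos_def[OF assms(1,3)]] by auto
qed

lemma is_form_multilinear: "is_form X k \<omega> \<Longrightarrow> c \<in> atlas X \<Longrightarrow> x \<in> fst c \<Longrightarrow> multilinear k (\<omega> c x)"
  unfolding is_form_def using alternating_imp_multilinear by blast

text \<open>The norm at \<open>x\<close> is defined in a chart that may jump from point to point. By invariance it can be
  computed in a fixed chart, where it depends measurably on the point.\<close>

lemma form_norm_chart:
  assumes "is_form X k \<omega>" and "c \<in> atlas X" and "x \<in> fst c"
  shows "form_norm X k \<omega> x = covector_norm (metric X c x) k (\<omega> c x)"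
proof -
  define c' where "c' = chart_at X x"
  have c': "c' \<in> atlas X" "x \<in> fst c'" using chart_at by (auto simp: c'_def)
  let ?D = "matrix (J c' c x)"
  have "invertible ?D"
    using det_transition_nonzero(1)[OF c'(1) assms(2) c'(2) assms(3)] by (simp add: invertible_det_nz)
  then obtain E where E: "?D ** E = mat 1" "E ** ?D = mat 1" unfolding invertible_def by blast
  have "\<omega> c' x = (\<lambda>v. \<omega> c x (\<lambda>i. J c' c x (v i)))"
    using assms c' unfolding is_form_def by blast
  also have "\<dots> = (\<lambda>v. \<omega> c x (\<lambda>i. ?D *v v i))"
    using transition_deriv_matrix[OF c'(1) assms(2) c'(2) assms(3)] by metis
  finally have \<omega>: "\<omega> c' x = (\<lambda>v. \<omega> c x (\<lambda>i. ?D *v v i))" .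
  have "covector_norm (metric X c' x) k (\<omega> c' x) = covector_norm (metric X c x) k (\<omega> c x)"
    unfolding \<omega>
    by (intro covector_norm_pullback[OF _ _ _ E] metric_transition c' assms metric_pos_def
        is_form_multilinear[OF assms(1)])
  then show ?thesis by (simp add: form_norm_def c'_def)
qed

lemma metric_continuous:
  assumes "c \<in> atlas X"
  shows "continuous_on (fst c) (\<lambda>x. metric X c x $ i $ j)"
proof -
  have "continuous_on (snd c ` fst c) (\<lambda>y. metric X c (chart_inv c y))"
    using manifold assms unfolding riemannian_manifold_def riemannian_metric_def
    by (intro smooth_on_imp_continuous_on) blast
  then have "continuous_on (fst c) (\<lambda>x. metric X c (chart_inv c (snd c x)))"
    using continuous_on_compose2[OF _ chart_continuous[OF assms]] by blast
  then have "continuous_on (fst c) (\<lambda>x. metric X c x)"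
    by (rule continuous_on_eq) (simp add: chart_inv_chart assms)
  then show ?thesis by (intro continuous_intros)
qed

lemma det_metric_continuous: "c \<in> atlas X \<Longrightarrow> continuous_on (fst c) (\<lambda>x. det (metric X c x))"
  by (intro continuous_on_det metric_continuous)

lemma det_metric_pos: "c \<in> atlas X \<Longrightarrow> x \<in> fst c \<Longrightarrow> 0 < det (metric X c x)"
  by (intro pos_def_det_pos metric_pos_def)

lemma matrix_inv_metric_continuous:
  assumes "c \<in> atlas X"
  shows "continuous_on (fst c) (\<lambda>x. matrix_inv (metric X c x) $ i $ j)"
proof -
  have nz: "det (metric X c x) \<noteq> 0" if "x \<in> fst c" for x
    using det_metric_pos[OF assms that] by simp
  have "continuous_on (fst c) (\<lambda>x.
      det (\<chi> k l. if l = i then axis j 1 $ k else metric X c x $ k $ l) / det (metric X c x))"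
  proof (intro continuous_on_divide continuous_on_det)
    show "continuous_on (fst c)
        (\<lambda>x. (\<chi> k l. if l = i then axis j 1 $ k else metric X c x $ k $ l) $ a $ b)" for a b
      using metric_continuous[OF assms] by (cases "b = i") auto
  qed (use assms nz metric_continuous in auto)
  then show ?thesis
    by (rule continuous_on_eq) (simp add: matrix_inv_component nz)
qed

lemma continuous_imp_measurable:
  fixes f :: "'a \<Rightarrow> real"
  assumes "continuous_on A f"
  shows "f \<in> borel_measurable (restrict_space (completion \<mu>) A)"
proof (rule measurable_restrict_completion)
  have "sets (restrict_space \<mu> A) = sets (restrict_space borel A)"
    by (rule sets_restrict_space_cong[OF sets_\<mu>])
  then show "f \<in> borel_measurable (restrict_space \<mu> A)"
    using borel_measurable_continuous_on_restrict[OF assms] measurable_cong_sets by blast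
qed

text \<open>By second countability, countably many charts cover the manifold.\<close>

lemma measurable_chartwise_on:
  assumes "open U" and "\<And>x. x \<notin> U \<Longrightarrow> f x = (0::real)"
    and "\<And>c. c \<in> atlas X \<Longrightarrow> f \<in> borel_measurable (restrict_space (completion \<mu>) (U \<inter> fst c))"
  shows "f \<in> borel_measurable (completion \<mu>)"
proof -
  have "\<And>S. S \<in> fst ` atlas X \<Longrightarrow> open S" using chart_open by auto
  then obtain F where F: "F \<subseteq> fst ` atlas X" "countable F" "\<Union>F = \<Union>(fst ` atlas X)"
    using Lindelof by metis
  have cover: "\<Union>F = UNIV" using F(3) chart_at by blast
  show ?thesis
  proof (rule measurable_piecewise_restrict)
    show "countable (insert (- U) ((\<inter>) U ` F))" using F(2) by simp
    show "space (completion \<mu>) \<subseteq> \<Union>(insert (- U) ((\<inter>) U ` F))"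
      using cover by auto
    fix \<Omega> assume \<Omega>: "\<Omega> \<in> insert (- U) ((\<inter>) U ` F)"
    have "- U \<in> sets borel" using assms(1) by (intro borel_closed) (simp add: closed_Compl)
    moreover have "U \<inter> V \<in> sets borel" if "V \<in> F" for V
      using that F(1) chart_open assms(1) by (intro borel_open open_Int) auto
    ultimately have "\<Omega> \<in> sets borel" using \<Omega> by blast
    then show "\<Omega> \<inter> space (completion \<mu>) \<in> sets (completion \<mu>)"
      by (simp add: sets_\<mu>)
    show "f \<in> borel_measurable (restrict_space (completion \<mu>) \<Omega>)"
      using \<Omega>
    proof
      assume "\<Omega> = - U"
      have "(\<lambda>x. 0) \<in> borel_measurable (restrict_space (completion \<mu>) \<Omega>)" by simp
      then show ?thesis
        by (rule measurable_cong[THEN iffD1, rotated])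
          (simp add: \<open>\<Omega> = - U\<close> space_restrict_space assms(2))
    next
      assume "\<Omega> \<in> (\<inter>) U ` F"
      then show ?thesis using F(1) assms(3) by auto
    qed
  qed
qed

lemma measurable_chartwise:
  fixes f :: "'a \<Rightarrow> real"
  assumes "\<And>c. c \<in> atlas X \<Longrightarrow> f \<in> borel_measurable (restrict_space (completion \<mu>) (fst c))"
  shows "f \<in> borel_measurable (completion \<mu>)"
  using assms by (intro measurable_chartwise_on[of UNIV]) auto

lemma form_norm_measurable:
  assumes "measurable_form X \<mu> k \<omega>"
  shows "form_norm X k \<omega> \<in> borel_measurable (completion \<mu>)"
proof (rule measurable_chartwise)
  fix c assume c: "c \<in> atlas X"
  have f: "is_form X k \<omega>"
    and m[measurable]: "\<And>v. (\<lambda>x. \<omega> c x v) \<in> borel_measurable (restrict_space (completion \<mu>) (fst c))"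
    using assms c by (auto simp: measurable_form_def)
  have [measurable]: "(\<lambda>x. matrix_inv (metric X c x) $ i $ j) \<in>
      borel_measurable (restrict_space (completion \<mu>) (fst c))" for i j
    by (intro continuous_imp_measurable matrix_inv_metric_continuous c)
  have "(\<lambda>x. covector_norm (metric X c x) k (\<omega> c x)) \<in>
      borel_measurable (restrict_space (completion \<mu>) (fst c))"
    unfolding covector_norm_def by measurable
  then show "form_norm X k \<omega> \<in> borel_measurable (restrict_space (completion \<mu>) (fst c))"
    by (rule measurable_cong[THEN iffD1, rotated])
      (simp add: space_restrict_space form_norm_chart[OF f c])
qed

text \<open>A small coordinate ball on which the density is bounded has finite volume.\<close>

lemma ex_open_finite_volume: "\<exists>U. open U \<and> x \<in> U \<and> emeasure \<mu> U < \<infinity>"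
proof -
  define c where "c = chart_at X x"
  have c: "c \<in> atlas X" "x \<in> fst c" using chart_at by (auto simp: c_def)
  define M where "M = sqrt (det (metric X c x)) + 1"
  define U where "U = {y \<in> fst c. sqrt (det (metric X c y)) < M} \<inter> {y \<in> fst c. snd c y \<in> ball (snd c x) 1}"
  have "open U"
    unfolding U_def
  proof (intro open_Int)
    have "continuous_on (fst c) (\<lambda>y. sqrt (det (metric X c y)))"
      by (intro continuous_intros det_metric_continuous c)
    from continuous_open_preimage[OF this chart_open[OF c(1)], of "{..<M}"]
    show "open {y \<in> fst c. sqrt (det (metric X c y)) < M}"
      by (rule back_subst[of "open"]) auto
    from continuous_open_preimage[OF chart_continuous[OF c(1)] chart_open[OF c(1)], of "ball (snd c x) 1"]
    show "open {y \<in> fst c. snd c y \<in> ball (snd c x) 1}"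
      by (rule back_subst[of "open"]) auto
  qed
  moreover have "x \<in> U" using c by (simp add: U_def M_def)
  moreover have "emeasure \<mu> U < \<infinity>"
  proof -
    have "U \<subseteq> fst c" "U \<in> sets borel"
      using \<open>open U\<close> by (auto simp: U_def)
    then have "emeasure \<mu> U =
        (\<integral>\<^sup>+y\<in>snd c ` U. ennreal (sqrt (det (metric X c (chart_inv c y)))) \<partial>lborel)"
      using volume c(1) unfolding riemannian_volume_def by blast
    also have "\<dots> \<le> (\<integral>\<^sup>+y. ennreal M * indicator (ball (snd c x) 1) y \<partial>lborel)"
    proof (rule nn_integral_mono)
      fix y
      show "ennreal (sqrt (det (metric X c (chart_inv c y)))) * indicator (snd c ` U) y
          \<le> ennreal M * indicator (ball (snd c x) 1) y"
      proof (cases "y \<in> snd c ` U")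
        case True
        then obtain z where "z \<in> U" "y = snd c z" by blast
        then show ?thesis
          by (auto simp: U_def chart_inv_chart c intro!: ennreal_leI)
      qed simp
    qed
    also have "\<dots> = ennreal M * emeasure lborel (ball (snd c x) 1)"
      by (simp add: nn_integral_cmult_indicator)
    also have "\<dots> < \<infinity>"
      using emeasure_lborel_ball_finite[of "snd c x" 1] by (simp add: ennreal_mult_less_top)
    finally show ?thesis .
  qed
  ultimately show ?thesis by blast
qed

lemma compact_finite_volume:
  assumes "compact K"
  shows "K \<in> sets (completion \<mu>)" and "emeasure (completion \<mu>) K < \<infinity>"
proof -
  have K: "K \<in> sets \<mu>" using compact_imp_closed[OF assms] by (simp add: sets_\<mu>)
  then show "K \<in> sets (completion \<mu>)" by simp
  have "\<forall>x. \<exists>U. open U \<and> x \<in> U \<and> emeasure \<mu> U < \<infinity>" using ex_open_finite_volume by blast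
  then obtain U where U: "\<And>x. open (U x)" "\<And>x. x \<in> U x" "\<And>x. emeasure \<mu> (U x) < \<infinity>"
    by metis
  obtain F where F: "finite F" "K \<subseteq> (\<Union>x\<in>F. U x)"
    using compactE_image[OF assms, of UNIV U] U by (metis UNIV_I UN_I subsetI)
  have "emeasure \<mu> K \<le> emeasure \<mu> (\<Union>x\<in>F. U x)"
    using F U(1) by (intro emeasure_mono) (auto simp: sets_\<mu>)
  also have "\<dots> \<le> (\<Sum>x\<in>F. emeasure \<mu> (U x))"
    using F U(1) by (intro emeasure_subadditive_finite) (auto simp: sets_\<mu>)
  also have "\<dots> < \<infinity>" using F(1) U(3) by (simp add: ennreal_sum_less_top)
  finally show "emeasure (completion \<mu>) K < \<infinity>" using K by simp
qed

end

section \<open>N-functions and Orlicz series\<close>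

lemma
  assumes "N_function \<Phi>"
  shows N_function_nonneg: "0 \<le> \<Phi> x"
    and N_function_zero: "\<Phi> 0 = 0"
    and N_function_convex: "convex_on UNIV \<Phi>"
    and N_function_continuous: "continuous_on UNIV \<Phi>"
    and N_function_measurable: "\<Phi> \<in> borel_measurable borel"
proof -
  show "0 \<le> \<Phi> x" "\<Phi> 0 = 0" and c: "convex_on UNIV \<Phi>"
    using assms by (simp_all add: N_function_def)
  show "continuous_on UNIV \<Phi>"
    using convex_on_continuous[OF open_UNIV c] .
  then show "\<Phi> \<in> borel_measurable borel"
    by (rule borel_measurable_continuous_onI)
qed

lemma N_function_scale_le:
  assumes "N_function \<Phi>" and "0 \<le> a" "a \<le> 1"
  shows "\<Phi> (a * t) \<le> a * \<Phi> t"
  using convex_onD[OF N_function_convex[OF assms(1)] assms(2,3), of 0 t] N_function_zero[OF assms(1)]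
  by simp

lemma N_function_mono:
  assumes "N_function \<Phi>" and "0 \<le> s" "s \<le> t"
  shows "\<Phi> s \<le> \<Phi> t"
proof (cases "t = 0")
  case False
  then have "\<Phi> s \<le> (s / t) * \<Phi> t"
    using N_function_scale_le[OF assms(1), of "s / t" t] assms by simp
  also have "\<dots> \<le> 1 * \<Phi> t"
    using assms False N_function_nonneg[OF assms(1)] by (intro mult_right_mono) auto
  finally show ?thesis by simp
qed (use assms in simp)

lemma N_function_superlinear:
  assumes "N_function \<Phi>"
  shows "\<exists>M\<ge>0. \<forall>t\<ge>0. t \<le> \<Phi> t + M"
proof -
  have "\<forall>\<^sub>F t in at_top. 1 \<le> \<Phi> t / t"
    using assms unfolding N_function_def filterlim_at_top by blast
  then obtain M where M: "\<And>t. t \<ge> M \<Longrightarrow> 1 \<le> \<Phi> t / t"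
    by (auto simp: eventually_at_top_linorder)
  have "t \<le> \<Phi> t + max M 1" if "t \<ge> 0" for t
  proof (cases "t \<ge> max M 1")
    case True
    then show ?thesis using M[of t] by (simp add: field_simps)
  next
    case False
    then show ?thesis using N_function_nonneg[OF assms, of t] by linarith
  qed
  then show ?thesis by (intro exI[of _ "max M 1"]) auto
qed

lemma N_function_jensen:
  fixes a t :: "nat \<Rightarrow> real" and m :: nat
  assumes "N_function \<Phi>" and "\<And>i. i < m \<Longrightarrow> 0 \<le> a i" and "(\<Sum>i<m. a i) \<le> 1"
  shows "\<Phi> (\<Sum>i<m. a i * t i) \<le> (\<Sum>i<m. a i * \<Phi> (t i))"
proof -
  define b where "b i = (if i < m then a i else 1 - (\<Sum>i<m. a i))" for i
  define u where "u i = (if i < m then t i else 0)" for i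
  have split: "(\<Sum>i\<le>m. h i) = (\<Sum>i<m. h i) + h m" for h :: "nat \<Rightarrow> real"
    by (metis lessThan_Suc_atMost sum.lessThan_Suc)
  have "(\<Sum>i\<le>m. b i) = 1"
    by (simp add: split b_def)
  then have "\<Phi> (\<Sum>i\<le>m. b i *\<^sub>R u i) \<le> (\<Sum>i\<le>m. b i * \<Phi> (u i))"
    using assms by (intro convex_on_sum[OF _ _ N_function_convex[OF assms(1)]]) (auto simp: b_def)
  then show ?thesis
    using N_function_zero[OF assms(1)]
    by (simp add: split b_def u_def)
qed

text \<open>If \<open>\<kappa> i\<close> bounds the gauge of \<open>f i\<close>, then \<open>\<Lambda>\<close> bounds the gauge of the sum: by Jensen's
  inequality for the partial sums and by monotone convergence in the limit. As \<open>\<Phi>\<close> tends to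
  infinity, the series converges almost everywhere.\<close>

lemma Orlicz_series:
  fixes f :: "nat \<Rightarrow> 'x \<Rightarrow> real"
  assumes \<Phi>: "N_function \<Phi>"
    and [measurable]: "\<And>i. f i \<in> borel_measurable M"
    and f0: "\<And>i x. 0 \<le> f i x"
    and \<kappa>: "\<And>i. 0 < \<kappa> i" "summable \<kappa>" "(\<Sum>i. \<kappa> i) \<le> \<Lambda>"
    and le1: "\<And>i. (\<integral>\<^sup>+x. ennreal (\<Phi> (f i x / \<kappa> i)) \<partial>M) \<le> 1"
  shows "AE x in M. summable (\<lambda>i. f i x)"
    and "(\<integral>\<^sup>+x. ennreal (\<Phi> ((\<Sum>i. f i x) / \<Lambda>)) * indicator {x. summable (\<lambda>i. f i x)} x \<partial>M) \<le> 1"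
proof -
  note [measurable] = N_function_measurable[OF \<Phi>]
  have part: "(\<Sum>i<m. \<kappa> i) \<le> \<Lambda>" for m
    using sum_le_suminf[OF \<kappa>(2), of "{..<m}"] \<kappa>(1,3) by (simp add: less_imp_le)
  have \<Lambda>: "0 < \<Lambda>" using part[of 1] \<kappa>(1)[of 0] by simp
  define g where "g m x = (\<Sum>i<m. f i x) / \<Lambda>" for m x
  have g0: "0 \<le> g m x" for m x using f0 \<Lambda> by (simp add: g_def sum_nonneg)
  have g_mono: "g m x \<le> g n x" if "m \<le> n" for m n x
    unfolding g_def using that f0 \<Lambda> by (intro divide_right_mono sum_mono2) auto
  define h where "h m x = ennreal (\<Phi> (g m x))" for m x
  have [measurable]: "h m \<in> borel_measurable M" for m
    unfolding h_def g_def by measurable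
  have "incseq h"
    unfolding h_def by (intro incseq_SucI le_funI ennreal_leI N_function_mono[OF \<Phi>] g0 g_mono) simp
  have "(\<integral>\<^sup>+x. h m x \<partial>M) \<le> 1" for m
  proof -
    have "(\<integral>\<^sup>+x. h m x \<partial>M) \<le> (\<integral>\<^sup>+x. (\<Sum>i<m. ennreal (\<kappa> i / \<Lambda>) * ennreal (\<Phi> (f i x / \<kappa> i))) \<partial>M)"
    proof (rule nn_integral_mono)
      fix x
      have "g m x = (\<Sum>i<m. (\<kappa> i / \<Lambda>) * (f i x / \<kappa> i))"
        using \<kappa>(1) unfolding g_def sum_divide_distrib
        by (intro sum.cong) (simp_all add: less_imp_neq[symmetric])
      also have "\<Phi> \<dots> \<le> (\<Sum>i<m. (\<kappa> i / \<Lambda>) * \<Phi> (f i x / \<kappa> i))"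
        using \<kappa>(1) \<Lambda> part[of m]
        by (intro N_function_jensen[OF \<Phi>]) (auto simp: less_imp_le simp flip: sum_divide_distrib)
      finally have "h m x \<le> ennreal (\<Sum>i<m. (\<kappa> i / \<Lambda>) * \<Phi> (f i x / \<kappa> i))"
        unfolding h_def by (rule ennreal_leI)
      also have "\<dots> = (\<Sum>i<m. ennreal (\<kappa> i / \<Lambda>) * ennreal (\<Phi> (f i x / \<kappa> i)))"
        using \<kappa>(1) \<Lambda> N_function_nonneg[OF \<Phi>]
        by (simp add: less_imp_le flip: ennreal_mult sum_ennreal)
      finally show "h m x \<le> (\<Sum>i<m. ennreal (\<kappa> i / \<Lambda>) * ennreal (\<Phi> (f i x / \<kappa> i)))" .
    qed
    also have "\<dots> = (\<Sum>i<m. ennreal (\<kappa> i / \<Lambda>) * (\<integral>\<^sup>+x. ennreal (\<Phi> (f i x / \<kappa> i)) \<partial>M))"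
      by (simp add: nn_integral_sum nn_integral_cmult)
    also have "\<dots> \<le> (\<Sum>i<m. ennreal (\<kappa> i / \<Lambda>) * 1)"
      by (intro sum_mono mult_left_mono le1) simp
    also have "\<dots> = ennreal ((\<Sum>i<m. \<kappa> i) / \<Lambda>)"
      using \<kappa>(1) \<Lambda> by (simp add: sum_ennreal less_imp_le sum_divide_distrib)
    also have "\<dots> \<le> 1"
      using part[of m] \<Lambda> by (simp add: ennreal_le_1)
    finally show ?thesis .
  qed
  then have SUP_le: "(\<integral>\<^sup>+x. (SUP m. h m x) \<partial>M) \<le> 1"
    by (subst nn_integral_monotone_convergence_SUP[OF \<open>incseq h\<close>]) (auto intro: SUP_least)
  obtain B where B: "0 \<le> B" "\<And>t. 0 \<le> t \<Longrightarrow> t \<le> \<Phi> t + B"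
    using N_function_superlinear[OF \<Phi>] by blast
  have "AE x in M. (SUP m. h m x) \<noteq> \<infinity>"
    using SUP_le by (intro nn_integral_PInf_AE) (auto simp: top_unique)
  then show "AE x in M. summable (\<lambda>i. f i x)"
  proof eventually_elim
    case (elim x)
    then obtain r where r: "0 \<le> r" "(SUP m. h m x) = ennreal r"
      by (cases "SUP m. h m x" rule: ennreal_cases) auto
    show ?case
    proof (rule summableI_nonneg_bounded)
      fix m
      have "h m x \<le> ennreal r" unfolding r(2)[symmetric] by (rule SUP_upper) simp
      then have "\<Phi> (g m x) \<le> r" using r(1) by (simp add: h_def)
      then have "g m x \<le> r + B" using B(2)[OF g0] by (meson add_right_mono order_trans)
      then show "(\<Sum>i<m. f i x) \<le> (r + B) * \<Lambda>" using \<Lambda> by (simp add: g_def field_simps)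
    qed (rule f0)
  qed
  have "ennreal (\<Phi> ((\<Sum>i. f i x) / \<Lambda>)) \<le> (SUP m. h m x)" if "summable (\<lambda>i. f i x)" for x
  proof (rule LIMSEQ_le_const2)
    have "(\<lambda>m. g m x) \<longlonglongrightarrow> (\<Sum>i. f i x) / \<Lambda>"
      unfolding g_def using summable_LIMSEQ[OF that] \<Lambda> by (intro tendsto_divide) auto
    moreover have "isCont \<Phi> ((\<Sum>i. f i x) / \<Lambda>)"
      using N_function_continuous[OF \<Phi>] by (simp add: continuous_on_eq_continuous_at)
    ultimately show "(\<lambda>m. h m x) \<longlonglongrightarrow> ennreal (\<Phi> ((\<Sum>i. f i x) / \<Lambda>))"
      unfolding h_def by (intro tendsto_ennrealI isCont_tendsto_compose[of _ \<Phi>])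
    show "\<exists>N. \<forall>m\<ge>N. h m x \<le> (SUP m. h m x)"
      by (intro exI[of _ 0] allI impI SUP_upper) simp
  qed
  then have "(\<integral>\<^sup>+x. ennreal (\<Phi> ((\<Sum>i. f i x) / \<Lambda>)) * indicator {x. summable (\<lambda>i. f i x)} x \<partial>M)
      \<le> (\<integral>\<^sup>+x. (SUP m. h m x) \<partial>M)"
    by (intro nn_integral_mono) (auto simp: indicator_def)
  with SUP_le show "(\<integral>\<^sup>+x. ennreal (\<Phi> ((\<Sum>i. f i x) / \<Lambda>)) * indicator {x. summable (\<lambda>i. f i x)} x \<partial>M) \<le> 1"
    by (rule order_trans[rotated])
qed

section \<open>The Orlicz space of forms\<close>

lemma alternating_zero: "alternating k (\<lambda>v. 0)"
  by (simp add: alternating_def linear_zero)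

lemma alternating_add:
  "alternating k \<alpha> \<Longrightarrow> alternating k \<beta> \<Longrightarrow> alternating k (\<lambda>v. \<alpha> v + \<beta> v)"
  unfolding alternating_def
  by (intro conjI allI impI linear_compose_add) (metis add_0)+

lemma alternating_scale:
  "alternating k \<alpha> \<Longrightarrow> alternating k (\<lambda>v. a * \<alpha> v)"
  unfolding alternating_def
  by (auto simp: linear_iff algebra_simps intro!: arg_cong[of _ _ "(*) a"])

lemma alternating_suminf:
  assumes "\<And>i. alternating k (\<alpha> i)" and "\<And>v. summable (\<lambda>i. \<alpha> i v)"
  shows "alternating k (\<lambda>v. \<Sum>i. \<alpha> i v)"
  unfolding alternating_def
proof (intro conjI allI impI)
  fix v :: "nat \<Rightarrow> real ^ 'a" and j
  assume "j < k"
  then have "linear (\<lambda>w. \<alpha> i (v(j := w)))" for i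
    using assms(1) unfolding alternating_def by blast
  then show "linear (\<lambda>w. \<Sum>i. \<alpha> i (v(j := w)))"
    using assms(2) by (simp add: linear_iff suminf_add suminf_mult)
next
  fix v :: "nat \<Rightarrow> real ^ 'a" and i j
  assume "i < k" "j < k" "i \<noteq> j \<and> v i = v j"
  then have "\<alpha> l v = 0" for l
    using assms(1)[of l] unfolding alternating_def by blast
  then show "(\<Sum>l. \<alpha> l v) = 0" by simp
next
  fix v w :: "nat \<Rightarrow> real ^ 'a"
  assume "\<forall>i<k. v i = w i"
  then have "\<alpha> l v = \<alpha> l w" for l
    using assms(1)[of l] unfolding alternating_def by blast
  then show "(\<Sum>l. \<alpha> l v) = (\<Sum>l. \<alpha> l w)" by simp
qed

text \<open>On covectors, pointwise convergence is convergence in norm, so the triangle inequality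
  extends to series.\<close>

lemma covector_norm_suminf_le:
  assumes g: "pos_def g" and \<alpha>: "\<And>i. multilinear k (\<alpha> i)"
    and sm: "summable (\<lambda>i. covector_norm g k (\<alpha> i))"
  shows "summable (\<lambda>i. \<alpha> i v)"
    and "covector_norm g k (\<lambda>v. \<Sum>i. \<alpha> i v) \<le> (\<Sum>i. covector_norm g k (\<alpha> i))"
proof -
  show sv: "summable (\<lambda>i. \<alpha> i v)" for v
  proof (rule summable_comparison_test')
    show "summable (\<lambda>i. (sqrt (fact k) * (\<Prod>a<k. sqrt (v a \<bullet> (g *v v a)))) * covector_norm g k (\<alpha> i))"
      by (rule summable_mult[OF sm])
    show "norm (\<alpha> i v) \<le> (sqrt (fact k) * (\<Prod>a<k. sqrt (v a \<bullet> (g *v v a)))) * covector_norm g k (\<alpha> i)"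
      if "i \<ge> 0" for i
      using abs_le_covector_norm[OF g \<alpha>, of i v] by simp
  qed
  have multi: "multilinear k (\<lambda>v. \<Sum>i<m. \<alpha> i v)" for m
  proof (induction m)
    case (Suc m)
    then show ?case using multilinear_add[OF _ \<alpha>] by simp
  qed (simp add: multilinear_def linear_zero)
  have le: "covector_norm g k (\<lambda>v. \<Sum>i<m. \<alpha> i v) \<le> (\<Sum>i<m. covector_norm g k (\<alpha> i))" for m
  proof (induction m)
    case 0
    then show ?case by (simp add: covector_norm_def)
  next
    case (Suc m)
    then show ?case
      using covector_norm_add_le[OF g multi \<alpha>, of m m] by simp
  qed
  show "covector_norm g k (\<lambda>v. \<Sum>i. \<alpha> i v) \<le> (\<Sum>i. covector_norm g k (\<alpha> i))"
  proof (rule LIMSEQ_le_const2)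
    show "(\<lambda>m. covector_norm g k (\<lambda>v. \<Sum>i<m. \<alpha> i v)) \<longlonglongrightarrow> covector_norm g k (\<lambda>v. \<Sum>i. \<alpha> i v)"
      unfolding covector_norm_def
      by (intro tendsto_real_sqrt tendsto_divide tendsto_sum tendsto_mult tendsto_const
          summable_LIMSEQ sv) simp
    have "covector_norm g k (\<lambda>v. \<Sum>i<m. \<alpha> i v) \<le> (\<Sum>i. covector_norm g k (\<alpha> i))" for m
      using le[of m] sum_le_suminf[OF sm, of "{..<m}"] covector_norm_nonneg[OF g \<alpha>]
      by (meson finite_lessThan order_trans)
    then show "\<exists>N. \<forall>m\<ge>N. covector_norm g k (\<lambda>v. \<Sum>i<m. \<alpha> i v) \<le> (\<Sum>i. covector_norm g k (\<alpha> i))"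
      by blast
  qed
qed

lemma scale_form_eq: "scale_form a \<omega> = a *\<^sub>R \<omega>"
  by (simp add: scale_form_def fun_eq_iff)

lemma zero_form_eq: "zero_form = 0"
  by (simp add: zero_form_def fun_eq_iff)

context riemannian_measure
begin

lemma is_form_zero: "is_form X k 0"
  by (simp add: is_form_def zero_fun_def alternating_zero)

lemma is_form_add: "is_form X k \<omega> \<Longrightarrow> is_form X k \<eta> \<Longrightarrow> is_form X k (\<omega> + \<eta>)"
  unfolding is_form_def plus_fun_def
  by (intro conjI ballI allI alternating_add arg_cong2[of _ _ _ _ "(+)"]) blast+

lemma is_form_scale: "is_form X k \<omega> \<Longrightarrow> is_form X k (a *\<^sub>R \<omega>)"
  unfolding is_form_def scaleR_fun_def real_scaleR_def
  by (intro conjI ballI allI alternating_scale arg_cong2[of _ _ _ _ "(*)"] refl) blast+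

lemma measurable_form_is_form: "measurable_form X \<mu> k \<omega> \<Longrightarrow> is_form X k \<omega>"
  by (simp add: measurable_form_def)

lemma measurable_form_zero: "measurable_form X \<mu> k 0"
  by (simp add: measurable_form_def is_form_zero)

lemma measurable_form_add:
  "measurable_form X \<mu> k \<omega> \<Longrightarrow> measurable_form X \<mu> k \<eta> \<Longrightarrow> measurable_form X \<mu> k (\<omega> + \<eta>)"
  by (auto simp: measurable_form_def is_form_add intro!: borel_measurable_add)

lemma measurable_form_scale:
  "measurable_form X \<mu> k \<omega> \<Longrightarrow> measurable_form X \<mu> k (a *\<^sub>R \<omega>)"
  by (auto simp: measurable_form_def is_form_scale intro!: borel_measurable_times)

lemma form_norm_nonneg: "is_form X k \<omega> \<Longrightarrow> 0 \<le> form_norm X k \<omega> x"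
  unfolding form_norm_def Let_def
  by (intro covector_norm_nonneg metric_pos_def chart_at is_form_multilinear)

lemma form_norm_zero: "form_norm X k 0 x = 0"
  by (simp add: form_norm_def covector_norm_def)

lemma form_norm_scale: "form_norm X k (a *\<^sub>R \<omega>) x = \<bar>a\<bar> * form_norm X k \<omega> x"
  by (simp add: form_norm_def Let_def scaleR_fun_def covector_norm_scale)

lemma form_norm_add_le:
  assumes "is_form X k \<omega>" "is_form X k \<eta>"
  shows "form_norm X k (\<omega> + \<eta>) x \<le> form_norm X k \<omega> x + form_norm X k \<eta> x"
  unfolding form_norm_def Let_def plus_fun_def
  by (intro covector_norm_add_le metric_pos_def chart_at is_form_multilinear assms)

text \<open>The constants over which the gauge norm is the infimum.\<close>

definition gauge_bound :: "(real \<Rightarrow> real) \<Rightarrow> nat \<Rightarrow> ('a, 'n) form \<Rightarrow> real \<Rightarrow> bool" where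
  "gauge_bound \<Phi> k \<omega> K \<longleftrightarrow>
     0 < K \<and> (\<integral>\<^sup>+x. ennreal (\<Phi> (form_norm X k \<omega> x / K)) \<partial>completion \<mu>) \<le> 1"

lemma modular_scale:
  "0 < a \<Longrightarrow> modular X \<mu> \<Phi> k (scale_form a \<omega>) =
    (\<integral>\<^sup>+x. ennreal (\<Phi> (a * form_norm X k \<omega> x)) \<partial>completion \<mu>)"
  by (simp add: modular_def scale_form_eq form_norm_scale)

lemma gauge_norm_eq: "gauge_norm X \<mu> \<Phi> k \<omega> = Inf {K. gauge_bound \<Phi> k \<omega> K}"
  unfolding gauge_norm_def gauge_bound_def
  by (intro arg_cong[of _ _ Inf] Collect_cong conj_cong refl) (simp add: modular_scale)

lemma gauge_norm_le: "gauge_bound \<Phi> k \<omega> K \<Longrightarrow> gauge_norm X \<mu> \<Phi> k \<omega> \<le> K"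
  unfolding gauge_norm_eq
  by (intro cInf_lower bdd_belowI[of _ 0]) (auto simp: gauge_bound_def)

lemma gauge_bound_mono:
  assumes "N_function \<Phi>" "is_form X k \<omega>" "gauge_bound \<Phi> k \<omega> K" "K \<le> K'"
  shows "gauge_bound \<Phi> k \<omega> K'"
proof -
  have "(\<integral>\<^sup>+x. ennreal (\<Phi> (form_norm X k \<omega> x / K')) \<partial>completion \<mu>) \<le>
      (\<integral>\<^sup>+x. ennreal (\<Phi> (form_norm X k \<omega> x / K)) \<partial>completion \<mu>)"
    using assms(3,4) form_norm_nonneg[OF assms(2)]
    by (intro nn_integral_mono ennreal_leI N_function_mono[OF assms(1)] frac_le)
      (auto simp: gauge_bound_def)
  then show ?thesis using assms(3,4) unfolding gauge_bound_def by (meson less_le_trans order_trans)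
qed

text \<open>Convexity turns a finite modular into one that is at most \<open>1\<close> by shrinking the form.\<close>

lemma Orlicz_iff_gauge_bound:
  assumes "N_function \<Phi>"
  shows "\<omega> \<in> Orlicz_forms X \<mu> \<Phi> k \<longleftrightarrow> measurable_form X \<mu> k \<omega> \<and> (\<exists>K. gauge_bound \<Phi> k \<omega> K)"
proof (intro iffI conjI)
  assume "\<omega> \<in> Orlicz_forms X \<mu> \<Phi> k"
  then obtain a where m: "measurable_form X \<mu> k \<omega>" and a: "0 < a"
    and "(\<integral>\<^sup>+x. ennreal (\<Phi> (a * form_norm X k \<omega> x)) \<partial>completion \<mu>) < \<infinity>"
    unfolding Orlicz_forms_def by (auto simp: modular_scale)
  then obtain r where r: "0 \<le> r"
      "(\<integral>\<^sup>+x. ennreal (\<Phi> (a * form_norm X k \<omega> x)) \<partial>completion \<mu>) = ennreal r"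
    by (auto simp: less_top_ennreal)
  show "measurable_form X \<mu> k \<omega>" by fact
  note [measurable] = form_norm_measurable[OF m] N_function_measurable[OF assms]
  define t where "t = 1 / (r + 1)"
  have t: "0 < t" "t \<le> 1" "t * r \<le> 1" using r(1) by (auto simp: t_def field_simps)
  have "(\<integral>\<^sup>+x. ennreal (\<Phi> (form_norm X k \<omega> x / (1 / (t * a)))) \<partial>completion \<mu>) \<le>
      (\<integral>\<^sup>+x. ennreal t * ennreal (\<Phi> (a * form_norm X k \<omega> x)) \<partial>completion \<mu>)"
  proof (rule nn_integral_mono)
    fix x
    have "\<Phi> (form_norm X k \<omega> x / (1 / (t * a))) \<le> t * \<Phi> (a * form_norm X k \<omega> x)"
      using N_function_scale_le[OF assms, of t "a * form_norm X k \<omega> x"] t by (simp add: mult_ac)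
    then show "ennreal (\<Phi> (form_norm X k \<omega> x / (1 / (t * a)))) \<le>
        ennreal t * ennreal (\<Phi> (a * form_norm X k \<omega> x))"
      using t N_function_nonneg[OF assms] by (subst ennreal_mult[symmetric]) (auto intro: ennreal_leI)
  qed
  also have "\<dots> = ennreal t * ennreal r"
    by (subst nn_integral_cmult) (use r(2) in simp_all)
  also have "\<dots> = ennreal (t * r)"
    using t r(1) by (simp add: ennreal_mult)
  also have "\<dots> \<le> 1" using t by (simp add: ennreal_le_1)
  finally show "\<exists>K. gauge_bound \<Phi> k \<omega> K"
    using a t unfolding gauge_bound_def by (intro exI[of _ "1 / (t * a)"]) simp
next
  assume "measurable_form X \<mu> k \<omega> \<and> (\<exists>K. gauge_bound \<Phi> k \<omega> K)"
  then obtain K where "measurable_form X \<mu> k \<omega>" "0 < K"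
    "(\<integral>\<^sup>+x. ennreal (\<Phi> (form_norm X k \<omega> x / K)) \<partial>completion \<mu>) \<le> 1"
    unfolding gauge_bound_def by blast
  then show "\<omega> \<in> Orlicz_forms X \<mu> \<Phi> k"
    unfolding Orlicz_forms_def
    by (auto simp: modular_scale intro!: exI[of _ "1 / K"] le_less_trans[OF _ ennreal_one_less_top])
qed

lemma Orlicz_measurable: "\<omega> \<in> Orlicz_forms X \<mu> \<Phi> k \<Longrightarrow> measurable_form X \<mu> k \<omega>"
  by (simp add: Orlicz_forms_def)

lemma Orlicz_is_form: "\<omega> \<in> Orlicz_forms X \<mu> \<Phi> k \<Longrightarrow> is_form X k \<omega>"
  by (simp add: Orlicz_forms_def measurable_form_def)

lemma gauge_bound_greater:
  assumes "N_function \<Phi>" "\<omega> \<in> Orlicz_forms X \<mu> \<Phi> k" "gauge_norm X \<mu> \<Phi> k \<omega> < K"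
  shows "gauge_bound \<Phi> k \<omega> K"
proof -
  have "{K. gauge_bound \<Phi> k \<omega> K} \<noteq> {}"
    using assms(2) Orlicz_iff_gauge_bound[OF assms(1)] by blast
  then obtain K' where K': "gauge_bound \<Phi> k \<omega> K'" "K' < K"
    using cInf_lessD[OF _ assms(3)[unfolded gauge_norm_eq]] by blast
  then show ?thesis
    by (intro gauge_bound_mono[OF assms(1) Orlicz_is_form[OF assms(2)] K'(1)]) simp
qed

lemma gauge_norm_nonneg:
  assumes "N_function \<Phi>" "\<omega> \<in> Orlicz_forms X \<mu> \<Phi> k"
  shows "0 \<le> gauge_norm X \<mu> \<Phi> k \<omega>"
  unfolding gauge_norm_eq
  using assms Orlicz_iff_gauge_bound[OF assms(1)]
  by (intro cInf_greatest) (auto simp: gauge_bound_def)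

lemma gauge_bound_add:
  assumes "N_function \<Phi>" "measurable_form X \<mu> k \<omega>" "measurable_form X \<mu> k \<eta>"
    and "gauge_bound \<Phi> k \<omega> K" "gauge_bound \<Phi> k \<eta> L"
  shows "gauge_bound \<Phi> k (\<omega> + \<eta>) (K + L)"
proof -
  have KL: "0 < K" "0 < L" using assms by (auto simp: gauge_bound_def)
  note [measurable] = form_norm_measurable[OF assms(2)] form_norm_measurable[OF assms(3)]
    N_function_measurable[OF assms(1)]
  have forms: "is_form X k \<omega>" "is_form X k \<eta>" using assms by (auto simp: measurable_form_def)
  define s where "s = K / (K + L)"
  have s: "0 < s" "s < 1" "1 - s = L / (K + L)" using KL by (auto simp: s_def field_simps)
  let ?f = "form_norm X k \<omega>" and ?h = "form_norm X k \<eta>"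
  have "(\<integral>\<^sup>+x. ennreal (\<Phi> (form_norm X k (\<omega> + \<eta>) x / (K + L))) \<partial>completion \<mu>) \<le>
      (\<integral>\<^sup>+x. ennreal s * ennreal (\<Phi> (?f x / K)) + ennreal (1 - s) * ennreal (\<Phi> (?h x / L)) \<partial>completion \<mu>)"
  proof (rule nn_integral_mono)
    fix x
    have "\<Phi> (form_norm X k (\<omega> + \<eta>) x / (K + L)) \<le> \<Phi> ((?f x + ?h x) / (K + L))"
      using KL form_norm_add_le[OF forms] form_norm_nonneg[OF is_form_add[OF forms]]
      by (intro N_function_mono[OF assms(1)] divide_right_mono) auto
    also have "(?f x + ?h x) / (K + L) = s * (?f x / K) + (1 - s) * (?h x / L)"
      unfolding s(3) using KL by (simp add: s_def add_divide_distrib)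
    also have "\<Phi> \<dots> \<le> s * \<Phi> (?f x / K) + (1 - s) * \<Phi> (?h x / L)"
      using s(1,2) convex_onD[OF N_function_convex[OF assms(1)], of "1 - s" "?f x / K" "?h x / L"]
      by simp
    finally have "ennreal (\<Phi> (form_norm X k (\<omega> + \<eta>) x / (K + L))) \<le>
        ennreal (s * \<Phi> (?f x / K) + (1 - s) * \<Phi> (?h x / L))"
      by (rule ennreal_leI)
    also have "\<dots> = ennreal s * ennreal (\<Phi> (?f x / K)) + ennreal (1 - s) * ennreal (\<Phi> (?h x / L))"
      using s(1,2) N_function_nonneg[OF assms(1)] by (simp flip: ennreal_plus ennreal_mult)
    finally show "ennreal (\<Phi> (form_norm X k (\<omega> + \<eta>) x / (K + L))) \<le>
      ennreal s * ennreal (\<Phi> (?f x / K)) + ennreal (1 - s) * ennreal (\<Phi> (?h x / L))" .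
  qed
  also have "\<dots> = ennreal s * (\<integral>\<^sup>+x. ennreal (\<Phi> (?f x / K)) \<partial>completion \<mu>) +
      ennreal (1 - s) * (\<integral>\<^sup>+x. ennreal (\<Phi> (?h x / L)) \<partial>completion \<mu>)"
    by (simp add: nn_integral_add nn_integral_cmult)
  also have "\<dots> \<le> ennreal s * 1 + ennreal (1 - s) * 1"
    using assms(4,5) by (intro add_mono mult_left_mono) (auto simp: gauge_bound_def)
  also have "\<dots> = 1"
    using s by (simp flip: ennreal_plus)
  finally show ?thesis using KL by (simp add: gauge_bound_def)
qed

lemma gauge_bound_scale:
  assumes "gauge_bound \<Phi> k \<omega> K" "a \<noteq> 0"
  shows "gauge_bound \<Phi> k (a *\<^sub>R \<omega>) (\<bar>a\<bar> * K)"
  using assms by (simp add: gauge_bound_def form_norm_scale)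

lemma gauge_bound_zero: "N_function \<Phi> \<Longrightarrow> 0 < K \<Longrightarrow> gauge_bound \<Phi> k 0 K"
  by (simp add: gauge_bound_def form_norm_zero N_function_zero)

lemma gauge_norm_zero:
  assumes "N_function \<Phi>"
  shows "gauge_norm X \<mu> \<Phi> k 0 = 0"
proof (rule antisym)
  show "gauge_norm X \<mu> \<Phi> k 0 \<le> 0"
    by (rule field_le_epsilon) (use gauge_norm_le[OF gauge_bound_zero[OF assms]] in simp)
  show "0 \<le> gauge_norm X \<mu> \<Phi> k 0"
    using gauge_bound_zero[OF assms, of 1 k] measurable_form_zero
    by (intro gauge_norm_nonneg assms) (auto simp: Orlicz_iff_gauge_bound[OF assms])
qed

lemma Orlicz_subspace:
  assumes "N_function \<Phi>"
  shows "subspace (Orlicz_forms X \<mu> \<Phi> k)"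
  unfolding subspace_def Orlicz_iff_gauge_bound[OF assms]
proof (intro conjI ballI allI)
  show "measurable_form X \<mu> k 0" "\<exists>K. gauge_bound \<Phi> k 0 K"
    using gauge_bound_zero[OF assms, of 1] measurable_form_zero by auto
next
  fix \<omega> \<eta> assume "\<omega> \<in> Orlicz_forms X \<mu> \<Phi> k" "\<eta> \<in> Orlicz_forms X \<mu> \<Phi> k"
  then show "measurable_form X \<mu> k (\<omega> + \<eta>)" "\<exists>K. gauge_bound \<Phi> k (\<omega> + \<eta>) K"
    unfolding Orlicz_iff_gauge_bound[OF assms]
    using gauge_bound_add[OF assms] measurable_form_add by blast+
next
  fix a \<omega> assume "\<omega> \<in> Orlicz_forms X \<mu> \<Phi> k"
  then have "measurable_form X \<mu> k \<omega>" "\<exists>K. gauge_bound \<Phi> k \<omega> K"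
    unfolding Orlicz_iff_gauge_bound[OF assms] by auto
  then obtain K where \<omega>: "measurable_form X \<mu> k \<omega>" "gauge_bound \<Phi> k \<omega> K"
    by blast
  show "measurable_form X \<mu> k (a *\<^sub>R \<omega>)"
    by (rule measurable_form_scale[OF \<omega>(1)])
  show "\<exists>K. gauge_bound \<Phi> k (a *\<^sub>R \<omega>) K"
  proof (cases "a = 0")
    case True
    then show ?thesis using gauge_bound_zero[OF assms, of 1 k] by auto
  next
    case False
    then show ?thesis using gauge_bound_scale[OF \<omega>(2)] by blast
  qed
qed

lemma gauge_norm_triangle:
  assumes \<Phi>: "N_function \<Phi>" and mem: "\<omega> \<in> Orlicz_forms X \<mu> \<Phi> k" "\<eta> \<in> Orlicz_forms X \<mu> \<Phi> k"
  shows "gauge_norm X \<mu> \<Phi> k (\<omega> + \<eta>) \<le> gauge_norm X \<mu> \<Phi> k \<omega> + gauge_norm X \<mu> \<Phi> k \<eta>"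
proof (rule field_le_epsilon)
  fix e :: real assume "0 < e"
  then have "gauge_bound \<Phi> k \<omega> (gauge_norm X \<mu> \<Phi> k \<omega> + e / 2)"
    and "gauge_bound \<Phi> k \<eta> (gauge_norm X \<mu> \<Phi> k \<eta> + e / 2)"
    by (auto intro!: gauge_bound_greater[OF \<Phi>] mem)
  from gauge_norm_le[OF gauge_bound_add[OF \<Phi> Orlicz_measurable[OF mem(1)] Orlicz_measurable[OF mem(2)] this]]
  show "gauge_norm X \<mu> \<Phi> k (\<omega> + \<eta>) \<le> gauge_norm X \<mu> \<Phi> k \<omega> + gauge_norm X \<mu> \<Phi> k \<eta> + e"
    by simp
qed

lemma gauge_norm_scale:
  assumes \<Phi>: "N_function \<Phi>" and \<omega>: "\<omega> \<in> Orlicz_forms X \<mu> \<Phi> k"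
  shows "gauge_norm X \<mu> \<Phi> k (a *\<^sub>R \<omega>) = \<bar>a\<bar> * gauge_norm X \<mu> \<Phi> k \<omega>"
proof (cases "a = 0")
  case True
  then show ?thesis by (simp add: gauge_norm_zero[OF \<Phi>])
next
  case False
  have le: "gauge_norm X \<mu> \<Phi> k (b *\<^sub>R \<eta>) \<le> \<bar>b\<bar> * gauge_norm X \<mu> \<Phi> k \<eta>"
    if "b \<noteq> 0" "\<eta> \<in> Orlicz_forms X \<mu> \<Phi> k" for b \<eta>
  proof (rule field_le_epsilon)
    fix e :: real assume "0 < e"
    then have "gauge_bound \<Phi> k \<eta> (gauge_norm X \<mu> \<Phi> k \<eta> + e / \<bar>b\<bar>)"
      using that by (intro gauge_bound_greater[OF \<Phi>]) auto
    from gauge_norm_le[OF gauge_bound_scale[OF this that(1)]]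
    show "gauge_norm X \<mu> \<Phi> k (b *\<^sub>R \<eta>) \<le> \<bar>b\<bar> * gauge_norm X \<mu> \<Phi> k \<eta> + e"
      using that(1) by (simp add: distrib_left)
  qed
  have "a *\<^sub>R \<omega> \<in> Orlicz_forms X \<mu> \<Phi> k"
    using Orlicz_subspace[OF \<Phi>] \<omega> by (rule subspace_scale)
  from le[of "1 / a", OF _ this] le[OF False \<omega>] False
  show ?thesis by (simp add: field_simps)
qed

text \<open>The theorem of Riesz and Fischer: wherever the series of norms converges, so does the series of
  forms, and the norms of its tails are bounded by the tails of the series of norms.\<close>

lemma Orlicz_complete:
  assumes \<Phi>: "N_function \<Phi>" and mem: "\<And>i. s i \<in> Orlicz_forms X \<mu> \<Phi> k"
    and sm: "summable (\<lambda>i. gauge_norm X \<mu> \<Phi> k (s i))"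
  shows "\<exists>\<omega>\<in>Orlicz_forms X \<mu> \<Phi> k. (\<lambda>m. gauge_norm X \<mu> \<Phi> k (\<omega> - (\<Sum>i<m. s i))) \<longlonglongrightarrow> 0"
proof -
  \<comment> \<open>The infimum in the gauge norm need not be an admissible constant for \<open>s i\<close>; any larger number is.\<close>
  define \<kappa> where "\<kappa> i = gauge_norm X \<mu> \<Phi> k (s i) + (1/2) ^ i" for i
  have \<kappa>: "0 < \<kappa> i" "gauge_bound \<Phi> k (s i) (\<kappa> i)" for i
  proof -
    show "gauge_bound \<Phi> k (s i) (\<kappa> i)"
      by (intro gauge_bound_greater[OF \<Phi> mem]) (simp add: \<kappa>_def)
    then show "0 < \<kappa> i" by (simp add: gauge_bound_def)
  qed
  have sm\<kappa>: "summable \<kappa>"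
    unfolding \<kappa>_def by (intro summable_add sm summable_geometric) simp
  have form: "is_form X k (s i)" and meas: "measurable_form X \<mu> k (s i)" for i
    by (rule Orlicz_is_form[OF mem], rule Orlicz_measurable[OF mem])
  have fm[measurable]: "form_norm X k (s i) \<in> borel_measurable (completion \<mu>)" for i
    by (rule form_norm_measurable[OF meas])
  \<comment> \<open>The sum is formed on \<open>S\<close>, a set that does not depend on charts, and is \<open>0\<close> on the null set
    outside it.\<close>
  define S where "S = {x. (\<Sum>i. ennreal (form_norm X k (s i) x)) \<noteq> top}"
  have S_iff: "x \<in> S \<longleftrightarrow> summable (\<lambda>i. form_norm X k (s i) x)" for x
    unfolding S_def using form_norm_nonneg[OF form]
    by (auto intro: summable_suminf_not_top simp: suminf_ennreal2)
  have S_meas: "S \<in> sets (completion \<mu>)"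
  proof -
    have "{x \<in> space (completion \<mu>). (\<Sum>i. ennreal (form_norm X k (s i) x)) \<noteq> top} \<in> sets (completion \<mu>)"
      by measurable
    then show ?thesis by (simp add: S_def)
  qed
  have S_AE: "AE x in completion \<mu>. x \<in> S"
    unfolding S_iff
    using form_norm_nonneg[OF form] \<kappa> sm\<kappa>
    by (intro Orlicz_series(1)[OF \<Phi> fm, where \<kappa> = \<kappa> and \<Lambda> = "suminf \<kappa>"])
      (auto simp: gauge_bound_def)
  have sm_chart: "summable (\<lambda>i. covector_norm (metric X c x) k (s i c x))"
    if "x \<in> S" "c \<in> atlas X" "x \<in> fst c" for x c
    using that unfolding S_iff by (simp add: form_norm_chart[OF form])
  have sm_val: "summable (\<lambda>i. s i c x v)" if "x \<in> S" "c \<in> atlas X" "x \<in> fst c" for x c v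
    using that by (intro covector_norm_suminf_le(1)[OF metric_pos_def is_form_multilinear[OF form] sm_chart])
  define \<omega> :: "('a, 'n) form" where "\<omega> c x v = (if x \<in> S then \<Sum>i. s i c x v else 0)" for c x v
  have \<omega>_form: "is_form X k \<omega>"
    unfolding is_form_def
  proof (intro conjI ballI allI)
    fix c x assume c: "c \<in> atlas X" "x \<in> fst c"
    show "alternating k (\<omega> c x)"
    proof (cases "x \<in> S")
      case True
      have "alternating k (s i c x)" for i
        using form[of i] c unfolding is_form_def by blast
      then have "alternating k (\<lambda>v. \<Sum>i. s i c x v)"
        using c True by (intro alternating_suminf sm_val)
      with True show ?thesis unfolding \<omega>_def by simp
    qed (simp add: \<omega>_def[abs_def] alternating_zero)
  next
    fix c c' x v assume "c \<in> atlas X" "c' \<in> atlas X" "x \<in> fst c \<inter> fst c'"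
    then have "s i c x v = s i c' x (\<lambda>j. J c c' x (v j))" for i
      using form[of i] unfolding is_form_def by blast
    then show "\<omega> c x v = \<omega> c' x (\<lambda>j. J c c' x (v j))" unfolding \<omega>_def by simp
  qed
  have \<omega>_meas: "measurable_form X \<mu> k \<omega>"
    unfolding measurable_form_def
  proof (intro conjI ballI allI \<omega>_form)
    fix c v assume c: "c \<in> atlas X"
    have [measurable]: "(\<lambda>x. s i c x v) \<in> borel_measurable (restrict_space (completion \<mu>) (fst c))" for i
      using meas[of i] c by (simp add: measurable_form_def)
    have [measurable]: "Measurable.pred (restrict_space (completion \<mu>) (fst c)) (\<lambda>x. x \<in> S)"
      using S_meas by (intro measurable_restrict_space1) simp
    show "(\<lambda>x. \<omega> c x v) \<in> borel_measurable (restrict_space (completion \<mu>) (fst c))"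
      unfolding \<omega>_def by measurable
  qed
  have tail: "form_norm X k (\<omega> - (\<Sum>i<m. s i)) x \<le> (\<Sum>i. form_norm X k (s (i + m)) x)" if "x \<in> S" for m x
  proof -
    define c where "c = chart_at X x"
    have c: "c \<in> atlas X" "x \<in> fst c" using chart_at by (auto simp: c_def)
    have sum_apply: "(\<Sum>i<m. s i) c x v = (\<Sum>i<m. s i c x v)" for v
      by (induction m) auto
    have "(\<omega> - (\<Sum>i<m. s i)) c x = (\<lambda>v. \<Sum>i. s (i + m) c x v)"
      using that suminf_minus_initial_segment[OF sm_val[OF that c]]
      by (simp add: fun_eq_iff \<omega>_def sum_apply)
    then have "form_norm X k (\<omega> - (\<Sum>i<m. s i)) x =
        covector_norm (metric X c x) k (\<lambda>v. \<Sum>i. s (i + m) c x v)"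
      unfolding form_norm_def c_def[symmetric] Let_def by simp
    also have "\<dots> \<le> (\<Sum>i. covector_norm (metric X c x) k (s (i + m) c x))"
      by (intro covector_norm_suminf_le(2) metric_pos_def is_form_multilinear[OF form] c
          summable_ignore_initial_segment[OF sm_chart[OF that c]])
    also have "\<dots> = (\<Sum>i. form_norm X k (s (i + m)) x)"
      by (simp add: form_norm_chart[OF form c])
    finally show ?thesis .
  qed
  have diff_meas: "measurable_form X \<mu> k (\<omega> - (\<Sum>i<m. s i))" for m
  proof -
    have "measurable_form X \<mu> k (\<Sum>i<m. s i)"
      by (intro Orlicz_measurable[of _ \<Phi>] subspace_sum[OF Orlicz_subspace[OF \<Phi>]] mem)
    then have "measurable_form X \<mu> k (\<omega> + (- 1) *\<^sub>R (\<Sum>i<m. s i))"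
      by (intro measurable_form_add \<omega>_meas measurable_form_scale)
    then show ?thesis by simp
  qed
  have bound: "gauge_bound \<Phi> k (\<omega> - (\<Sum>i<m. s i)) (\<Sum>i. \<kappa> (i + m))" for m
  proof -
    let ?\<Lambda> = "\<Sum>i. \<kappa> (i + m)"
    have sm': "summable (\<lambda>i. \<kappa> (i + m))" by (rule summable_ignore_initial_segment[OF sm\<kappa>])
    have \<Lambda>: "0 < ?\<Lambda>" using \<kappa>(1) by (intro suminf_pos sm') auto
    have "(\<integral>\<^sup>+x. ennreal (\<Phi> (form_norm X k (\<omega> - (\<Sum>i<m. s i)) x / ?\<Lambda>)) \<partial>completion \<mu>) \<le>
        (\<integral>\<^sup>+x. ennreal (\<Phi> ((\<Sum>i. form_norm X k (s (i + m)) x) / ?\<Lambda>)) *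
          indicator {x. summable (\<lambda>i. form_norm X k (s (i + m)) x)} x \<partial>completion \<mu>)"
    proof (rule nn_integral_mono_AE)
      show "AE x in completion \<mu>. ennreal (\<Phi> (form_norm X k (\<omega> - (\<Sum>i<m. s i)) x / ?\<Lambda>)) \<le>
        ennreal (\<Phi> ((\<Sum>i. form_norm X k (s (i + m)) x) / ?\<Lambda>)) *
          indicator {x. summable (\<lambda>i. form_norm X k (s (i + m)) x)} x"
        using S_AE
      proof eventually_elim
        case (elim x)
        then have "summable (\<lambda>i. form_norm X k (s (i + m)) x)"
          unfolding S_iff by (rule summable_ignore_initial_segment)
        moreover have "\<Phi> (form_norm X k (\<omega> - (\<Sum>i<m. s i)) x / ?\<Lambda>) \<le>
            \<Phi> ((\<Sum>i. form_norm X k (s (i + m)) x) / ?\<Lambda>)"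
          using tail[OF elim] \<Lambda> form_norm_nonneg[OF measurable_form_is_form[OF diff_meas]]
          by (intro N_function_mono[OF \<Phi>] divide_right_mono) auto
        ultimately show ?case by (simp add: ennreal_leI)
      qed
    qed
    also have "\<dots> \<le> 1"
      using \<kappa> form_norm_nonneg[OF form] sm'
      by (intro Orlicz_series(2)[OF \<Phi> fm, where \<kappa> = "\<lambda>i. \<kappa> (i + m)"]) (auto simp: gauge_bound_def)
    finally show ?thesis using \<Lambda> by (simp add: gauge_bound_def)
  qed
  have "\<omega> \<in> Orlicz_forms X \<mu> \<Phi> k"
    using bound[of 0] \<omega>_meas by (auto simp: Orlicz_iff_gauge_bound[OF \<Phi>])
  moreover have "(\<lambda>m. gauge_norm X \<mu> \<Phi> k (\<omega> - (\<Sum>i<m. s i))) \<longlonglongrightarrow> 0"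
  proof (rule real_tendsto_sandwich[of "\<lambda>_. 0"])
    show "\<forall>\<^sub>F m in sequentially. 0 \<le> gauge_norm X \<mu> \<Phi> k (\<omega> - (\<Sum>i<m. s i))"
      using bound diff_meas Orlicz_iff_gauge_bound[OF \<Phi>]
      by (intro always_eventually allI gauge_norm_nonneg[OF \<Phi>]) blast
    show "\<forall>\<^sub>F m in sequentially. gauge_norm X \<mu> \<Phi> k (\<omega> - (\<Sum>i<m. s i)) \<le> (\<Sum>i. \<kappa> (i + m))"
      by (intro always_eventually allI gauge_norm_le bound)
    show "(\<lambda>m. \<Sum>i. \<kappa> (i + m)) \<longlonglongrightarrow> 0"
      by (rule suminf_exist_split2[OF sm\<kappa>])
  qed simp
  ultimately show ?thesis by blast
qed

lemma complete_seminormed_Orlicz: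
  assumes "N_function \<Phi>"
  shows "complete_seminormed (Orlicz_forms X \<mu> \<Phi> k) (gauge_norm X \<mu> \<Phi> k)"
  by unfold_locales
    (use Orlicz_subspace gauge_norm_nonneg gauge_norm_triangle gauge_norm_scale Orlicz_complete assms in blast)+

text \<open>An N-function dominates the identity up to a constant, so on a set of finite volume the
  gauge norm dominates the \<open>L\<^sup>1\<close> norm.\<close>

lemma Orlicz_integrable_compact:
  assumes \<Phi>: "N_function \<Phi>" and K: "compact K"
  shows "\<exists>C\<ge>0. \<forall>\<omega>\<in>Orlicz_forms X \<mu> \<Phi> k.
    integrable (completion \<mu>) (\<lambda>x. indicator K x * form_norm X k \<omega> x) \<and>
    (\<integral>x. indicator K x * form_norm X k \<omega> x \<partial>completion \<mu>) \<le> C * gauge_norm X \<mu> \<Phi> k \<omega>"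
proof -
  obtain B where B: "0 \<le> B" "\<And>t. 0 \<le> t \<Longrightarrow> t \<le> \<Phi> t + B"
    using N_function_superlinear[OF \<Phi>] by blast
  have K_meas[measurable]: "K \<in> sets (completion \<mu>)" and Kfin: "emeasure (completion \<mu>) K < \<infinity>"
    using compact_finite_volume[OF K] by auto
  define C where "C = 1 + B * measure (completion \<mu>) K"
  have C: "0 < C" using B(1) by (simp add: C_def add_pos_nonneg)
  have "integrable (completion \<mu>) (\<lambda>x. indicator K x * form_norm X k \<omega> x) \<and>
    (\<integral>x. indicator K x * form_norm X k \<omega> x \<partial>completion \<mu>) \<le> C * gauge_norm X \<mu> \<Phi> k \<omega>"
    if \<omega>: "\<omega> \<in> Orlicz_forms X \<mu> \<Phi> k" for \<omega>
  proof -
    let ?f = "form_norm X k \<omega>"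
    have [measurable]: "?f \<in> borel_measurable (completion \<mu>)"
      by (rule form_norm_measurable[OF Orlicz_measurable[OF \<omega>]])
    have f0: "0 \<le> ?f x" for x by (rule form_norm_nonneg[OF Orlicz_is_form[OF \<omega>]])
    note [measurable] = N_function_measurable[OF \<Phi>]
    have le: "(\<integral>\<^sup>+x. ennreal (indicator K x * ?f x) \<partial>completion \<mu>) \<le> ennreal (C * L)"
      if "gauge_norm X \<mu> \<Phi> k \<omega> < L" for L
    proof -
      have L: "0 < L" "(\<integral>\<^sup>+x. ennreal (\<Phi> (?f x / L)) \<partial>completion \<mu>) \<le> 1"
        using gauge_bound_greater[OF \<Phi> \<omega> that] by (auto simp: gauge_bound_def)
      have "(\<integral>\<^sup>+x. ennreal (indicator K x * ?f x) \<partial>completion \<mu>) \<le>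
          (\<integral>\<^sup>+x. ennreal L * (ennreal (\<Phi> (?f x / L)) + ennreal B * indicator K x) \<partial>completion \<mu>)"
      proof (rule nn_integral_mono)
        fix x
        have "?f x \<le> L * (\<Phi> (?f x / L) + B)"
          using B(2)[of "?f x / L"] f0[of x] L(1) by (simp add: field_simps)
        then have "ennreal (?f x) \<le> ennreal L * (ennreal (\<Phi> (?f x / L)) + ennreal B)"
          using L(1) B(1) N_function_nonneg[OF \<Phi>]
          by (simp flip: ennreal_plus ennreal_mult add: ennreal_leI)
        then show "ennreal (indicator K x * ?f x) \<le>
            ennreal L * (ennreal (\<Phi> (?f x / L)) + ennreal B * indicator K x)"
          by (simp add: indicator_def)
      qed
      also have "\<dots> = ennreal L * ((\<integral>\<^sup>+x. ennreal (\<Phi> (?f x / L)) \<partial>completion \<mu>) +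
          ennreal B * emeasure (completion \<mu>) K)"
        by (simp add: nn_integral_cmult nn_integral_add nn_integral_cmult_indicator)
      also have "\<dots> \<le> ennreal L * (1 + ennreal B * ennreal (measure (completion \<mu>) K))"
        using L(2) Kfin by (intro mult_left_mono add_mono) (auto simp: emeasure_eq_ennreal_measure)
      also have "\<dots> = ennreal (C * L)"
        using L(1) B(1) by (simp add: C_def mult.commute flip: ennreal_1 ennreal_plus ennreal_mult)
      finally show ?thesis .
    qed
    have int: "integrable (completion \<mu>) (\<lambda>x. indicator K x * ?f x)"
    proof (rule integrableI_nonneg)
      show "(\<integral>\<^sup>+x. ennreal (indicator K x * ?f x) \<partial>completion \<mu>) < \<infinity>"
        using le[of "gauge_norm X \<mu> \<Phi> k \<omega> + 1"] by (simp add: le_less_trans[OF _ ennreal_less_top])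
    qed (auto simp: f0)
    have "(\<integral>x. indicator K x * ?f x \<partial>completion \<mu>) \<le> C * gauge_norm X \<mu> \<Phi> k \<omega>"
    proof (rule field_le_epsilon)
      fix e :: real assume e: "0 < e"
      have g0: "0 \<le> gauge_norm X \<mu> \<Phi> k \<omega>" by (rule gauge_norm_nonneg[OF \<Phi> \<omega>])
      have "ennreal (\<integral>x. indicator K x * ?f x \<partial>completion \<mu>) \<le> ennreal (C * (gauge_norm X \<mu> \<Phi> k \<omega> + e / C))"
        using le[of "gauge_norm X \<mu> \<Phi> k \<omega> + e / C"] C e
        by (subst nn_integral_eq_integral[OF int, symmetric]) (auto simp: f0)
      then have "(\<integral>x. indicator K x * ?f x \<partial>completion \<mu>) \<le> C * (gauge_norm X \<mu> \<Phi> k \<omega> + e / C)"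
        using C e g0 by (subst (asm) ennreal_le_iff) (auto intro!: mult_nonneg_nonneg)
      then show "(\<integral>x. indicator K x * ?f x \<partial>completion \<mu>) \<le> C * gauge_norm X \<mu> \<Phi> k \<omega> + e"
        using C by (simp add: distrib_left)
    qed
    with int show ?thesis by blast
  qed
  then show ?thesis using C by (intro exI[of _ C]) auto
qed

lemma Orlicz_locally_integrable:
  assumes "N_function \<Phi>" and \<omega>: "\<omega> \<in> Orlicz_forms X \<mu> \<Phi> k"
  shows "locally_integrable_form X \<mu> k \<omega>"
  unfolding locally_integrable_form_def
proof (intro conjI allI impI Orlicz_measurable[OF \<omega>])
  fix K :: "'a set" assume "compact K"
  then have int: "integrable (completion \<mu>) (\<lambda>x. indicator K x * form_norm X k \<omega> x)"
    using Orlicz_integrable_compact[OF assms(1)] \<omega> by blast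
  have "(\<integral>\<^sup>+x\<in>K. ennreal (form_norm X k \<omega> x) \<partial>completion \<mu>) =
      (\<integral>\<^sup>+x. ennreal (indicator K x * form_norm X k \<omega> x) \<partial>completion \<mu>)"
    by (intro nn_integral_cong) (auto simp: indicator_def)
  also have "\<dots> < \<infinity>"
    using form_norm_nonneg[OF Orlicz_is_form[OF \<omega>]] by (subst nn_integral_eq_integral[OF int]) auto
  finally show "(\<integral>\<^sup>+x\<in>K. ennreal (form_norm X k \<omega> x) \<partial>completion \<mu>) < \<infinity>" .
qed

end

section \<open>Pairing a form with a continuous test field\<close>

context riemannian_measure
begin

text \<open>Whether a point is interior does not depend on the chart, by invariance of domain.\<close>

lemma interior_in_every_chart:
  assumes "x \<in> manifold_interior X" and c: "c \<in> atlas X" "x \<in> fst c"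
  shows "snd c x \<in> interior (snd c ` fst c)"
proof -
  obtain c0 where c0: "c0 \<in> atlas X" "x \<in> fst c0" and int: "snd c0 x \<in> interior (snd c0 ` fst c0)"
    using assms(1) unfolding manifold_interior_def by blast
  define S where "S = interior (snd c0 ` fst c0) \<inter> chart_inv c0 -` fst c"
  have sub: "interior (snd c0 ` fst c0) \<subseteq> snd c0 ` fst c0" by (rule interior_subset)
  have "open S"
    unfolding S_def
    by (intro continuous_open_preimage open_interior chart_open c
        continuous_on_subset[OF chart_inv_continuous[OF c0(1)] sub])
  moreover have "continuous_on S (snd c \<circ> chart_inv c0)"
  proof (rule continuous_on_compose)
    show "continuous_on S (chart_inv c0)"
      using sub by (intro continuous_on_subset[OF chart_inv_continuous[OF c0(1)]]) (auto simp: S_def)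
    show "continuous_on (chart_inv c0 ` S) (snd c)"
      by (intro continuous_on_subset[OF chart_continuous[OF c(1)]]) (auto simp: S_def)
  qed
  moreover have "inj_on (snd c \<circ> chart_inv c0) S"
  proof (rule comp_inj_on)
    show "inj_on (chart_inv c0) S"
    proof (rule inj_on_inverseI)
      fix y assume "y \<in> S"
      then obtain z where "z \<in> fst c0" "y = snd c0 z" using sub unfolding S_def by blast
      then show "snd c0 (chart_inv c0 y) = y" by (simp add: chart_inv_chart c0)
    qed
    show "inj_on (snd c) (chart_inv c0 ` S)"
      by (rule inj_on_subset[OF chart_inj[OF c(1)]]) (auto simp: S_def)
  qed
  ultimately have "open ((snd c \<circ> chart_inv c0) ` S)"
    using invariance_of_domain by blast
  moreover have "(snd c \<circ> chart_inv c0) ` S \<subseteq> snd c ` fst c" by (auto simp: S_def)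
  moreover have "snd c x \<in> (snd c \<circ> chart_inv c0) ` S"
  proof (rule image_eqI)
    show "snd c x = (snd c \<circ> chart_inv c0) (snd c0 x)" by (simp add: chart_inv_chart c0)
    show "snd c0 x \<in> S" using int c0 c by (simp add: S_def chart_inv_chart)
  qed
  ultimately show ?thesis using interior_maximal by blast
qed

text \<open>A test form and its exterior derivative both have these properties on sets of interior
  points.\<close>

definition continuous_tensor_on :: "'a set \<Rightarrow> nat \<Rightarrow> ('a, 'n) form \<Rightarrow> bool" where
  "continuous_tensor_on U q \<tau> \<longleftrightarrow>
     (\<forall>c\<in>atlas X. \<forall>x\<in>U \<inter> fst c. multilinear q (\<tau> c x)) \<and>
     (\<forall>c\<in>atlas X. \<forall>c'\<in>atlas X. \<forall>x\<in>U \<inter> fst c \<inter> fst c'. \<forall>v.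
        \<tau> c x v = \<tau> c' x (\<lambda>i. J c c' x (v i))) \<and>
     (\<forall>c\<in>atlas X. \<forall>v. continuous_on (U \<inter> fst c) (\<lambda>x. \<tau> c x v))"

text \<open>The coefficient, computed in the chart \<open>c\<close>, of the \<open>n\<close>-form \<open>\<omega> \<and> \<tau>\<close> with respect to the oriented
  Riemannian volume form.\<close>

definition density ::
    "(('a, 'n) chart \<Rightarrow> 'a \<Rightarrow> real) \<Rightarrow> nat \<Rightarrow> nat \<Rightarrow> ('a, 'n) form \<Rightarrow> ('a, 'n) form \<Rightarrow>
     ('a, 'n) chart \<Rightarrow> 'a \<Rightarrow> real" where
  "density s j q \<omega> \<tau> c x = s c x * wedge j q (\<omega> c x) (\<tau> c x) coord_frame / sqrt (det (metric X c x))"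

lemma form_integral_density:
  "form_integral X \<mu> s U (wedge_form j q \<omega> \<tau>) =
    (\<integral>x. indicator U x * density s j q \<omega> \<tau> (chart_at X x) x \<partial>completion \<mu>)"
  by (simp add: form_integral_def set_lebesgue_integral_def density_def wedge_form_def Let_def)

lemma density_add:
  "density s j q (\<omega> + \<eta>) \<tau> c x = density s j q \<omega> \<tau> c x + density s j q \<eta> \<tau> c x"
  by (simp add: density_def wedge_def algebra_simps sum.distrib add_divide_distrib)

lemma density_scale: "density s j q (a *\<^sub>R \<omega>) \<tau> c x = a * density s j q \<omega> \<tau> c x"
  by (simp add: density_def wedge_def mult.assoc mult.left_commute[of _ a] flip: sum_distrib_left)

text \<open>Under a change of charts the coefficient of an \<open>n\<close>-form is multiplied by the determinant of
  the Jacobian, the density of the volume by its absolute value and the orientation by its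
  sign, so that the factors cancel.\<close>

lemma density_chart:
  assumes s: "orientation X U s" and \<omega>: "is_form X j \<omega>" and \<tau>: "continuous_tensor_on U q \<tau>"
    and n: "j + q = CARD('n)"
    and c: "c \<in> atlas X" "x \<in> fst c" and c': "c' \<in> atlas X" "x \<in> fst c'" and x: "x \<in> U"
  shows "density s j q \<omega> \<tau> c x = density s j q \<omega> \<tau> c' x"
proof -
  define D where "D = matrix (J c c' x)"
  define W where "W = wedge j q (\<omega> c' x) (\<tau> c' x)"
  have D: "J c c' x v = D *v v" for v
    using transition_deriv_matrix[OF c(1) c'(1) c(2) c'(2)] by (simp add: D_def)
  have "\<omega> c x = (\<lambda>v. \<omega> c' x (\<lambda>i. D *v v i))"
    using \<omega> c c' unfolding is_form_def D[symmetric] by blast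
  moreover have "\<tau> c x = (\<lambda>v. \<tau> c' x (\<lambda>i. D *v v i))"
    using \<tau> c c' x unfolding continuous_tensor_on_def D[symmetric] by blast
  ultimately have "wedge j q (\<omega> c x) (\<tau> c x) coord_frame = W (\<lambda>i. D *v coord_frame i)"
    by (simp add: wedge_def W_def)
  also have "\<dots> = det D * W coord_frame"
  proof (rule top_degree_det)
    have "multilinear q (\<tau> c' x)" using \<tau> c' x unfolding continuous_tensor_on_def by blast
    then show "multilinear CARD('n) W"
      unfolding W_def n[symmetric] by (intro multilinear_wedge is_form_multilinear[OF \<omega>] c')
    show "W (\<lambda>i. v (\<pi> i)) = of_int (sign \<pi>) * W v" if "\<pi> permutes {..<CARD('n)}" for \<pi> v
      unfolding W_def using that by (intro wedge_permute) (simp add: n)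
  qed
  finally have W: "wedge j q (\<omega> c x) (\<tau> c x) coord_frame = det D * W coord_frame" .
  have nz: "det D \<noteq> 0" and det: "det (metric X c x) = (det D)\<^sup>2 * det (metric X c' x)"
    using det_transition_nonzero[OF c(1) c'(1) c(2) c'(2)] by (simp_all add: D_def)
  have sg: "s c x = sgn (det D) * s c' x"
    using s c c' x unfolding orientation_def D_def by blast
  have "density s j q \<omega> \<tau> c x =
      (sgn (det D) * det D / \<bar>det D\<bar>) * (s c' x * W coord_frame / sqrt (det (metric X c' x)))"
    unfolding density_def W sg det by (simp add: real_sqrt_mult)
  also have "sgn (det D) * det D / \<bar>det D\<bar> = 1"
    using nz by (simp add: sgn_if)
  finally show ?thesis by (simp add: density_def W_def)
qed

lemma density_measurable:
  assumes U: "open U" and s: "orientation X U s" and \<omega>: "measurable_form X \<mu> j \<omega>"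
    and \<tau>: "continuous_tensor_on U q \<tau>" and n: "j + q = CARD('n)"
  shows "(\<lambda>x. indicator U x * density s j q \<omega> \<tau> (chart_at X x) x) \<in> borel_measurable (completion \<mu>)"
proof (rule measurable_chartwise_on[OF U])
  fix c assume c: "c \<in> atlas X"
  let ?M = "restrict_space (completion \<mu>) (U \<inter> fst c)"
  have [measurable]: "(\<lambda>x. \<omega> c x v) \<in> borel_measurable ?M" for v
    using \<omega> c unfolding measurable_form_def by (blast intro: measurable_restrict_mono)
  have [measurable]: "(\<lambda>x. \<tau> c x v) \<in> borel_measurable ?M" for v
    using \<tau> c unfolding continuous_tensor_on_def by (intro continuous_imp_measurable) blast
  have [measurable]: "s c \<in> borel_measurable ?M"
    using s c unfolding orientation_def by (intro continuous_imp_measurable) blast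
  have [measurable]: "(\<lambda>x. det (metric X c x)) \<in> borel_measurable ?M"
    by (intro continuous_imp_measurable continuous_on_subset[OF det_metric_continuous[OF c]]) auto
  have "(\<lambda>x. density s j q \<omega> \<tau> c x) \<in> borel_measurable ?M"
    unfolding density_def wedge_def by measurable
  then show "(\<lambda>x. indicator U x * density s j q \<omega> \<tau> (chart_at X x) x) \<in> borel_measurable ?M"
  proof (rule measurable_cong[THEN iffD1, rotated])
    fix x assume "x \<in> space ?M"
    then have "x \<in> U" "x \<in> fst c" by (auto simp: space_restrict_space)
    then show "density s j q \<omega> \<tau> c x = indicator U x * density s j q \<omega> \<tau> (chart_at X x) x"
      using density_chart[OF s measurable_form_is_form[OF \<omega>] \<tau> n c _ chart_at] by simp
  qed
qed simp

text \<open>In a fixed chart the components of \<open>\<omega>\<close> are bounded by its norm with a factor that depends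
  continuously on the metric.\<close>

lemma density_locally_bounded:
  assumes U: "open U" and s: "orientation X U s" and \<tau>: "continuous_tensor_on U q \<tau>"
    and n: "j + q = CARD('n)" and x0: "x0 \<in> U"
  shows "\<exists>N C. open N \<and> x0 \<in> N \<and> (\<forall>\<omega>. is_form X j \<omega> \<longrightarrow>
    (\<forall>x\<in>N. \<bar>density s j q \<omega> \<tau> (chart_at X x) x\<bar> \<le> C * form_norm X j \<omega> x))"
proof -
  define c where "c = chart_at X x0"
  have c: "c \<in> atlas X" "x0 \<in> fst c" using chart_at by (auto simp: c_def)
  let ?P = "{\<sigma>. \<sigma> permutes {..<j + q}}"
  define b where "b \<sigma> x = (sqrt (fact j) *
      (\<Prod>a<j. sqrt (coord_frame (\<sigma> a) \<bullet> (metric X c x *v coord_frame (\<sigma> a))))) *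
      \<bar>\<tau> c x (\<lambda>i. coord_frame (\<sigma> (j + i)))\<bar>" for \<sigma> x
  define B where "B x = (\<Sum>\<sigma>\<in>?P. b \<sigma> x) / (fact j * fact q) / sqrt (det (metric X c x))" for x
  have opn: "open (U \<inter> fst c)" using U chart_open[OF c(1)] by auto
  have "continuous_on (U \<inter> fst c) B"
  proof -
    have "continuous_on (U \<inter> fst c) (\<lambda>x. \<tau> c x v)" for v
      using \<tau> c unfolding continuous_tensor_on_def by blast
    moreover have "continuous_on (U \<inter> fst c) (\<lambda>x. metric X c x *v w)" for w
      unfolding matrix_vector_mult_def
      by (intro continuous_on_vec_lambda continuous_intros
          continuous_on_subset[OF metric_continuous[OF c(1)]]) auto
    moreover have "continuous_on (U \<inter> fst c) (\<lambda>x. det (metric X c x))"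
      by (rule continuous_on_subset[OF det_metric_continuous[OF c(1)]]) auto
    moreover have "sqrt (det (metric X c x)) \<noteq> 0" if "x \<in> U \<inter> fst c" for x
      using det_metric_pos[OF c(1), of x] that by simp
    ultimately show ?thesis
      unfolding B_def b_def by (intro continuous_intros) auto
  qed
  then have "open ((U \<inter> fst c) \<inter> B -` {..<B x0 + 1})"
    by (intro continuous_open_preimage opn) auto
  moreover have "\<bar>density s j q \<omega> \<tau> (chart_at X x) x\<bar> \<le> (B x0 + 1) * form_norm X j \<omega> x"
    if \<omega>: "is_form X j \<omega>" and x: "x \<in> (U \<inter> fst c) \<inter> B -` {..<B x0 + 1}" for \<omega> x
  proof -
    have xU: "x \<in> U" "x \<in> fst c" using x by auto
    let ?N = "form_norm X j \<omega> x"
    have N: "0 \<le> ?N" by (rule form_norm_nonneg[OF \<omega>])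
    have dp: "0 < sqrt (det (metric X c x))" using det_metric_pos[OF c(1) xU(2)] by simp
    have "s c x \<in> {1, -1}" using s c xU unfolding orientation_def by blast
    then have "\<bar>s c x\<bar> = 1" by auto
    then have "\<bar>density s j q \<omega> \<tau> c x\<bar> =
        \<bar>wedge j q (\<omega> c x) (\<tau> c x) coord_frame\<bar> / sqrt (det (metric X c x))"
      using dp by (simp add: density_def abs_mult)
    also have "\<bar>wedge j q (\<omega> c x) (\<tau> c x) coord_frame\<bar> \<le> (\<Sum>\<sigma>\<in>?P. b \<sigma> x * ?N) / (fact j * fact q)"
    proof -
      have "\<bar>\<Sum>\<sigma>\<in>?P. of_int (sign \<sigma>) * \<omega> c x (\<lambda>i. coord_frame (\<sigma> i)) * \<tau> c x (\<lambda>i. coord_frame (\<sigma> (j + i)))\<bar>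
          \<le> (\<Sum>\<sigma>\<in>?P. b \<sigma> x * ?N)"
      proof (rule order_trans[OF sum_abs sum_mono])
        fix \<sigma>
        have "\<bar>\<omega> c x (\<lambda>i. coord_frame (\<sigma> i))\<bar> \<le> (sqrt (fact j) *
            (\<Prod>a<j. sqrt (coord_frame (\<sigma> a) \<bullet> (metric X c x *v coord_frame (\<sigma> a))))) * ?N"
          unfolding form_norm_chart[OF \<omega> c(1) xU(2)]
          by (intro abs_le_covector_norm metric_pos_def is_form_multilinear[OF \<omega>] c xU)
        then have "\<bar>\<omega> c x (\<lambda>i. coord_frame (\<sigma> i))\<bar> * \<bar>\<tau> c x (\<lambda>i. coord_frame (\<sigma> (j + i)))\<bar> \<le> b \<sigma> x * ?N"
          unfolding b_def by (rule order_trans[OF mult_right_mono[OF _ abs_ge_zero] eq_refl]) (simp only: mult_ac)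
        moreover have "\<bar>of_int (sign \<sigma>) :: real\<bar> = 1" by (simp add: sign_def)
        ultimately show "\<bar>of_int (sign \<sigma>) * \<omega> c x (\<lambda>i. coord_frame (\<sigma> i)) * \<tau> c x (\<lambda>i. coord_frame (\<sigma> (j + i)))\<bar>
            \<le> b \<sigma> x * ?N"
          by (simp add: abs_mult)
      qed
      then show ?thesis
        unfolding wedge_def by (simp add: abs_divide divide_right_mono)
    qed
    also have "(\<Sum>\<sigma>\<in>?P. b \<sigma> x * ?N) / (fact j * fact q) / sqrt (det (metric X c x)) = B x * ?N"
      by (simp add: B_def flip: sum_distrib_right)
    also have "B x * ?N \<le> (B x0 + 1) * ?N"
      using x N by (intro mult_right_mono) auto
    finally show ?thesis
      using density_chart[OF s \<omega> \<tau> n c(1) xU(2) chart_at xU(1)] dp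
      by (simp add: divide_right_mono)
  qed
  ultimately show ?thesis
    using x0 c(2) by (intro exI[of _ "(U \<inter> fst c) \<inter> B -` {..<B x0 + 1}"] exI[of _ "B x0 + 1"]) simp
qed

text \<open>Finitely many of the neighbourhoods of the preceding lemma cover the compact support.\<close>

lemma density_bounded:
  assumes U: "open U" and s: "orientation X U s" and \<tau>: "continuous_tensor_on U q \<tau>"
    and n: "j + q = CARD('n)" and K: "compact K" "K \<subseteq> U"
    and supp: "\<And>c x v. c \<in> atlas X \<Longrightarrow> x \<in> U \<inter> fst c \<Longrightarrow> x \<notin> K \<Longrightarrow> \<tau> c x v = 0"
  shows "\<exists>C\<ge>0. \<forall>\<omega>. is_form X j \<omega> \<longrightarrow> (\<forall>x.
    \<bar>indicator U x * density s j q \<omega> \<tau> (chart_at X x) x\<bar> \<le> C * (indicator K x * form_norm X j \<omega> x))"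
proof -
  have "\<forall>x0\<in>U. \<exists>N C. open N \<and> x0 \<in> N \<and> (\<forall>\<omega>. is_form X j \<omega> \<longrightarrow>
      (\<forall>x\<in>N. \<bar>density s j q \<omega> \<tau> (chart_at X x) x\<bar> \<le> C * form_norm X j \<omega> x))"
    using density_locally_bounded[OF U s \<tau> n] by blast
  then obtain N C where NC: "\<And>x0. x0 \<in> U \<Longrightarrow> open (N x0)" "\<And>x0. x0 \<in> U \<Longrightarrow> x0 \<in> N x0"
    "\<And>x0 \<omega> x. x0 \<in> U \<Longrightarrow> is_form X j \<omega> \<Longrightarrow> x \<in> N x0 \<Longrightarrow>
      \<bar>density s j q \<omega> \<tau> (chart_at X x) x\<bar> \<le> C x0 * form_norm X j \<omega> x"
    by metis
  have "K \<subseteq> (\<Union>x\<in>K. N x)" using NC(2) K(2) by blast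
  then obtain F where F: "F \<subseteq> K" "finite F" "K \<subseteq> (\<Union>x\<in>F. N x)"
    using compactE_image[OF K(1), of K N] NC(1) K(2) by (metis subsetD)
  define C' where "C' = (\<Sum>x\<in>F. \<bar>C x\<bar>)"
  have "\<bar>indicator U x * density s j q \<omega> \<tau> (chart_at X x) x\<bar> \<le> C' * (indicator K x * form_norm X j \<omega> x)"
    if \<omega>: "is_form X j \<omega>" for \<omega> x
  proof (cases "x \<in> K")
    case True
    then obtain y where y: "y \<in> F" "x \<in> N y" using F by blast
    have "\<bar>density s j q \<omega> \<tau> (chart_at X x) x\<bar> \<le> C y * form_norm X j \<omega> x"
      using NC(3)[OF _ \<omega> y(2)] y(1) F(1) K(2) by blast
    also have "\<dots> \<le> C' * form_norm X j \<omega> x"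
    proof (rule mult_right_mono[OF _ form_norm_nonneg[OF \<omega>]])
      have "\<bar>C y\<bar> \<le> C'"
        unfolding C'_def using y(1) F(2) by (intro member_le_sum) auto
      then show "C y \<le> C'" by simp
    qed
    finally show ?thesis using True K(2) by (auto simp: indicator_def)
  next
    case False
    have "x \<in> U \<Longrightarrow> \<tau> (chart_at X x) x v = 0" for v
      using supp[OF chart_at(1)] chart_at(2) False by blast
    then have "x \<in> U \<Longrightarrow> density s j q \<omega> \<tau> (chart_at X x) x = 0"
      by (simp add: density_def wedge_def)
    with False show ?thesis by (auto simp: indicator_def)
  qed
  then show ?thesis
    by (intro exI[of _ C']) (auto simp: C'_def sum_nonneg)
qed

text \<open>Pairing with a continuous test field of compact support is a continuous linear functional
  on an Orlicz space of forms.\<close>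

lemma form_integral_continuous_linear:
  assumes U: "open U" and s: "orientation X U s" and \<tau>: "continuous_tensor_on U q \<tau>"
    and n: "j + q = CARD('n)" and K: "compact K" "K \<subseteq> U"
    and supp: "\<And>c x v. c \<in> atlas X \<Longrightarrow> x \<in> U \<inter> fst c \<Longrightarrow> x \<notin> K \<Longrightarrow> \<tau> c x v = 0"
    and \<Phi>: "N_function \<Phi>"
  defines "I \<equiv> \<lambda>\<omega>. form_integral X \<mu> s U (wedge_form j q \<omega> \<tau>)"
  shows "\<omega> \<in> Orlicz_forms X \<mu> \<Phi> j \<Longrightarrow> \<eta> \<in> Orlicz_forms X \<mu> \<Phi> j \<Longrightarrow> I (\<omega> + \<eta>) = I \<omega> + I \<eta>"
    and "\<omega> \<in> Orlicz_forms X \<mu> \<Phi> j \<Longrightarrow> I (a *\<^sub>R \<omega>) = a * I \<omega>"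
    and "\<exists>C\<ge>0. \<forall>\<omega>\<in>Orlicz_forms X \<mu> \<Phi> j. \<bar>I \<omega>\<bar> \<le> C * gauge_norm X \<mu> \<Phi> j \<omega>"
proof -
  let ?F = "\<lambda>\<omega> x. indicator U x * density s j q \<omega> \<tau> (chart_at X x) x"
  have I: "I \<omega> = (\<integral>x. ?F \<omega> x \<partial>completion \<mu>)" for \<omega>
    by (simp add: I_def form_integral_density)
  obtain C where C: "0 \<le> C"
    "\<And>\<omega> x. is_form X j \<omega> \<Longrightarrow> \<bar>?F \<omega> x\<bar> \<le> C * (indicator K x * form_norm X j \<omega> x)"
    using density_bounded[OF U s \<tau> n K supp] by blast
  obtain D where D: "0 \<le> D"
    "\<And>\<omega>. \<omega> \<in> Orlicz_forms X \<mu> \<Phi> j \<Longrightarrow> integrable (completion \<mu>) (\<lambda>x. indicator K x * form_norm X j \<omega> x)"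
    "\<And>\<omega>. \<omega> \<in> Orlicz_forms X \<mu> \<Phi> j \<Longrightarrow>
      (\<integral>x. indicator K x * form_norm X j \<omega> x \<partial>completion \<mu>) \<le> D * gauge_norm X \<mu> \<Phi> j \<omega>"
    using Orlicz_integrable_compact[OF \<Phi> K(1)] by blast
  have int: "integrable (completion \<mu>) (?F \<omega>)" if "\<omega> \<in> Orlicz_forms X \<mu> \<Phi> j" for \<omega>
  proof (rule Bochner_Integration.integrable_bound)
    show "integrable (completion \<mu>) (\<lambda>x. C * (indicator K x * form_norm X j \<omega> x))"
      by (intro integrable_mult_right D(2) that)
    show "?F \<omega> \<in> borel_measurable (completion \<mu>)"
      by (rule density_measurable[OF U s Orlicz_measurable[OF that] \<tau> n])
    show "AE x in completion \<mu>. norm (?F \<omega> x) \<le> norm (C * (indicator K x * form_norm X j \<omega> x))"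
      using C(2)[OF Orlicz_is_form[OF that]] by (intro AE_I2) (simp add: order_trans[OF _ abs_ge_self])
  qed
  show "I (\<omega> + \<eta>) = I \<omega> + I \<eta>"
    if "\<omega> \<in> Orlicz_forms X \<mu> \<Phi> j" "\<eta> \<in> Orlicz_forms X \<mu> \<Phi> j"
    unfolding I density_add distrib_left
    by (rule Bochner_Integration.integral_add[OF int int]) fact+
  show "I (a *\<^sub>R \<omega>) = a * I \<omega>"
    unfolding I density_scale mult.left_commute[of _ a] by simp
  have "\<bar>I \<omega>\<bar> \<le> (C * D) * gauge_norm X \<mu> \<Phi> j \<omega>" if "\<omega> \<in> Orlicz_forms X \<mu> \<Phi> j" for \<omega>
  proof -
    have "\<bar>I \<omega>\<bar> \<le> (\<integral>x. C * (indicator K x * form_norm X j \<omega> x) \<partial>completion \<mu>)"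
      unfolding I
    proof (rule order_trans[OF integral_abs_bound integral_mono])
      show "\<bar>?F \<omega> x\<bar> \<le> C * (indicator K x * form_norm X j \<omega> x)" for x
        by (rule C(2)[OF Orlicz_is_form[OF that]])
    qed (intro integrable_abs int integrable_mult_right D(2) that)+
    also have "\<dots> = C * (\<integral>x. indicator K x * form_norm X j \<omega> x \<partial>completion \<mu>)" by simp
    also have "\<dots> \<le> C * (D * gauge_norm X \<mu> \<Phi> j \<omega>)"
      by (intro mult_left_mono D(3) that C(1))
    finally show ?thesis by (simp add: mult.assoc)
  qed
  then show "\<exists>C\<ge>0. \<forall>\<omega>\<in>Orlicz_forms X \<mu> \<Phi> j. \<bar>I \<omega>\<bar> \<le> C * gauge_norm X \<mu> \<Phi> j \<omega>"
    using C(1) D(1) by (intro exI[of _ "C * D"]) simp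
qed

end

section \<open>Symmetry of second derivatives\<close>

lemma has_derivative_line:
  fixes f :: "'e::real_normed_vector \<Rightarrow> real"
  assumes "(f has_derivative f') (at (a + t *\<^sub>R v))"
  shows "((\<lambda>t. f (a + t *\<^sub>R v)) has_real_derivative f' v) (at t)"
proof -
  have "((\<lambda>t. a + t *\<^sub>R v) has_derivative (\<lambda>h. h *\<^sub>R v)) (at t)"
    by (auto intro!: derivative_eq_intros)
  from has_derivative_compose[OF this assms]
  have "((\<lambda>t. f (a + t *\<^sub>R v)) has_derivative (\<lambda>h. f' (h *\<^sub>R v))) (at t)" .
  moreover have "(\<lambda>h. f' (h *\<^sub>R v)) = (*) (f' v)"
    using linear_scale[OF has_derivative_linear[OF assms]] by (auto simp: mult.commute)
  ultimately show ?thesis by (simp add: has_field_derivative_def)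
qed

lemma second_difference_mean_value:
  fixes f :: "'e::real_normed_vector \<Rightarrow> real"
  assumes f: "\<And>x. x \<in> ball y r \<Longrightarrow> (f has_derivative f' x) (at x)"
    and A: "\<And>x. x \<in> ball y r \<Longrightarrow> ((\<lambda>z. f' z v) has_derivative A x) (at x)"
    and s: "0 < s" "s * (norm v + norm w) < r"
  shows "\<exists>p\<in>ball y r. f (y + s *\<^sub>R v + s *\<^sub>R w) - f (y + s *\<^sub>R v) - f (y + s *\<^sub>R w) + f y = s * s * A p w"
proof -
  have near: "y + a *\<^sub>R v + b *\<^sub>R w \<in> ball y r" if "0 \<le> a" "a \<le> s" "0 \<le> b" "b \<le> s" for a b
  proof -
    have "norm (a *\<^sub>R v + b *\<^sub>R w) \<le> a * norm v + b * norm w"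
      using norm_triangle_ineq[of "a *\<^sub>R v" "b *\<^sub>R w"] that by simp
    also have "\<dots> \<le> s * norm v + s * norm w"
      using that by (intro add_mono mult_right_mono) auto
    also have "\<dots> < r" using s by (simp add: distrib_left)
    finally show ?thesis
      by (metis add.assoc add_diff_cancel_left' dist_commute dist_norm mem_ball)
  qed
  have "\<exists>\<xi>>0. \<xi> < s \<and> (f (y + s *\<^sub>R w + s *\<^sub>R v) - f (y + s *\<^sub>R v)) - (f (y + s *\<^sub>R w + 0 *\<^sub>R v) - f (y + 0 *\<^sub>R v)) =
      (s - 0) * (f' (y + s *\<^sub>R w + \<xi> *\<^sub>R v) v - f' (y + \<xi> *\<^sub>R v) v)"
  proof (rule MVT2[OF s(1)])
    fix t assume t: "0 \<le> t" "t \<le> s"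
    have "y + s *\<^sub>R w + t *\<^sub>R v \<in> ball y r" "y + t *\<^sub>R v \<in> ball y r"
      using near[of t s] near[of t 0] t s by (simp_all add: add_ac)
    then show "((\<lambda>t. f (y + s *\<^sub>R w + t *\<^sub>R v) - f (y + t *\<^sub>R v)) has_real_derivative
        f' (y + s *\<^sub>R w + t *\<^sub>R v) v - f' (y + t *\<^sub>R v) v) (at t)"
      by (intro DERIV_diff has_derivative_line f)
  qed
  then obtain \<xi> where \<xi>: "0 < \<xi>" "\<xi> < s"
    "f (y + s *\<^sub>R w + s *\<^sub>R v) - f (y + s *\<^sub>R v) - (f (y + s *\<^sub>R w) - f y) =
      s * (f' (y + s *\<^sub>R w + \<xi> *\<^sub>R v) v - f' (y + \<xi> *\<^sub>R v) v)"
    by auto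
  have "\<exists>\<eta>>0. \<eta> < s \<and> f' (y + \<xi> *\<^sub>R v + s *\<^sub>R w) v - f' (y + \<xi> *\<^sub>R v + 0 *\<^sub>R w) v =
      (s - 0) * A (y + \<xi> *\<^sub>R v + \<eta> *\<^sub>R w) w"
  proof (rule MVT2[OF s(1)])
    fix t assume t: "0 \<le> t" "t \<le> s"
    show "((\<lambda>t. f' (y + \<xi> *\<^sub>R v + t *\<^sub>R w) v) has_real_derivative A (y + \<xi> *\<^sub>R v + t *\<^sub>R w) w) (at t)"
      using near[of \<xi> t] t \<xi> by (intro has_derivative_line[of "\<lambda>z. f' z v"] A) simp
  qed
  then obtain \<eta> where \<eta>: "0 < \<eta>" "\<eta> < s"
    "f' (y + \<xi> *\<^sub>R v + s *\<^sub>R w) v - f' (y + \<xi> *\<^sub>R v) v = s * A (y + \<xi> *\<^sub>R v + \<eta> *\<^sub>R w) w"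
    by auto
  have "y + \<xi> *\<^sub>R v + \<eta> *\<^sub>R w \<in> ball y r"
    using near[of \<xi> \<eta>] \<xi> \<eta> by simp
  moreover have "f (y + s *\<^sub>R v + s *\<^sub>R w) - f (y + s *\<^sub>R v) - f (y + s *\<^sub>R w) + f y =
      s * (s * A (y + \<xi> *\<^sub>R v + \<eta> *\<^sub>R w) w)"
    using \<xi>(3) \<eta>(3) by (simp add: algebra_simps)
  ultimately show ?thesis unfolding mult.assoc by blast
qed

text \<open>Both iterated derivatives are limits of the same second difference quotient.\<close>

lemma symmetric_second_derivative_real:
  fixes f :: "'e::real_normed_vector \<Rightarrow> real"
  assumes "open S" "y \<in> S"
    and f: "\<And>x. x \<in> S \<Longrightarrow> (f has_derivative f' x) (at x)"
    and A: "\<And>x. x \<in> S \<Longrightarrow> ((\<lambda>z. f' z v) has_derivative A x) (at x)"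
    and B: "\<And>x. x \<in> S \<Longrightarrow> ((\<lambda>z. f' z w) has_derivative B x) (at x)"
    and cont: "continuous_on S (\<lambda>x. A x w)" "continuous_on S (\<lambda>x. B x v)"
  shows "A y w = B y v"
proof (rule ccontr)
  assume ne: "A y w \<noteq> B y v"
  define e where "e = \<bar>A y w - B y v\<bar> / 2"
  have e: "0 < e" using ne by (simp add: e_def)
  have near: "\<exists>r>0. \<forall>x. dist x y < r \<longrightarrow> \<bar>g x - g y\<bar> < e"
    if "continuous_on S g" for g :: "'e \<Rightarrow> real"
  proof -
    have "isCont g y" using that assms(1,2) by (simp add: continuous_on_eq_continuous_at)
    then show ?thesis using e unfolding continuous_at_eps_delta dist_real_def by blast
  qed
  obtain r1 where r1: "0 < r1" "\<And>x. dist x y < r1 \<Longrightarrow> \<bar>A x w - A y w\<bar> < e"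
    using near[OF cont(1)] by blast
  obtain r2 where r2: "0 < r2" "\<And>x. dist x y < r2 \<Longrightarrow> \<bar>B x v - B y v\<bar> < e"
    using near[OF cont(2)] by blast
  obtain r3 where r3: "0 < r3" "ball y r3 \<subseteq> S"
    using assms(1,2) by (meson open_contains_ball)
  define r where "r = min r3 (min r1 r2)"
  have r: "0 < r" "ball y r \<subseteq> S" using r1 r2 r3 by (auto simp: r_def)
  define s where "s = r / (2 * (norm v + norm w + 1))"
  have s: "0 < s" "s * (norm v + norm w) < r"
  proof -
    have p: "0 < norm v + norm w + 1" by (smt (verit) norm_ge_zero)
    then show "0 < s" using r(1) by (simp add: s_def)
    have "s * (norm v + norm w) < s * (2 * (norm v + norm w + 1))"
      using \<open>0 < s\<close> by (intro mult_strict_left_mono) (smt (verit) norm_ge_zero)+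
    also have "\<dots> = r" using p by (simp add: s_def)
    finally show "s * (norm v + norm w) < r" .
  qed
  have "\<exists>p\<in>ball y r. f (y + s *\<^sub>R v + s *\<^sub>R w) - f (y + s *\<^sub>R v) - f (y + s *\<^sub>R w) + f y = s * s * A p w"
    using r s by (intro second_difference_mean_value[of y r f f' v A s w] f A) auto
  then obtain p where p: "p \<in> ball y r"
    "f (y + s *\<^sub>R v + s *\<^sub>R w) - f (y + s *\<^sub>R v) - f (y + s *\<^sub>R w) + f y = s * s * A p w"
    by blast
  have "\<exists>p\<in>ball y r. f (y + s *\<^sub>R w + s *\<^sub>R v) - f (y + s *\<^sub>R w) - f (y + s *\<^sub>R v) + f y = s * s * B p v"
    using r s by (intro second_difference_mean_value[of y r f f' w B s v] f B) (auto simp: add.commute)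
  then obtain p' where p': "p' \<in> ball y r"
    "f (y + s *\<^sub>R w + s *\<^sub>R v) - f (y + s *\<^sub>R w) - f (y + s *\<^sub>R v) + f y = s * s * B p' v"
    by blast
  have "f (y + s *\<^sub>R w + s *\<^sub>R v) = f (y + s *\<^sub>R v + s *\<^sub>R w)" by (simp add: add_ac)
  then have "s * s * A p w = s * s * B p' v" using p(2) p'(2) by linarith
  then have "A p w = B p' v" using s(1) by simp
  moreover have "\<bar>A p w - A y w\<bar> < e"
    using p(1) by (intro r1(2)) (simp add: r_def dist_commute)
  moreover have "\<bar>B p' v - B y v\<bar> < e"
    using p'(1) by (intro r2(2)) (simp add: r_def dist_commute)
  moreover have "2 * e = \<bar>A y w - B y v\<bar>" by (simp add: e_def)
  ultimately show False by arith
qed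

lemma symmetric_second_derivative:
  fixes f :: "'e::real_normed_vector \<Rightarrow> 'f::euclidean_space"
  assumes "open S" "y \<in> S"
    and f: "\<And>x. x \<in> S \<Longrightarrow> (f has_derivative f' x) (at x)"
    and A: "\<And>x. x \<in> S \<Longrightarrow> ((\<lambda>z. f' z v) has_derivative A x) (at x)"
    and B: "\<And>x. x \<in> S \<Longrightarrow> ((\<lambda>z. f' z w) has_derivative B x) (at x)"
    and cont: "continuous_on S (\<lambda>x. A x w)" "continuous_on S (\<lambda>x. B x v)"
  shows "A y w = B y v"
proof (rule euclidean_eqI)
  fix b :: 'f
  show "A y w \<bullet> b = B y v \<bullet> b"
  proof (rule symmetric_second_derivative_real[OF assms(1,2)])
    show "((\<lambda>x. f x \<bullet> b) has_derivative (\<lambda>u. f' x u \<bullet> b)) (at x)" if "x \<in> S" for x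
      by (intro has_derivative_inner_left f that)
    show "((\<lambda>z. f' z v \<bullet> b) has_derivative (\<lambda>u. A x u \<bullet> b)) (at x)" if "x \<in> S" for x
      by (intro has_derivative_inner_left A that)
    show "((\<lambda>z. f' z w \<bullet> b) has_derivative (\<lambda>u. B x u \<bullet> b)) (at x)" if "x \<in> S" for x
      by (intro has_derivative_inner_left B that)
  qed (intro continuous_intros cont)+
qed

section \<open>The exterior derivative commutes with pullback\<close>

lemma alternating_swap:
  assumes "alternating m \<alpha>" "p < m" "q < m" "p \<noteq> q"
  shows "\<alpha> (W(p := x, q := y)) = - \<alpha> (W(p := y, q := x))"
proof -
  define f where "f a b = \<alpha> (W(p := a, q := b))" for a b
  have multi: "multilinear m \<alpha>" using assms(1) by (rule alternating_imp_multilinear)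
  have zero: "f a a = 0" for a
  proof -
    have "(W(p := a, q := a)) p = (W(p := a, q := a)) q" using assms(4) by simp
    then show ?thesis using assms unfolding f_def alternating_def by blast
  qed
  have "f a (b + c) = f a b + f a c" for a b c
    using linear_add[OF multilinear_linear[OF multi assms(3), of "W(p := a)"]] by (simp add: f_def)
  moreover have "f (b + c) a = f b a + f c a" for a b c
    using linear_add[OF multilinear_linear[OF multi assms(2), of "W(q := a)"]] assms(4)
    by (simp add: f_def fun_upd_twist)
  ultimately have "f (x + y) (x + y) = f x x + f x y + (f y x + f y y)" by simp
  then show ?thesis using zero by (simp add: f_def)
qed

text \<open>Moving an entry over \<open>d\<close> others takes \<open>d\<close> transpositions of neighbours.\<close>

lemma alternating_move:
  assumes "alternating m \<alpha>" "i + d < m"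
  shows "\<alpha> (\<lambda>j. if i \<le> j \<and> j < i + d then W (Suc j) else if j = i + d then W i else W j) = (-1) ^ d * \<alpha> W"
  using assms(2)
proof (induction d)
  case 0
  have "(\<lambda>j. if i \<le> j \<and> j < i + 0 then W (Suc j) else if j = i + 0 then W i else W j) = W"
    by (auto simp: fun_eq_iff)
  then show ?case by simp
next
  case (Suc d)
  define C where "C = (\<lambda>d j. if i \<le> j \<and> j < i + d then W (Suc j) else if j = i + d then W i else W j)"
  have "C (Suc d) = (C d)(i + d := W (Suc (i + d)), Suc (i + d) := W i)"
    by (auto simp: C_def fun_eq_iff)
  moreover have "\<alpha> ((C d)(i + d := W (Suc (i + d)), Suc (i + d) := W i)) =
      - \<alpha> ((C d)(i + d := W i, Suc (i + d) := W (Suc (i + d))))"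
    using Suc.prems by (intro alternating_swap[OF assms(1)]) simp_all
  ultimately have "\<alpha> (C (Suc d)) = - \<alpha> ((C d)(i + d := W i, Suc (i + d) := W (Suc (i + d))))"
    by (rule trans[OF arg_cong[of _ _ \<alpha>]])
  also have "(C d)(i + d := W i, Suc (i + d) := W (Suc (i + d))) = C d"
    by (auto simp: C_def fun_eq_iff)
  also have "\<alpha> (C d) = (-1) ^ d * \<alpha> W"
    unfolding C_def using Suc.IH Suc.prems by simp
  finally have "\<alpha> (C (Suc d)) = (-1) ^ Suc d * \<alpha> W" by simp
  then show ?case unfolding C_def .
qed

definition skip :: "nat \<Rightarrow> (nat \<Rightarrow> 'b) \<Rightarrow> nat \<Rightarrow> 'b" where
  "skip i v = (\<lambda>j. if j < i then v j else v (Suc j))"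

lemma alternating_skip_exchange:
  assumes "alternating m \<alpha>" "i \<le> a" "a < m"
  shows "\<alpha> ((skip i V)(a := h)) = (-1) ^ (a - i) * \<alpha> ((skip (Suc a) V)(i := h))"
proof -
  let ?W = "(skip (Suc a) V)(i := h)"
  have "(skip i V)(a := h) =
      (\<lambda>j. if i \<le> j \<and> j < i + (a - i) then ?W (Suc j) else if j = i + (a - i) then ?W i else ?W j)"
    using assms(2) by (auto simp: skip_def fun_eq_iff)
  then show ?thesis
    using alternating_move[OF assms(1), of i "a - i" ?W] assms(2,3) by simp
qed

text \<open>The terms with second derivatives in the exterior derivative of a pullback cancel in pairs,
  since they are symmetric in the two directions and the form is alternating.\<close>

lemma second_derivative_terms_cancel:
  assumes \<alpha>: "alternating m \<alpha>" and h: "\<And>i p. h i p = h p i"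
  shows "(\<Sum>i\<le>m. (-1) ^ i * (\<Sum>a<m. \<alpha> ((skip i V)(a := h (skip i id a) i)))) = 0"
proof -
  define t where "t i a = (-1) ^ i * \<alpha> ((skip i V)(a := h (skip i id a) i))" for i a
  define P where "P = {(i, a). i \<le> a \<and> a < m}"
  define Q where "Q = {(i, a). a < i \<and> i \<le> m}"
  have PQ: "{..m} \<times> {..<m} = P \<union> Q" "P \<inter> Q = {}" by (auto simp: P_def Q_def)
  have "finite (P \<union> Q)" unfolding PQ(1)[symmetric] by simp
  then have fin: "finite P" "finite Q" by auto
  have pair: "t (Suc a) i = - t i a" if "(i, a) \<in> P" for i a
  proof -
    have ia: "i \<le> a" "a < m" using that by (auto simp: P_def)
    have "t i a = (-1) ^ i * ((-1) ^ (a - i) * \<alpha> ((skip (Suc a) V)(i := h (Suc a) i)))"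
      unfolding t_def using ia by (subst alternating_skip_exchange[OF \<alpha> ia]) (simp add: skip_def)
    also have "\<dots> = (-1) ^ a * \<alpha> ((skip (Suc a) V)(i := h i (Suc a)))"
      using ia h[of i "Suc a"] by (simp flip: mult.assoc power_add)
    finally show ?thesis
      using ia by (simp add: t_def skip_def)
  qed
  have "(\<Sum>i\<le>m. (-1) ^ i * (\<Sum>a<m. \<alpha> ((skip i V)(a := h (skip i id a) i)))) = (\<Sum>i\<le>m. \<Sum>a<m. t i a)"
    by (simp add: t_def sum_distrib_left)
  also have "\<dots> = (\<Sum>(i, a)\<in>P \<union> Q. t i a)"
    by (simp add: sum.cartesian_product PQ(1))
  also have "\<dots> = (\<Sum>(i, a)\<in>P. t i a) + (\<Sum>(i, a)\<in>Q. t i a)"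
    by (rule sum.union_disjoint[OF fin PQ(2)])
  also have "(\<Sum>(i, a)\<in>Q. t i a) = (\<Sum>(i, a)\<in>P. t (Suc a) i)"
    by (rule sum.reindex_bij_witness[of _ "\<lambda>(i, a). (Suc a, i)" "\<lambda>(i, a). (a, i - 1)"])
      (auto simp: P_def Q_def)
  also have "(\<Sum>(i, a)\<in>P. t (Suc a) i) = (\<Sum>(i, a)\<in>P. - t i a)"
    using pair by (intro sum.cong) auto
  also have "\<dots> = - (\<Sum>(i, a)\<in>P. t i a)"
    by (simp add: case_prod_unfold sum_negf)
  also have "(\<Sum>(i, a)\<in>P. t i a) + - (\<Sum>(i, a)\<in>P. t i a) = 0"
    by simp
  finally show ?thesis .
qed

lemma multilinear_derivative:
  fixes A :: "'e::real_normed_vector \<Rightarrow> 'n::finite covector"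
  assumes N: "open N" "z0 \<in> N" and multi: "\<And>z. z \<in> N \<Longrightarrow> multilinear m (A z)"
    and A': "\<And>v. ((\<lambda>z. A z v) has_derivative A' v) (at z0)"
  shows "multilinear m (\<lambda>v. A' v w)"
  unfolding multilinear_def
proof (intro conjI allI impI)
  have unique: "A' v = g" if "(f has_derivative g) (at z0)" "\<And>z. z \<in> N \<Longrightarrow> f z = A z v" for f g v
  proof -
    have "((\<lambda>z. A z v) has_derivative g) (at z0)"
      by (rule has_derivative_transform_within_open[OF that(1) N]) (rule that(2))
    then show ?thesis by (rule has_derivative_unique[OF A'])
  qed
  fix v :: "nat \<Rightarrow> real ^ 'n" and i assume i: "i < m"
  have lin: "linear (\<lambda>x. A z (v(i := x)))" if "z \<in> N" for z
    by (rule multilinear_linear[OF multi[OF that] i])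
  show "linear (\<lambda>x. A' (v(i := x)) w)"
  proof (rule linearI)
    fix x y
    have "A' (v(i := x + y)) = (\<lambda>w. A' (v(i := x)) w + A' (v(i := y)) w)"
      by (rule unique[OF has_derivative_add[OF A' A']]) (simp add: linear_add[OF lin])
    then show "A' (v(i := x + y)) w = A' (v(i := x)) w + A' (v(i := y)) w" by simp
  next
    fix c x
    have "A' (v(i := c *\<^sub>R x)) = (\<lambda>w. c *\<^sub>R A' (v(i := x)) w)"
      by (rule unique[OF has_derivative_scaleR_right[OF A']]) (simp add: linear_scale[OF lin])
    then show "A' (v(i := c *\<^sub>R x)) w = c *\<^sub>R A' (v(i := x)) w" by simp
  qed
next
  fix v v' :: "nat \<Rightarrow> real ^ 'n" assume "\<forall>i<m. v i = v' i"
  then have "A z v = A z v'" if "z \<in> N" for z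
    using multilinear_cong[OF multi[OF that]] by blast
  then have "((\<lambda>z. A z v') has_derivative A' v) (at z0)"
    by (rule has_derivative_transform_within_open[OF A' N])
  then have "A' v = A' v'"
    by (rule has_derivative_unique[OF _ A'])
  then show "A' v w = A' v' w" by simp
qed

text \<open>The shape of an exterior derivative: \<open>A' v\<close> is the derivative of the coefficient of the form on
  the vectors \<open>v\<close>.\<close>

lemma multilinear_antisymmetrized:
  fixes A' :: "(nat \<Rightarrow> real ^ 'n::finite) \<Rightarrow> real ^ 'n \<Rightarrow> real"
  assumes multi: "\<And>w. multilinear m (\<lambda>v. A' v w)" and lin: "\<And>v. linear (A' v)"
  shows "multilinear (Suc m) (\<lambda>v. \<Sum>i\<le>m. (-1) ^ i * A' (skip i v) (v i))"
  unfolding multilinear_def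
proof (intro conjI allI impI)
  fix v :: "nat \<Rightarrow> real ^ 'n" and l assume l: "l < Suc m"
  have "linear (\<lambda>w. (-1) ^ i * A' (skip i (v(l := w))) ((v(l := w)) i))" if i: "i \<le> m" for i
  proof -
    have "linear (\<lambda>w. A' (skip i (v(l := w))) ((v(l := w)) i))"
    proof (cases "i = l")
      case True
      have "skip l (v(l := w)) = skip l v" for w by (auto simp: skip_def fun_eq_iff)
      then show ?thesis using lin True by simp
    next
      case False
      define l' where "l' = (if l < i then l else l - 1)"
      have "skip i (v(l := w)) = (skip i v)(l' := w)" for w
        using False by (auto simp: skip_def fun_eq_iff l'_def)
      moreover have "l' < m" using False l i by (auto simp: l'_def)
      ultimately show ?thesis
        using multilinear_linear[OF multi \<open>l' < m\<close>] False by simp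
    qed
    then show ?thesis by (simp add: linear_iff algebra_simps)
  qed
  then show "linear (\<lambda>w. \<Sum>i\<le>m. (-1) ^ i * A' (skip i (v(l := w))) ((v(l := w)) i))"
    by (intro linear_compose_sum) auto
next
  fix v v' :: "nat \<Rightarrow> real ^ 'n" assume eq: "\<forall>i<Suc m. v i = v' i"
  have "A' (skip i v) (v i) = A' (skip i v') (v' i)" if "i \<le> m" for i
  proof -
    have "A' (skip i v) (v i) = A' (skip i v') (v i)"
      by (rule multilinear_cong[OF multi]) (use eq in \<open>auto simp: skip_def\<close>)
    with that eq show ?thesis by simp
  qed
  then show "(\<Sum>i\<le>m. (-1) ^ i * A' (skip i v) (v i)) = (\<Sum>i\<le>m. (-1) ^ i * A' (skip i v') (v' i))"
    by (intro sum.cong) auto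
qed

text \<open>The product rule for the pullback of a field of multilinear functions, obtained by expanding
  it into components.\<close>

lemma has_derivative_pullback:
  fixes A :: "real ^ 'n::finite \<Rightarrow> 'n covector" and T :: "real ^ 'n \<Rightarrow> real ^ 'n"
  assumes S: "open S" "y0 \<in> S" and N: "open N" "T ` S \<subseteq> N"
    and multi: "\<And>z. z \<in> N \<Longrightarrow> multilinear m (A z)"
    and A': "\<And>v. ((\<lambda>z. A z v) has_derivative A' v) (at (T y0))"
    and T': "(T has_derivative T' y0) (at y0)"
    and H: "\<And>v. ((\<lambda>y. T' y v) has_derivative H v) (at y0)"
    and B: "\<And>y v. y \<in> S \<Longrightarrow> B y v = A (T y) (\<lambda>i. T' y (v i))"
  shows "((\<lambda>y. B y v) has_derivative (\<lambda>w. A' (\<lambda>i. T' y0 (v i)) (T' y0 w) +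
    (\<Sum>a<m. A (T y0) ((\<lambda>i. T' y0 (v i))(a := H (v a) w))))) (at y0)"
proof -
  let ?P = "{..<m} \<rightarrow>\<^sub>E (UNIV :: 'n set)"
  define e :: "(nat \<Rightarrow> 'n) \<Rightarrow> nat \<Rightarrow> real ^ 'n" where "e I = (\<lambda>a. axis (I a) 1)" for I
  define V where "V = (\<lambda>i. T' y0 (v i))"
  have z0: "T y0 \<in> N" using S N by blast
  have comp: "((\<lambda>y. A (T y) (e I)) has_derivative (\<lambda>w. A' (e I) (T' y0 w))) (at y0)" for I
    using has_derivative_compose[OF T' A'] .
  have coord: "((\<lambda>y. T' y (v a) $ i) has_derivative (\<lambda>w. H (v a) w $ i)) (at y0)" for a i
    by (rule bounded_linear.has_derivative[OF bounded_linear_vec_nth H])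
  have "((\<lambda>y. \<Sum>I\<in>?P. (\<Prod>a<m. T' y (v a) $ I a) * A (T y) (e I)) has_derivative
      (\<lambda>w. \<Sum>I\<in>?P. (\<Prod>a<m. V a $ I a) * A' (e I) (T' y0 w) +
        (\<Sum>a<m. H (v a) w $ I a * (\<Prod>b\<in>{..<m} - {a}. V b $ I b)) * A (T y0) (e I))) (at y0)"
    unfolding V_def
    by (intro has_derivative_sum has_derivative_mult has_derivative_prod coord comp)
  then have "((\<lambda>y. B y v) has_derivative
      (\<lambda>w. \<Sum>I\<in>?P. (\<Prod>a<m. V a $ I a) * A' (e I) (T' y0 w) +
        (\<Sum>a<m. H (v a) w $ I a * (\<Prod>b\<in>{..<m} - {a}. V b $ I b)) * A (T y0) (e I))) (at y0)"
  proof (rule has_derivative_transform_within_open[OF _ S])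
    fix y assume "y \<in> S"
    then have "B y v = A (T y) (\<lambda>i. T' y (v i))" "T y \<in> N" using B N by auto
    then show "(\<Sum>I\<in>?P. (\<Prod>a<m. T' y (v a) $ I a) * A (T y) (e I)) = B y v"
      using multilinear_components[OF multi] by (simp add: e_def)
  qed
  also have "(\<lambda>w. \<Sum>I\<in>?P. (\<Prod>a<m. V a $ I a) * A' (e I) (T' y0 w) +
        (\<Sum>a<m. H (v a) w $ I a * (\<Prod>b\<in>{..<m} - {a}. V b $ I b)) * A (T y0) (e I)) =
      (\<lambda>w. A' V (T' y0 w) + (\<Sum>a<m. A (T y0) (V(a := H (v a) w))))"
  proof
    fix w
    have "multilinear m (\<lambda>v. A' v (T' y0 w))"
      by (rule multilinear_derivative[OF N(1) z0 multi A'])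
    from multilinear_components[OF this, of V]
    have 1: "(\<Sum>I\<in>?P. (\<Prod>a<m. V a $ I a) * A' (e I) (T' y0 w)) = A' V (T' y0 w)"
      by (simp add: e_def)
    have 2: "A (T y0) (V(a := H (v a) w)) =
        (\<Sum>I\<in>?P. H (v a) w $ I a * (\<Prod>b\<in>{..<m} - {a}. V b $ I b) * A (T y0) (e I))" if "a < m" for a
    proof -
      have "(\<Prod>b<m. (V(a := H (v a) w)) b $ I b) = H (v a) w $ I a * (\<Prod>b\<in>{..<m} - {a}. V b $ I b)" for I
        using that by (subst prod.remove[of _ a]) auto
      then show ?thesis
        using multilinear_components[OF multi[OF z0], of "V(a := H (v a) w)"] by (simp add: e_def)
    qed
    have "(\<Sum>I\<in>?P. (\<Sum>a<m. H (v a) w $ I a * (\<Prod>b\<in>{..<m} - {a}. V b $ I b)) * A (T y0) (e I)) =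
        (\<Sum>I\<in>?P. \<Sum>a<m. H (v a) w $ I a * (\<Prod>b\<in>{..<m} - {a}. V b $ I b) * A (T y0) (e I))"
      by (simp add: sum_distrib_right)
    also have "\<dots> = (\<Sum>a<m. \<Sum>I\<in>?P. H (v a) w $ I a * (\<Prod>b\<in>{..<m} - {a}. V b $ I b) * A (T y0) (e I))"
      by (rule sum.swap)
    also have "\<dots> = (\<Sum>a<m. A (T y0) (V(a := H (v a) w)))"
      by (intro sum.cong refl) (simp add: 2)
    finally show "(\<Sum>I\<in>?P. (\<Prod>a<m. V a $ I a) * A' (e I) (T' y0 w) +
        (\<Sum>a<m. H (v a) w $ I a * (\<Prod>b\<in>{..<m} - {a}. V b $ I b)) * A (T y0) (e I)) =
      A' V (T' y0 w) + (\<Sum>a<m. A (T y0) (V(a := H (v a) w)))"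
      by (simp add: sum.distrib 1)
  qed
  finally show ?thesis unfolding V_def .
qed

text \<open>Here \<open>A'\<close> and \<open>B'\<close> are the derivatives of a form and of its pullback, so both sides are values of
  exterior derivatives; \<open>H\<close> is the second derivative of the map.\<close>

lemma antisymmetrized_pullback:
  fixes A :: "'n::finite covector" and T' :: "real ^ 'n \<Rightarrow> real ^ 'n"
  assumes A: "alternating m A" and H: "\<And>v w. H v w = H w v"
    and B': "\<And>v w. B' v w = A' (\<lambda>i. T' (v i)) (T' w) + (\<Sum>a<m. A ((\<lambda>i. T' (v i))(a := H (v a) w)))"
  shows "(\<Sum>i\<le>m. (-1) ^ i * B' (skip i v) (v i)) =
    (\<Sum>i\<le>m. (-1) ^ i * A' (skip i (\<lambda>i. T' (v i))) (T' (v i)))"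
proof -
  let ?V = "\<lambda>i. T' (v i)"
  have skip_T: "(\<lambda>j. T' (skip i v j)) = skip i ?V" and skip_id: "skip i v a = v (skip i id a)" for i a
    by (auto simp: skip_def)
  have "(\<Sum>i\<le>m. (-1) ^ i * B' (skip i v) (v i)) =
      (\<Sum>i\<le>m. (-1) ^ i * A' (skip i ?V) (T' (v i))) +
      (\<Sum>i\<le>m. (-1) ^ i * (\<Sum>a<m. A ((skip i ?V)(a := H (v (skip i id a)) (v i)))))"
    unfolding B' skip_T by (simp add: distrib_left sum.distrib flip: skip_id)
  also have "(\<Sum>i\<le>m. (-1) ^ i * (\<Sum>a<m. A ((skip i ?V)(a := H (v (skip i id a)) (v i))))) = 0"
    by (rule second_derivative_terms_cancel[OF A, of "\<lambda>p i. H (v p) (v i)"]) (rule H)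
  finally show ?thesis by simp
qed

section \<open>Test forms\<close>

lemma Ck_on_cong:
  assumes "open S" "\<And>x. x \<in> S \<Longrightarrow> f x = g x" "Ck_on m S f"
  shows "Ck_on m S g"
  using assms(2,3)
proof (induction m arbitrary: f g)
  case 0
  then show ?case using continuous_on_eq by auto
next
  case (Suc m)
  have g: "(g has_derivative frechet_derivative f (at x)) (at x)" if "x \<in> S" for x
  proof (rule has_derivative_transform_within_open[OF _ assms(1) that Suc.prems(1)])
    show "(f has_derivative frechet_derivative f (at x)) (at x)"
      using Suc.prems(2) that by (simp add: frechet_derivative_works)
  qed
  have "Ck_on m S (\<lambda>x. frechet_derivative g (at x) v)" for v
  proof (rule Suc.IH)
    show "frechet_derivative f (at x) v = frechet_derivative g (at x) v" if "x \<in> S" for x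
      using frechet_derivative_at[OF g[OF that]] by (rule fun_cong)
    show "Ck_on m S (\<lambda>x. frechet_derivative f (at x) v)"
      using Suc.prems(2) by simp
  qed
  then show ?case using g unfolding Ck_on.simps by (blast intro: differentiableI)
qed

lemma Ck_on_local:
  assumes "\<And>x. x \<in> S \<Longrightarrow> \<exists>W. open W \<and> x \<in> W \<and> Ck_on m W f"
  shows "Ck_on m S f"
  using assms
proof (induction m arbitrary: f)
  case 0
  have "continuous (at x within S) f" if "x \<in> S" for x
  proof -
    obtain W where "open W" "x \<in> W" "continuous_on W f" using 0[OF \<open>x \<in> S\<close>] by auto
    then have "isCont f x" by (simp add: continuous_on_eq_continuous_at)
    then show ?thesis by (rule continuous_at_imp_continuous_at_within)
  qed
  then show ?case by (simp add: continuous_on_eq_continuous_within)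
next
  case (Suc m)
  have "Ck_on m S (\<lambda>x. frechet_derivative f (at x) v)" for v
  proof (rule Suc.IH)
    fix x assume "x \<in> S"
    then obtain W where "open W" "x \<in> W" "Ck_on (Suc m) W f" using Suc.prems by blast
    then show "\<exists>W. open W \<and> x \<in> W \<and> Ck_on m W (\<lambda>x. frechet_derivative f (at x) v)" by auto
  qed
  moreover have "f differentiable (at x)" if x: "x \<in> S" for x
  proof -
    obtain W where "x \<in> W" "Ck_on (Suc m) W f" using Suc.prems[OF x] by blast
    then show ?thesis by simp
  qed
  ultimately show ?case by simp
qed

lemma Ck_on_subset: "Ck_on m S f \<Longrightarrow> S' \<subseteq> S \<Longrightarrow> Ck_on m S' f"
  by (induction m arbitrary: f) (auto intro: continuous_on_subset)

text \<open>At interior points the local extensions coincide with the function itself.\<close>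

lemma smooth_on_interior:
  assumes "smooth_on S f"
  shows "Ck_on m (interior S) f"
proof (rule Ck_on_local)
  fix x assume x: "x \<in> interior S"
  then have "x \<in> S" using interior_subset by blast
  then obtain W F where W: "open W" "x \<in> W" "\<forall>m. Ck_on m W F" "\<forall>y\<in>S \<inter> W. F y = f y"
    using bspec[OF assms[unfolded smooth_on_def] \<open>x \<in> S\<close>] by (elim exE conjE)
  have "Ck_on m (W \<inter> interior S) f"
  proof (rule Ck_on_cong)
    show "open (W \<inter> interior S)" by (intro open_Int open_interior W(1))
    show "F y = f y" if "y \<in> W \<inter> interior S" for y
      using that W(4) interior_subset by blast
    show "Ck_on m (W \<inter> interior S) F"
      by (rule Ck_on_subset[OF W(3)[THEN spec]]) simp
  qed
  then show "\<exists>W. open W \<and> x \<in> W \<and> Ck_on m W f"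
    using W(1,2) x by (intro exI[of _ "W \<inter> interior S"]) auto
qed

lemma Ck_on_has_derivative:
  "Ck_on (Suc m) S f \<Longrightarrow> x \<in> S \<Longrightarrow> (f has_derivative frechet_derivative f (at x)) (at x)"
  by (simp add: frechet_derivative_works)

lemma Ck_on_symmetric:
  assumes "open S" "y \<in> S" "Ck_on (Suc (Suc 0)) S f"
  shows "frechet_derivative (\<lambda>z. frechet_derivative f (at z) v) (at y) w =
    frechet_derivative (\<lambda>z. frechet_derivative f (at z) w) (at y) v"
proof (rule symmetric_second_derivative[OF assms(1,2)])
  have C: "Ck_on (Suc 0) S (\<lambda>z. frechet_derivative f (at z) u)" for u
    using assms(3) by simp
  show "(f has_derivative frechet_derivative f (at x)) (at x)" if "x \<in> S" for x
    by (rule Ck_on_has_derivative[OF assms(3) that])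
  show "((\<lambda>z. frechet_derivative f (at z) v) has_derivative
      frechet_derivative (\<lambda>z. frechet_derivative f (at z) v) (at x)) (at x)" if "x \<in> S" for x
    by (rule Ck_on_has_derivative[OF C that])
  show "((\<lambda>z. frechet_derivative f (at z) w) has_derivative
      frechet_derivative (\<lambda>z. frechet_derivative f (at z) w) (at x)) (at x)" if "x \<in> S" for x
    by (rule Ck_on_has_derivative[OF C that])
  show "continuous_on S (\<lambda>x. frechet_derivative (\<lambda>z. frechet_derivative f (at z) v) (at x) w)"
    and "continuous_on S (\<lambda>x. frechet_derivative (\<lambda>z. frechet_derivative f (at z) w) (at x) v)"
    using C by simp_all
qed

context riemannian_measure
begin

lemma chart_inv_mem: "c \<in> atlas X \<Longrightarrow> y \<in> interior (snd c ` fst c) \<Longrightarrow> chart_inv c y \<in> fst c"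
  using interior_subset chart_inv_chart by fastforce

lemma open_interior_preimage:
  assumes "c \<in> atlas X" "open V"
  shows "open (interior (snd c ` fst c) \<inter> chart_inv c -` V)"
  by (intro continuous_open_preimage open_interior assms
      continuous_on_subset[OF chart_inv_continuous interior_subset])

lemma interior_overlap:
  assumes "x \<in> manifold_interior X" and c: "c \<in> atlas X" "x \<in> fst c" and c': "c' \<in> atlas X" "x \<in> fst c'"
  shows "snd c x \<in> interior (snd c ` (fst c \<inter> fst c'))"
proof (rule interiorI)
  show "open (interior (snd c ` fst c) \<inter> chart_inv c -` fst c')"
    by (rule open_interior_preimage[OF c(1) chart_open[OF c'(1)]])
  show "snd c x \<in> interior (snd c ` fst c) \<inter> chart_inv c -` fst c'"
    using interior_in_every_chart[OF assms(1) c] c' by (simp add: chart_inv_chart c)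
  show "interior (snd c ` fst c) \<inter> chart_inv c -` fst c' \<subseteq> snd c ` (fst c \<inter> fst c')"
  proof
    fix y assume y: "y \<in> interior (snd c ` fst c) \<inter> chart_inv c -` fst c'"
    then obtain p where p: "p \<in> fst c" "y = snd c p" using interior_subset by blast
    with y have "p \<in> fst c'" by (simp add: chart_inv_chart c)
    with p show "y \<in> snd c ` (fst c \<inter> fst c')" by blast
  qed
qed

lemma smooth_form_smooth_on:
  "smooth_form X m u \<Longrightarrow> c \<in> atlas X \<Longrightarrow> smooth_on (snd c ` fst c) (\<lambda>y. u c (chart_inv c y) v)"
  by (simp add: smooth_form_def)

lemma smooth_form_is_form: "smooth_form X m u \<Longrightarrow> is_form X m u"
  by (simp add: smooth_form_def)

lemma smooth_form_has_derivative:
  assumes "smooth_form X m u" "c \<in> atlas X" "y \<in> interior (snd c ` fst c)"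
  shows "((\<lambda>z. u c (chart_inv c z) v) has_derivative
    frechet_derivative (\<lambda>z. u c (chart_inv c z) v) (at y)) (at y)"
  by (rule Ck_on_has_derivative[OF smooth_on_interior[OF smooth_form_smooth_on[OF assms(1,2)]] assms(3)])

lemma ext_deriv_interior:
  assumes "x \<in> manifold_interior X" "c \<in> atlas X" "x \<in> fst c"
  shows "ext_deriv m u c x v = (\<Sum>i\<le>m. (-1) ^ i *
    frechet_derivative (\<lambda>y. u c (chart_inv c y) (skip i v)) (at (snd c x)) (v i))"
  unfolding ext_deriv_def skip_def at_within_interior[OF interior_in_every_chart[OF assms]] ..

lemma ext_deriv_multilinear:
  assumes u: "smooth_form X m u" and x: "x \<in> manifold_interior X" and c: "c \<in> atlas X" "x \<in> fst c"
  shows "multilinear (Suc m) (ext_deriv m u c x)"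
proof -
  let ?A' = "\<lambda>v. frechet_derivative (\<lambda>y. u c (chart_inv c y) v) (at (snd c x))"
  have int: "snd c x \<in> interior (snd c ` fst c)" by (rule interior_in_every_chart[OF x c])
  have "multilinear m (\<lambda>v. ?A' v w)" for w
  proof (rule multilinear_derivative[OF open_interior int])
    show "multilinear m (u c (chart_inv c z))" if "z \<in> interior (snd c ` fst c)" for z
      by (rule is_form_multilinear[OF smooth_form_is_form[OF u] c(1) chart_inv_mem[OF c(1) that]])
  qed (rule smooth_form_has_derivative[OF u c(1) int])
  moreover have "linear (?A' v)" for v
    by (rule has_derivative_linear[OF smooth_form_has_derivative[OF u c(1) int]])
  ultimately have "multilinear (Suc m) (\<lambda>v. \<Sum>i\<le>m. (-1) ^ i * ?A' (skip i v) (v i))"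
    by (rule multilinear_antisymmetrized)
  moreover have "ext_deriv m u c x = (\<lambda>v. \<Sum>i\<le>m. (-1) ^ i * ?A' (skip i v) (v i))"
    by (rule ext) (rule ext_deriv_interior[OF x c])
  ultimately show ?thesis by simp
qed

text \<open>By the product rule and the cancellation of second derivatives, the exterior derivative on the
  interior can be computed in any chart.\<close>

lemma ext_deriv_transition:
  assumes u: "smooth_form X m u" and x: "x \<in> manifold_interior X"
    and c: "c \<in> atlas X" "x \<in> fst c" and c': "c' \<in> atlas X" "x \<in> fst c'"
  shows "ext_deriv m u c x v = ext_deriv m u c' x (\<lambda>i. J c c' x (v i))"
proof -
  define T where "T = transition c c'"
  define y0 where "y0 = snd c x"
  define S where "S = interior (snd c ` (fst c \<inter> fst c'))"
  define T' where "T' y = J c c' (chart_inv c y)" for y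
  define H where "H v = frechet_derivative (\<lambda>z. frechet_derivative T (at z) v) (at y0)" for v
  define A' where "A' v = frechet_derivative (\<lambda>z. u c' (chart_inv c' z) v) (at (T y0))" for v
  define B' where "B' v = frechet_derivative (\<lambda>z. u c (chart_inv c z) v) (at y0)" for v
  have form: "is_form X m u" by (rule smooth_form_is_form[OF u])
  have S: "open S" "y0 \<in> S"
    using interior_overlap[OF x c c'] by (auto simp: S_def y0_def)
  have point: "\<exists>p. p \<in> fst c \<and> p \<in> fst c' \<and> y = snd c p \<and> p \<in> manifold_interior X" if "y \<in> S" for y
  proof -
    have "y \<in> snd c ` (fst c \<inter> fst c')"
      using that interior_subset unfolding S_def by blast
    then obtain p where p: "p \<in> fst c" "p \<in> fst c'" "y = snd c p" by blast
    have "interior (snd c ` (fst c \<inter> fst c')) \<subseteq> interior (snd c ` fst c)"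
      by (intro interior_mono) auto
    then have "p \<in> manifold_interior X"
      unfolding manifold_interior_def using that p c(1) unfolding S_def by blast
    with p show ?thesis by blast
  qed
  have T_smooth: "Ck_on l S T" for l
    unfolding S_def T_def by (rule smooth_on_interior[OF transition_smooth[OF c(1) c'(1)]])
  have T'_eq: "T' y = frechet_derivative T (at y)" if y: "y \<in> S" for y
  proof -
    obtain p where p: "p \<in> fst c" "y = snd c p" using point[OF y] by blast
    have "T' y = frechet_derivative T (at y within snd c ` (fst c \<inter> fst c'))"
      by (simp add: T'_def T_def p transition_deriv_def chart_inv_chart c)
    also have "at y within snd c ` (fst c \<inter> fst c') = at y"
      using y unfolding S_def by (rule at_within_interior)
    finally show ?thesis .
  qed
  have T'0: "T' y0 = J c c' x" by (simp add: T'_def y0_def chart_inv_chart c)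
  have Ty0: "T y0 = snd c' x" by (simp add: T_def y0_def transition_chart c)
  have pullback: "((\<lambda>y. u c (chart_inv c y) v) has_derivative (\<lambda>w. A' (\<lambda>i. T' y0 (v i)) (T' y0 w) +
      (\<Sum>a<m. u c' (chart_inv c' (T y0)) ((\<lambda>i. T' y0 (v i))(a := H (v a) w))))) (at y0)" for v
  proof (rule has_derivative_pullback[OF S open_interior, of T "snd c' ` fst c'"])
    show "T ` S \<subseteq> interior (snd c' ` fst c')"
    proof clarify
      fix y assume "y \<in> S"
      then obtain p where p: "p \<in> fst c" "p \<in> fst c'" "y = snd c p" "p \<in> manifold_interior X"
        using point by blast
      then show "T y \<in> interior (snd c' ` fst c')"
        using interior_in_every_chart[OF p(4) c'(1) p(2)] by (simp add: T_def transition_chart c)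
    qed
    show "multilinear m (u c' (chart_inv c' z))" if "z \<in> interior (snd c' ` fst c')" for z
      by (rule is_form_multilinear[OF form c'(1) chart_inv_mem[OF c'(1) that]])
    show "((\<lambda>z. u c' (chart_inv c' z) v) has_derivative A' v) (at (T y0))" for v
      unfolding A'_def Ty0
      by (rule smooth_form_has_derivative[OF u c'(1) interior_in_every_chart[OF x c']])
    show "(T has_derivative T' y0) (at y0)"
      unfolding T'_eq[OF S(2)] by (rule Ck_on_has_derivative[OF T_smooth S(2)])
    show "((\<lambda>y. T' y v) has_derivative H v) (at y0)" for v
    proof (rule has_derivative_transform_within_open[OF _ S])
      have "Ck_on (Suc 0) S (\<lambda>z. frechet_derivative T (at z) v)"
        using T_smooth[of "Suc (Suc 0)"] by simp
      from Ck_on_has_derivative[OF this S(2)]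
      show "((\<lambda>z. frechet_derivative T (at z) v) has_derivative H v) (at y0)" unfolding H_def .
    qed (simp add: T'_eq)
    show "u c (chart_inv c y) v = u c' (chart_inv c' (T y)) (\<lambda>i. T' y (v i))" if yS: "y \<in> S" for y v
    proof -
      obtain p where p: "p \<in> fst c" "p \<in> fst c'" "y = snd c p" using point[OF yS] by blast
      have "u c p v = u c' p (\<lambda>i. J c c' p (v i))"
        using form c(1) c'(1) p unfolding is_form_def by blast
      then show ?thesis
        by (simp add: p T_def T'_def transition_chart chart_inv_chart c(1) c'(1))
    qed
  qed
  have "B' v w = A' (\<lambda>i. T' y0 (v i)) (T' y0 w) +
      (\<Sum>a<m. u c' x ((\<lambda>i. T' y0 (v i))(a := H (v a) w)))" for v w
    using frechet_derivative_at[OF pullback[of v]] unfolding B'_def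
    by (simp add: Ty0 chart_inv_chart c' fun_eq_iff)
  moreover have "alternating m (u c' x)"
    using form c' unfolding is_form_def by blast
  moreover have "H v w = H w v" for v w
    unfolding H_def by (rule Ck_on_symmetric[OF S T_smooth])
  ultimately have "(\<Sum>i\<le>m. (-1) ^ i * B' (skip i v) (v i)) =
      (\<Sum>i\<le>m. (-1) ^ i * A' (skip i (\<lambda>i. T' y0 (v i))) (T' y0 (v i)))"
    by (intro antisymmetrized_pullback)
  then show ?thesis
    unfolding ext_deriv_interior[OF x c] ext_deriv_interior[OF x c'] B'_def A'_def T'0 y0_def[symmetric] Ty0 .
qed

lemma continuous_tensor_on_smooth_form:
  assumes u: "smooth_form X m u"
  shows "continuous_tensor_on U m u"
  unfolding continuous_tensor_on_def
proof (intro conjI ballI allI)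
  have form: "is_form X m u" by (rule smooth_form_is_form[OF u])
  show "multilinear m (u c x)" if "c \<in> atlas X" "x \<in> U \<inter> fst c" for c x
    using that is_form_multilinear[OF form] by blast
  show "u c x v = u c' x (\<lambda>i. J c c' x (v i))"
    if "c \<in> atlas X" "c' \<in> atlas X" "x \<in> U \<inter> fst c \<inter> fst c'" for c c' x v
    using form that unfolding is_form_def by blast
  fix c v assume c: "c \<in> atlas X"
  have "continuous_on (fst c) (\<lambda>x. u c (chart_inv c (snd c x)) v)"
    by (rule continuous_on_compose2[OF
        smooth_on_imp_continuous_on[OF smooth_form_smooth_on[OF u c]] chart_continuous[OF c]]) simp
  then have "continuous_on (fst c) (\<lambda>x. u c x v)"
    by (rule continuous_on_eq) (simp add: chart_inv_chart c)
  then show "continuous_on (U \<inter> fst c) (\<lambda>x. u c x v)"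
    by (rule continuous_on_subset) auto
qed

lemma continuous_tensor_on_ext_deriv:
  assumes u: "smooth_form X m u" and U: "U \<subseteq> manifold_interior X"
  shows "continuous_tensor_on U (Suc m) (ext_deriv m u)"
  unfolding continuous_tensor_on_def
proof (intro conjI ballI allI)
  show "multilinear (Suc m) (ext_deriv m u c x)" if "c \<in> atlas X" "x \<in> U \<inter> fst c" for c x
    using that U by (intro ext_deriv_multilinear[OF u]) auto
  show "ext_deriv m u c x v = ext_deriv m u c' x (\<lambda>i. J c c' x (v i))"
    if "c \<in> atlas X" "c' \<in> atlas X" "x \<in> U \<inter> fst c \<inter> fst c'" for c c' x v
    using that U by (intro ext_deriv_transition[OF u]) auto
  fix c v assume c: "c \<in> atlas X"
  have "continuous_on (U \<inter> fst c) (\<lambda>x. \<Sum>i\<le>m. (-1) ^ i *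
      frechet_derivative (\<lambda>y. u c (chart_inv c y) (skip i v)) (at (snd c x)) (v i))"
  proof (intro continuous_intros)
    fix i
    have "Ck_on (Suc 0) (interior (snd c ` fst c)) (\<lambda>y. u c (chart_inv c y) (skip i v))"
      by (rule smooth_on_interior[OF smooth_form_smooth_on[OF u c]])
    then have "continuous_on (interior (snd c ` fst c))
        (\<lambda>z. frechet_derivative (\<lambda>y. u c (chart_inv c y) (skip i v)) (at z) (v i))"
      by simp
    then show "continuous_on (U \<inter> fst c)
        (\<lambda>x. frechet_derivative (\<lambda>y. u c (chart_inv c y) (skip i v)) (at (snd c x)) (v i))"
    proof (rule continuous_on_compose2)
      show "continuous_on (U \<inter> fst c) (snd c)"
        by (rule continuous_on_subset[OF chart_continuous[OF c]]) auto
      show "snd c ` (U \<inter> fst c) \<subseteq> interior (snd c ` fst c)"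
        using U interior_in_every_chart[OF _ c] by blast
    qed
  qed
  then show "continuous_on (U \<inter> fst c) (\<lambda>x. ext_deriv m u c x v)"
    by (rule continuous_on_eq) (use U c in \<open>auto simp: ext_deriv_interior\<close>)
qed

lemma form_support_zero:
  assumes "c \<in> atlas X" "x \<in> fst c" "x \<notin> form_support X u"
  shows "u c x v = 0"
proof (rule ccontr)
  assume "u c x v \<noteq> 0"
  then have "x \<in> {x. \<exists>c\<in>atlas X. x \<in> fst c \<and> (\<exists>v. u c x v \<noteq> 0)}" using assms by blast
  then have "x \<in> form_support X u" unfolding form_support_def by (rule subsetD[OF closure_subset])
  with assms(3) show False by contradiction
qed

lemma ext_deriv_support_zero:
  assumes x: "x \<in> manifold_interior X" and c: "c \<in> atlas X" "x \<in> fst c" and "x \<notin> form_support X u"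
  shows "ext_deriv m u c x v = 0"
proof -
  have "open (- form_support X u)" unfolding form_support_def by (intro open_Compl closed_closure)
  then have N: "open (interior (snd c ` fst c) \<inter> chart_inv c -` (- form_support X u))"
    by (rule open_interior_preimage[OF c(1)])
  have y: "snd c x \<in> interior (snd c ` fst c) \<inter> chart_inv c -` (- form_support X u)"
    using interior_in_every_chart[OF x c] assms(4) by (simp add: chart_inv_chart c)
  have "((\<lambda>y. u c (chart_inv c y) w) has_derivative (\<lambda>h. 0)) (at (snd c x))" for w
  proof (rule has_derivative_transform_within_open[OF has_derivative_const[of 0] N y])
    fix z assume "z \<in> interior (snd c ` fst c) \<inter> chart_inv c -` (- form_support X u)"
    then show "0 = u c (chart_inv c z) w"
      using form_support_zero[OF c(1) chart_inv_mem[OF c(1)]] by simp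
  qed
  from frechet_derivative_at[OF this, symmetric]
  show ?thesis by (simp add: ext_deriv_interior[OF x c])
qed

end

section \<open>The weak differential as a closed relation\<close>

context riemannian_measure
begin

definition test_form :: "nat \<Rightarrow> 'a set \<Rightarrow> (('a, 'n) chart \<Rightarrow> 'a \<Rightarrow> real) \<Rightarrow> ('a, 'n) form \<Rightarrow> bool" where
  "test_form j U s u \<longleftrightarrow>
     open U \<and> connected U \<and> U \<subseteq> manifold_interior X \<and> orientation X U s \<and>
     smooth_form X (CARD('n) - j - 1) u \<and>
     compact (form_support X u) \<and> form_support X u \<subseteq> U"

definition differential_graph ::
    "(real \<Rightarrow> real) \<Rightarrow> (real \<Rightarrow> real) \<Rightarrow> nat \<Rightarrow> (('a, 'n) form \<times> ('a, 'n) form) set" where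
  "differential_graph \<Phi>1 \<Phi>2 j =
     {(\<beta>, \<omega>) \<in> Orlicz_forms X \<mu> \<Phi>1 j \<times> Orlicz_forms X \<mu> \<Phi>2 (j + 1). weak_differential X \<mu> j \<beta> \<omega>}"

text \<open>The two sides of the integral identity that defines the weak differential, up to sign.\<close>

definition coboundary_pairing ::
    "nat \<Rightarrow> 'a set \<Rightarrow> (('a, 'n) chart \<Rightarrow> 'a \<Rightarrow> real) \<Rightarrow> ('a, 'n) form \<Rightarrow> ('a, 'n) form \<Rightarrow> real" where
  "coboundary_pairing j U s u \<beta> =
     form_integral X \<mu> s U (wedge_form j (CARD('n) - j) \<beta> (ext_deriv (CARD('n) - j - 1) u))"

definition pairing ::
    "nat \<Rightarrow> 'a set \<Rightarrow> (('a, 'n) chart \<Rightarrow> 'a \<Rightarrow> real) \<Rightarrow> ('a, 'n) form \<Rightarrow> ('a, 'n) form \<Rightarrow> real" where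
  "pairing j U s u \<omega> = form_integral X \<mu> s U (wedge_form (j + 1) (CARD('n) - j - 1) \<omega> u)"

lemma differential_graph_iff:
  assumes "N_function \<Phi>1" "N_function \<Phi>2"
  shows "(\<beta>, \<omega>) \<in> differential_graph \<Phi>1 \<Phi>2 j \<longleftrightarrow>
    \<beta> \<in> Orlicz_forms X \<mu> \<Phi>1 j \<and> \<omega> \<in> Orlicz_forms X \<mu> \<Phi>2 (j + 1) \<and>
    (\<forall>U s u. test_form j U s u \<longrightarrow> coboundary_pairing j U s u \<beta> = (-1) ^ (j + 1) * pairing j U s u \<omega>)"
  using Orlicz_locally_integrable[OF assms(1), of \<beta> j] Orlicz_locally_integrable[OF assms(2), of \<omega> "j + 1"]
  unfolding differential_graph_def weak_differential_def test_form_def coboundary_pairing_def pairing_def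
  by auto

lemma
  assumes \<Phi>: "N_function \<Phi>" and t: "test_form j U s u" and j: "j < CARD('n)"
  shows coboundary_pairing_add: "\<omega> \<in> Orlicz_forms X \<mu> \<Phi> j \<Longrightarrow> \<eta> \<in> Orlicz_forms X \<mu> \<Phi> j \<Longrightarrow>
      coboundary_pairing j U s u (\<omega> + \<eta>) = coboundary_pairing j U s u \<omega> + coboundary_pairing j U s u \<eta>"
    and coboundary_pairing_scale: "\<omega> \<in> Orlicz_forms X \<mu> \<Phi> j \<Longrightarrow>
      coboundary_pairing j U s u (a *\<^sub>R \<omega>) = a * coboundary_pairing j U s u \<omega>"
    and coboundary_pairing_bounded: "\<exists>C\<ge>0. \<forall>\<omega>\<in>Orlicz_forms X \<mu> \<Phi> j.
      \<bar>coboundary_pairing j U s u \<omega>\<bar> \<le> C * gauge_norm X \<mu> \<Phi> j \<omega>"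
proof -
  have U: "open U" "U \<subseteq> manifold_interior X" "orientation X U s" and u: "smooth_form X (CARD('n) - j - 1) u"
    and K: "compact (form_support X u)" "form_support X u \<subseteq> U"
    using t by (auto simp: test_form_def)
  have du: "continuous_tensor_on U (CARD('n) - j) (ext_deriv (CARD('n) - j - 1) u)"
    using continuous_tensor_on_ext_deriv[OF u U(2)] j by (simp add: Suc_diff_Suc)
  have n: "j + (CARD('n) - j) = CARD('n)" using j by simp
  have supp: "ext_deriv (CARD('n) - j - 1) u c x v = 0"
    if "c \<in> atlas X" "x \<in> U \<inter> fst c" "x \<notin> form_support X u" for c x v
    using that U(2) by (intro ext_deriv_support_zero) auto
  note I = form_integral_continuous_linear[OF U(1,3) du n K supp \<Phi>]
  show "\<omega> \<in> Orlicz_forms X \<mu> \<Phi> j \<Longrightarrow> \<eta> \<in> Orlicz_forms X \<mu> \<Phi> j \<Longrightarrow>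
      coboundary_pairing j U s u (\<omega> + \<eta>) = coboundary_pairing j U s u \<omega> + coboundary_pairing j U s u \<eta>"
    unfolding coboundary_pairing_def by (rule I(1))
  show "\<omega> \<in> Orlicz_forms X \<mu> \<Phi> j \<Longrightarrow>
      coboundary_pairing j U s u (a *\<^sub>R \<omega>) = a * coboundary_pairing j U s u \<omega>"
    unfolding coboundary_pairing_def by (rule I(2))
  show "\<exists>C\<ge>0. \<forall>\<omega>\<in>Orlicz_forms X \<mu> \<Phi> j.
      \<bar>coboundary_pairing j U s u \<omega>\<bar> \<le> C * gauge_norm X \<mu> \<Phi> j \<omega>"
    unfolding coboundary_pairing_def by (rule I(3))
qed

lemma
  assumes \<Phi>: "N_function \<Phi>" and t: "test_form j U s u" and j: "j < CARD('n)"
  shows pairing_add: "\<omega> \<in> Orlicz_forms X \<mu> \<Phi> (j + 1) \<Longrightarrow> \<eta> \<in> Orlicz_forms X \<mu> \<Phi> (j + 1) \<Longrightarrow>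
      pairing j U s u (\<omega> + \<eta>) = pairing j U s u \<omega> + pairing j U s u \<eta>"
    and pairing_scale: "\<omega> \<in> Orlicz_forms X \<mu> \<Phi> (j + 1) \<Longrightarrow>
      pairing j U s u (a *\<^sub>R \<omega>) = a * pairing j U s u \<omega>"
    and pairing_bounded: "\<exists>C\<ge>0. \<forall>\<omega>\<in>Orlicz_forms X \<mu> \<Phi> (j + 1).
      \<bar>pairing j U s u \<omega>\<bar> \<le> C * gauge_norm X \<mu> \<Phi> (j + 1) \<omega>"
proof -
  have U: "open U" "orientation X U s" and u: "smooth_form X (CARD('n) - j - 1) u"
    and K: "compact (form_support X u)" "form_support X u \<subseteq> U"
    using t by (auto simp: test_form_def)
  have cont: "continuous_tensor_on U (CARD('n) - j - 1) u"
    by (rule continuous_tensor_on_smooth_form[OF u])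
  have n: "(j + 1) + (CARD('n) - j - 1) = CARD('n)" using j by simp
  have supp: "u c x v = 0" if "c \<in> atlas X" "x \<in> U \<inter> fst c" "x \<notin> form_support X u" for c x v
    using that by (intro form_support_zero) auto
  note I = form_integral_continuous_linear[OF U cont n K supp \<Phi>]
  show "\<omega> \<in> Orlicz_forms X \<mu> \<Phi> (j + 1) \<Longrightarrow> \<eta> \<in> Orlicz_forms X \<mu> \<Phi> (j + 1) \<Longrightarrow>
      pairing j U s u (\<omega> + \<eta>) = pairing j U s u \<omega> + pairing j U s u \<eta>"
    unfolding pairing_def by (rule I(1))
  show "\<omega> \<in> Orlicz_forms X \<mu> \<Phi> (j + 1) \<Longrightarrow>
      pairing j U s u (a *\<^sub>R \<omega>) = a * pairing j U s u \<omega>"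
    unfolding pairing_def by (rule I(2))
  show "\<exists>C\<ge>0. \<forall>\<omega>\<in>Orlicz_forms X \<mu> \<Phi> (j + 1).
      \<bar>pairing j U s u \<omega>\<bar> \<le> C * gauge_norm X \<mu> \<Phi> (j + 1) \<omega>"
    unfolding pairing_def by (rule I(3))
qed

lemma bounded_functional_tendsto:
  fixes I :: "('a, 'n) form \<Rightarrow> real"
  assumes \<Phi>: "N_function \<Phi>"
    and add: "\<And>\<omega> \<eta>. \<omega> \<in> Orlicz_forms X \<mu> \<Phi> k \<Longrightarrow> \<eta> \<in> Orlicz_forms X \<mu> \<Phi> k \<Longrightarrow> I (\<omega> + \<eta>) = I \<omega> + I \<eta>"
    and bound: "\<exists>C\<ge>0. \<forall>\<omega>\<in>Orlicz_forms X \<mu> \<Phi> k. \<bar>I \<omega>\<bar> \<le> C * gauge_norm X \<mu> \<Phi> k \<omega>"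
    and mem: "\<And>m. x m \<in> Orlicz_forms X \<mu> \<Phi> k" "\<omega> \<in> Orlicz_forms X \<mu> \<Phi> k"
    and lim: "(\<lambda>m. gauge_norm X \<mu> \<Phi> k (\<omega> - x m)) \<longlonglongrightarrow> 0"
  shows "(\<lambda>m. I (x m)) \<longlonglongrightarrow> I \<omega>"
proof -
  obtain C where C: "\<And>\<omega>. \<omega> \<in> Orlicz_forms X \<mu> \<Phi> k \<Longrightarrow> \<bar>I \<omega>\<bar> \<le> C * gauge_norm X \<mu> \<Phi> k \<omega>"
    using bound by blast
  have diff: "\<omega> - x m \<in> Orlicz_forms X \<mu> \<Phi> k" for m
    by (rule subspace_diff[OF Orlicz_subspace[OF \<Phi>] mem(2) mem(1)])
  have "I \<omega> - I (x m) = I (\<omega> - x m)" for m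
    using add[OF diff[of m] mem(1)[of m]] by simp
  then have le: "norm (I \<omega> - I (x m)) \<le> C * gauge_norm X \<mu> \<Phi> k (\<omega> - x m)" for m
    using C[OF diff[of m]] by simp
  have "(\<lambda>m. C * gauge_norm X \<mu> \<Phi> k (\<omega> - x m)) \<longlonglongrightarrow> 0"
    by (rule tendsto_mult_right_zero[OF lim])
  then have "(\<lambda>m. I \<omega> - I (x m)) \<longlonglongrightarrow> 0"
    by (rule Lim_null_comparison[OF always_eventually[OF allI[OF le]]])
  from tendsto_diff[OF tendsto_const[of "I \<omega>"] this] show ?thesis by simp
qed

text \<open>For each test form both sides of the integral identity that defines the weak differential are
  continuous linear functionals, so the identity survives limits in the gauge norms.\<close>

lemma closed_linear_relation_differential:
  assumes \<Phi>: "N_function \<Phi>1" "N_function \<Phi>2" and j: "j < CARD('n)"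
  shows "closed_linear_relation (Orlicz_forms X \<mu> \<Phi>1 j) (gauge_norm X \<mu> \<Phi>1 j)
    (Orlicz_forms X \<mu> \<Phi>2 (j + 1)) (gauge_norm X \<mu> \<Phi>2 (j + 1)) (differential_graph \<Phi>1 \<Phi>2 j)"
proof -
  let ?V = "Orlicz_forms X \<mu> \<Phi>1 j" and ?W = "Orlicz_forms X \<mu> \<Phi>2 (j + 1)"
  let ?G = "differential_graph \<Phi>1 \<Phi>2 j"
  interpret dom: complete_seminormed ?V "gauge_norm X \<mu> \<Phi>1 j"
    by (rule complete_seminormed_Orlicz[OF \<Phi>(1)])
  interpret cod: complete_seminormed ?W "gauge_norm X \<mu> \<Phi>2 (j + 1)"
    by (rule complete_seminormed_Orlicz[OF \<Phi>(2)])
  note iff = differential_graph_iff[OF \<Phi>]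
  note cadd = coboundary_pairing_add[OF \<Phi>(1) _ j] and cscale = coboundary_pairing_scale[OF \<Phi>(1) _ j]
  note padd = pairing_add[OF \<Phi>(2) _ j] and pscale = pairing_scale[OF \<Phi>(2) _ j]
  have add: "(\<beta> + \<beta>', \<omega> + \<omega>') \<in> ?G" if G: "(\<beta>, \<omega>) \<in> ?G" "(\<beta>', \<omega>') \<in> ?G" for \<beta> \<omega> \<beta>' \<omega>'
  proof -
    note G' = G(1)[unfolded iff] G(2)[unfolded iff]
    have "coboundary_pairing j U s u (\<beta> + \<beta>') = (-1) ^ (j + 1) * pairing j U s u (\<omega> + \<omega>')"
      if t: "test_form j U s u" for U s u
    proof -
      have "coboundary_pairing j U s u (\<beta> + \<beta>') = coboundary_pairing j U s u \<beta> + coboundary_pairing j U s u \<beta>'"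
        using G' by (intro cadd t) blast+
      also have "\<dots> = (-1) ^ (j + 1) * (pairing j U s u \<omega> + pairing j U s u \<omega>')"
        using G' t by (simp add: distrib_left)
      also have "pairing j U s u \<omega> + pairing j U s u \<omega>' = pairing j U s u (\<omega> + \<omega>')"
        using G' by (intro padd[symmetric] t) blast+
      finally show ?thesis .
    qed
    then show ?thesis using G' dom.add_mem cod.add_mem unfolding iff by blast
  qed
  have scale: "(a *\<^sub>R \<beta>, a *\<^sub>R \<omega>) \<in> ?G" if G: "(\<beta>, \<omega>) \<in> ?G" for a \<beta> \<omega>
  proof -
    note G' = G[unfolded iff]
    have "coboundary_pairing j U s u (a *\<^sub>R \<beta>) = (-1) ^ (j + 1) * pairing j U s u (a *\<^sub>R \<omega>)"
      if t: "test_form j U s u" for U s u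
    proof -
      have "coboundary_pairing j U s u (a *\<^sub>R \<beta>) = a * ((-1) ^ (j + 1) * pairing j U s u \<omega>)"
        using G' t cscale[OF t, of \<beta> a] by simp
      also have "\<dots> = (-1) ^ (j + 1) * (a * pairing j U s u \<omega>)"
        by (rule mult.left_commute)
      also have "a * pairing j U s u \<omega> = pairing j U s u (a *\<^sub>R \<omega>)"
        using G' by (intro pscale[symmetric] t) blast
      finally show ?thesis .
    qed
    then show ?thesis using G' dom.scale_mem cod.scale_mem unfolding iff by blast
  qed
  have zero: "(0, 0) \<in> ?G"
    unfolding iff
    using cscale[OF _ dom.zero_mem, of _ _ _ 0] pscale[OF _ cod.zero_mem, of _ _ _ 0] dom.zero_mem cod.zero_mem
    by simp
  show ?thesis
  proof unfold_locales
    show "subspace ?G"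
      unfolding subspace_def using add scale zero by (auto simp: zero_prod_def)
    show "?G \<subseteq> ?V \<times> ?W" by (auto simp: differential_graph_def)
    fix x y \<beta> \<omega>
    assume G: "\<And>m. (x m, y m) \<in> ?G" and mem: "\<beta> \<in> ?V" "\<omega> \<in> ?W"
      and lim: "(\<lambda>m. gauge_norm X \<mu> \<Phi>1 j (\<beta> - x m)) \<longlonglongrightarrow> 0"
        "(\<lambda>m. gauge_norm X \<mu> \<Phi>2 (j + 1) (\<omega> - y m)) \<longlonglongrightarrow> 0"
    have xy: "x m \<in> ?V" "y m \<in> ?W" for m using G[of m] unfolding iff by auto
    have "coboundary_pairing j U s u \<beta> = (-1) ^ (j + 1) * pairing j U s u \<omega>"
      if t: "test_form j U s u" for U s u
    proof (rule LIMSEQ_unique)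
      show "(\<lambda>m. coboundary_pairing j U s u (x m)) \<longlonglongrightarrow> coboundary_pairing j U s u \<beta>"
        by (rule bounded_functional_tendsto[OF \<Phi>(1) coboundary_pairing_add[OF \<Phi>(1) t j]
              coboundary_pairing_bounded[OF \<Phi>(1) t j] xy(1) mem(1) lim(1)])
      have "(\<lambda>m. pairing j U s u (y m)) \<longlonglongrightarrow> pairing j U s u \<omega>"
        by (rule bounded_functional_tendsto[OF \<Phi>(2) pairing_add[OF \<Phi>(2) t j]
              pairing_bounded[OF \<Phi>(2) t j] xy(2) mem(2) lim(2)])
      then have "(\<lambda>m. (-1) ^ (j + 1) * pairing j U s u (y m)) \<longlonglongrightarrow> (-1) ^ (j + 1) * pairing j U s u \<omega>"
        by (rule tendsto_mult[OF tendsto_const])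
      moreover have "(-1) ^ (j + 1) * pairing j U s u (y m) = coboundary_pairing j U s u (x m)" for m
        using G[of m] t unfolding iff by simp
      ultimately show "(\<lambda>m. coboundary_pairing j U s u (x m)) \<longlonglongrightarrow> (-1) ^ (j + 1) * pairing j U s u \<omega>"
        by simp
    qed
    with mem show "(\<beta>, \<omega>) \<in> ?G" unfolding iff by blast
  qed
qed

end

section \<open>Vanishing torsion\<close>

lemma cosets_eq_singleton_iff:
  fixes B C :: "'v::real_vector set"
  assumes B: "subspace B" and "B \<subseteq> C"
  shows "C // {(x, y). x \<in> C \<and> y \<in> C \<and> x - y \<in> B} = {B} \<longleftrightarrow> C \<subseteq> B"
proof
  let ?r = "{(x, y). x \<in> C \<and> y \<in> C \<and> x - y \<in> B}"
  have 0: "0 \<in> B" by (rule subspace_0[OF B])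
  show "C \<subseteq> B" if quot: "C // ?r = {B}"
  proof
    fix x assume x: "x \<in> C"
    then have "?r `` {x} \<in> C // ?r" by (rule quotientI)
    then have "?r `` {x} = B" using quot by simp
    moreover have "x \<in> ?r `` {x}" using x 0 by simp
    ultimately show "x \<in> B" by simp
  qed
  show "C // ?r = {B}" if "C \<subseteq> B"
  proof -
    have "C = B" using that assms(2) by simp
    then have "?r `` {x} = B" if "x \<in> B" for x
      using that subspace_diff[OF B] by auto
    then show ?thesis
      using 0 \<open>C = B\<close> by (auto simp: quotient_def)
  qed
qed

theorem theorem3p4:
  fixes X :: "('a::{t2_space, second_countable_topology}, 'n::finite) riemannian"
    and \<mu> :: "'a measure" and \<Phi>1 \<Phi>2 :: "real \<Rightarrow> real" and k :: nat
  assumes "riemannian_manifold X"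
    and "riemannian_volume X \<mu>"
    and "N_function \<Phi>1" and "N_function \<Phi>2"
    and "1 \<le> k" and "k \<le> CARD('n)"
  shows "(torsion X \<mu> \<Phi>1 \<Phi>2 k = {exact_forms X \<mu> \<Phi>1 \<Phi>2 k} \<longrightarrow>
          (\<exists>C'::real. \<forall>\<theta>\<in>Omega_forms X \<mu> \<Phi>1 \<Phi>2 (k - 1).
            \<forall>d\<theta>\<in>Orlicz_forms X \<mu> \<Phi>2 k. weak_differential X \<mu> (k - 1) \<theta> d\<theta> \<longrightarrow>
              (\<exists>\<zeta>\<in>closed_forms X \<mu> \<Phi>1 (k - 1).
                 gauge_norm X \<mu> \<Phi>1 (k - 1) (\<theta> - \<zeta>) \<le> C' * gauge_norm X \<mu> \<Phi>2 k d\<theta>))) \<and>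
         (Delta2 \<Phi>2 \<and> nabla2 \<Phi>2 \<and>
          (\<exists>C'::real. \<forall>\<theta>\<in>Omega_forms X \<mu> \<Phi>1 \<Phi>2 (k - 1).
            \<forall>d\<theta>\<in>Orlicz_forms X \<mu> \<Phi>2 k. weak_differential X \<mu> (k - 1) \<theta> d\<theta> \<longrightarrow>
              (\<exists>\<zeta>\<in>closed_forms X \<mu> \<Phi>1 (k - 1).
                 gauge_norm X \<mu> \<Phi>1 (k - 1) (\<theta> - \<zeta>) \<le> C' * gauge_norm X \<mu> \<Phi>2 k d\<theta>)) \<longrightarrow>
          torsion X \<mu> \<Phi>1 \<Phi>2 k = {exact_forms X \<mu> \<Phi>1 \<Phi>2 k})"
proof -
  interpret riemannian_measure X \<mu>
    by unfold_locales (fact assms(1), fact assms(2))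
  define j where "j = k - 1"
  have k: "k = j + 1" and j: "j < CARD('n)" using assms(5,6) by (auto simp: j_def)
  let ?V = "Orlicz_forms X \<mu> \<Phi>1 j" and ?W = "Orlicz_forms X \<mu> \<Phi>2 (j + 1)"
  let ?G = "differential_graph \<Phi>1 \<Phi>2 j"
  interpret closed_linear_relation ?V "gauge_norm X \<mu> \<Phi>1 j" ?W "gauge_norm X \<mu> \<Phi>2 (j + 1)" ?G
    by (rule closed_linear_relation_differential[OF assms(3,4) j])
  let ?B = "exact_forms X \<mu> \<Phi>1 \<Phi>2 k" and ?C = "exact_forms_closure X \<mu> \<Phi>1 \<Phi>2 k"
  have B: "?B = Range ?G"
    by (auto simp: exact_forms_def differential_graph_def k)
  have C: "?C = {y \<in> ?W. \<forall>\<epsilon>>0. \<exists>z\<in>Range ?G. gauge_norm X \<mu> \<Phi>2 (j + 1) (y - z) < \<epsilon>}"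
    unfolding exact_forms_closure_def B by (simp add: k)
  have "?B \<subseteq> ?C"
  proof
    fix y assume y: "y \<in> ?B"
    then have R: "y \<in> Range ?G" "y \<in> ?W" using B Range_mem by auto
    have "gauge_norm X \<mu> \<Phi>2 (j + 1) (y - y) < \<epsilon>" if "\<epsilon> > 0" for \<epsilon> :: real
      using cod.zero that by simp
    with R show "y \<in> ?C" unfolding C by blast
  qed
  moreover have "subspace ?B" unfolding B by (rule Range_subspace)
  ultimately have "torsion X \<mu> \<Phi>1 \<Phi>2 k = {?B} \<longleftrightarrow> ?C \<subseteq> ?B"
    unfolding torsion_def by (intro cosets_eq_singleton_iff)
  also have "\<dots> \<longleftrightarrow> closed_range"
    unfolding closed_range_def B C by blast
  finally have torsion: "torsion X \<mu> \<Phi>1 \<Phi>2 k = {?B} \<longleftrightarrow> closed_range" .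
  have closed: "(\<zeta>, 0) \<in> ?G \<longleftrightarrow> \<zeta> \<in> closed_forms X \<mu> \<Phi>1 j" for \<zeta>
    using cod.zero_mem by (auto simp: differential_graph_def closed_forms_def zero_form_eq)
  have bounded: "bounded_below_mod_kernel C' \<longleftrightarrow>
      (\<forall>\<theta>\<in>Omega_forms X \<mu> \<Phi>1 \<Phi>2 (k - 1).
        \<forall>d\<theta>\<in>Orlicz_forms X \<mu> \<Phi>2 k. weak_differential X \<mu> (k - 1) \<theta> d\<theta> \<longrightarrow>
          (\<exists>\<zeta>\<in>closed_forms X \<mu> \<Phi>1 (k - 1).
             gauge_norm X \<mu> \<Phi>1 (k - 1) (\<theta> - \<zeta>) \<le> C' * gauge_norm X \<mu> \<Phi>2 k d\<theta>))" for C'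
  proof -
    have G: "(\<theta>, d\<theta>) \<in> ?G \<longleftrightarrow>
        \<theta> \<in> Omega_forms X \<mu> \<Phi>1 \<Phi>2 j \<and> d\<theta> \<in> ?W \<and> weak_differential X \<mu> j \<theta> d\<theta>" for \<theta> d\<theta>
      by (auto simp: differential_graph_def Omega_forms_def)
    have "bounded_below_mod_kernel C' \<longleftrightarrow> (\<forall>\<theta> d\<theta>. (\<theta>, d\<theta>) \<in> ?G \<longrightarrow> (\<exists>\<zeta>\<in>closed_forms X \<mu> \<Phi>1 j.
        gauge_norm X \<mu> \<Phi>1 j (\<theta> - \<zeta>) \<le> C' * gauge_norm X \<mu> \<Phi>2 (j + 1) d\<theta>))"
      unfolding bounded_below_mod_kernel_def closed by blast
    then show ?thesis
      unfolding G k add_diff_cancel_right' by blast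
  qed
  have "closed_range \<longleftrightarrow> (\<exists>C'. bounded_below_mod_kernel C')"
    using closed_range_imp_bounded_below bounded_below_imp_closed_range by blast
  then show ?thesis
    unfolding torsion bounded by blast
qed

end
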